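(* Let $V \models ZFC^-$ be transitive, $\mathbf{j}: V \preceq \hat{V}$ with $\hat V$ $\omega$-nonstandard, and $T \in V$ a complete countable theory. Then $\lambda_{\hat{V}}(T) \leq \lambda_{\hat{V}}^{loc}(T)$. If moreover $\hat{V}$ is $\aleph_1$-saturated, then $\lambda_{\hat{V}}(T) = \lambda_{\hat{V}}^{loc}(T) = \lambda_{\hat{V}}^{loc, 1}(T)$.
   Context: $ZFC^-$ is ZFC without power set, with collection and the well-ordering principle. $\hat V$ may be ill-founded; it is $\omega$-nonstandard if some element of $\hat\omega$ has infinitely many $\hat\in$-predecessors. Elements of $\hat V$ are identified with their sets of $\hat\in$-elements; $X\subseteq\hat V$ is pseudofinite if $X\subseteq\hat X$ for some $\hat X\in\hat V$ that $\hat V$ believes finite. Each complete countable theory comes with an injection of its symbols into $\omega$; for $M\in V$ a model of $T$ in language $\mathcal L$, $\mathbf j_{std}(M)$ is the reduct of $\mathbf j(M)$ to $\mathcal L$; it is $\kappa$-pseudosaturated if every complete type over any pseudofinite $A\subseteq\mathbf j_{std}(M)$ with $|A|<\kappa$ is realized. $\hat V$ $\kappa$-pseudosaturates $T$ if $\mathbf j_{std}(M)$ is $\kappa$-pseudosaturated for some (equivalently every) $M\models T$ in $V$. $\lambda_{\hat V}(T)$ is the least infinite cardinal $\lambda$ such that $\hat V$ does not $\lambda^+$-pseudosaturate $T$ ($\infty$ if none). A pattern on $I$ is a subset-closed $\Delta\subseteq[I]^{<\aleph_0}$. For $\Delta\in V$ a pattern on $I\in V$, $\lambda_{\hat V}(\Delta)$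 is the least $\lambda$ such that some pseudofinite $X\subseteq\mathbf j(I)$ with $|X|\le\lambda$ has all its finite subsets in $\mathbf j(\Delta)$ but is contained in no $\hat X\in\mathbf j(\Delta)$ ($\infty$ if none). For a formula $\varphi(\bar x,\bar y)$ of $T$ and $M\models T$, $\Delta_{M,\varphi}=\{s\in[M^{|\bar y|}]^{<\aleph_0}: M\models\exists\bar x\bigwedge_{\bar a\in s}\varphi(\bar x,\bar a)\}$; $\lambda_{\hat V}(T,\varphi):=\lambda_{\hat V}(\Delta_{M,\varphi})$ for any $M\models T$ in $V$ (independent of $M$). $\lambda^{loc,n}_{\hat V}(T)$ is the minimum of $\lambda_{\hat V}(T,\varphi)$ over formulas $\varphi(\bar x,\bar y)$ of $T$ with $|\bar x|\le n$, and $\lambda^{loc}_{\hat V}(T)=\min_n\lambda^{loc,n}_{\hat V}(T)$. *)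

theory Defs
  imports "HOL-Library.Equipollence"
begin

unbundle cardinal_syntax

section \<open>Cardinals of subsets of a type, with a top element\<close>

quotient_type 'a cardinal = "'a set" / "(\<approx>) :: 'a set \<Rightarrow> 'a set \<Rightarrow> bool"
  morphisms rep_cardinal cardinality
  by (rule equivpI) (auto intro: reflpI sympI transpI eqpoll_sym eqpoll_trans)

instantiation cardinal :: (type) linorder
begin

lift_definition less_eq_cardinal :: "'a cardinal \<Rightarrow> 'a cardinal \<Rightarrow> bool" is "(\<lesssim>)"
  by (meson eqpoll_sym lepoll_trans1 lepoll_trans2)

definition less_cardinal :: "'a cardinal \<Rightarrow> 'a cardinal \<Rightarrow> bool" where
  "less_cardinal c d \<longleftrightarrow> c \<le> d \<and> \<not> d \<le> c"

instance
proof
  fix x y z :: "'a cardinal"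
  show "x < y \<longleftrightarrow> x \<le> y \<and> \<not> y \<le> x" by (rule less_cardinal_def)
  show "x \<le> x" by transfer simp
  show "x \<le> y \<Longrightarrow> y \<le> z \<Longrightarrow> x \<le> z" by transfer (rule lepoll_trans)
  show "x \<le> y \<Longrightarrow> y \<le> x \<Longrightarrow> x = y" by transfer (rule lepoll_antisym)
  show "x \<le> y \<or> y \<le> x"
    by transfer (metis lepoll_def card_of_ordLeq ordLeq_total card_of_Well_order)
qed

end

lemma cardinality_le_iff: "cardinality A \<le> cardinality B \<longleftrightarrow> |A| \<le>o |B|"
  by (simp add: less_eq_cardinal.abs_eq lepoll_def card_of_ordLeq)

lemma cardinality_less_iff: "cardinality A < cardinality B \<longleftrightarrow> |A| <o |B|"
  by (simp add: less_cardinal_def cardinality_le_iff)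
     (metis card_of_Well_order not_ordLess_iff_ordLeq ordLess_imp_ordLeq)

lemma cardinality_surj: "\<exists>A. c = cardinality A"
  by (induct c rule: cardinal.abs_induct) blast

instance cardinal :: (type) wellorder
proof
  fix P :: "'a cardinal \<Rightarrow> bool" and c :: "'a cardinal"
  assume step: "\<And>x. (\<And>y. y < x \<Longrightarrow> P y) \<Longrightarrow> P x"
  have "P (cardinality A)" for A :: "'a set"
  proof (induction "|A|" arbitrary: A rule: wf_induct_rule[OF wf_ordLess])
    case (1 A)
    show ?case
    proof (rule step)
      fix y assume "y < cardinality A"
      then show "P y"
        using 1 cardinality_surj[of y] by (auto simp: cardinality_less_iff)
    qed
  qed
  then show "P c" using cardinality_surj[of c] by auto
qed

datatype 'a ecardinal = Cardinal "'a cardinal" | Infty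

instantiation ecardinal :: (type) linorder
begin

fun less_eq_ecardinal :: "'a ecardinal \<Rightarrow> 'a ecardinal \<Rightarrow> bool" where
  "less_eq_ecardinal _ Infty = True"
| "less_eq_ecardinal Infty (Cardinal d) = False"
| "less_eq_ecardinal (Cardinal c) (Cardinal d) = (c \<le> d)"

definition less_ecardinal :: "'a ecardinal \<Rightarrow> 'a ecardinal \<Rightarrow> bool" where
  "less_ecardinal c d \<longleftrightarrow> c \<le> d \<and> \<not> d \<le> c"

instance
proof
  fix x y z :: "'a ecardinal"
  show "x < y \<longleftrightarrow> x \<le> y \<and> \<not> y \<le> x" by (rule less_ecardinal_def)
  show "x \<le> x" by (cases x) auto
  show "x \<le> y \<Longrightarrow> y \<le> z \<Longrightarrow> x \<le> z" by (cases x; cases y; cases z) auto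
  show "x \<le> y \<Longrightarrow> y \<le> x \<Longrightarrow> x = y" by (cases x; cases y) auto
  show "x \<le> y \<or> y \<le> x" by (cases x; cases y) auto
qed

end

instance ecardinal :: (type) wellorder
proof
  fix P :: "'a ecardinal \<Rightarrow> bool" and c :: "'a ecardinal"
  assume step: "\<And>x. (\<And>y. y < x \<Longrightarrow> P y) \<Longrightarrow> P x"
  have *: "P (Cardinal d)" for d
  proof (induction d rule: less_induct)
    case (less d)
    show ?case
    proof (rule step)
      fix y assume "y < Cardinal d"
      then show "P y" using less by (cases y) (auto simp: less_ecardinal_def)
    qed
  qed
  show "P c"
  proof (cases c)
    case Infty
    show ?thesis unfolding Infty
    proof (rule step)
      fix y :: "'a ecardinal" assume "y < Infty"
      then show "P y" using * by (cases y) (auto simp: less_ecardinal_def)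
    qed
  qed (simp add: *)
qed

definition least_cardinal :: "('a cardinal \<Rightarrow> bool) \<Rightarrow> 'a ecardinal" where
  "least_cardinal P = (if \<exists>c. P c then Cardinal (LEAST c. P c) else Infty)"


section \<open>First-order logic over countable languages\<close>

text \<open>Symbols are named by natural numbers and carry their arity; a language is a set of
  symbols. This renders the convention that the symbols of a countable language are given
  together with an injection into \<open>\<omega>\<close>. Constants are function symbols of arity 0.\<close>

datatype sym = FunSym nat nat | RelSym nat nat

datatype trm = Var nat | Fn nat "trm list"

datatype fm = Equal trm trm | Rel nat "trm list" | Neg fm | And fm fm | All nat fm

primrec trm_syms :: "trm \<Rightarrow> sym set" where
  "trm_syms (Var x) = {}"
| "trm_syms (Fn f ts) = insert (FunSym f (length ts)) (\<Union> (set (map trm_syms ts)))"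

primrec syms :: "fm \<Rightarrow> sym set" where
  "syms (Equal s t) = trm_syms s \<union> trm_syms t"
| "syms (Rel r ts) = insert (RelSym r (length ts)) (\<Union> (set (map trm_syms ts)))"
| "syms (Neg \<phi>) = syms \<phi>"
| "syms (And \<phi> \<psi>) = syms \<phi> \<union> syms \<psi>"
| "syms (All x \<phi>) = syms \<phi>"

primrec trm_fv :: "trm \<Rightarrow> nat set" where
  "trm_fv (Var x) = {x}"
| "trm_fv (Fn f ts) = \<Union> (set (map trm_fv ts))"

primrec fv :: "fm \<Rightarrow> nat set" where
  "fv (Equal s t) = trm_fv s \<union> trm_fv t"
| "fv (Rel r ts) = \<Union> (set (map trm_fv ts))"
| "fv (Neg \<phi>) = fv \<phi>"
| "fv (And \<phi> \<psi>) = fv \<phi> \<union> fv \<psi>"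
| "fv (All x \<phi>) = fv \<phi> - {x}"

definition formulas :: "sym set \<Rightarrow> fm set" where
  "formulas L = {\<phi>. syms \<phi> \<subseteq> L}"

definition sentences :: "sym set \<Rightarrow> fm set" where
  "sentences L = {\<phi> \<in> formulas L. fv \<phi> = {}}"

record 'a fo_struct =
  univ :: "'a set"
  fn :: "nat \<Rightarrow> 'a list \<Rightarrow> 'a"
  rl :: "nat \<Rightarrow> 'a list \<Rightarrow> bool"

primrec tval :: "'a fo_struct \<Rightarrow> (nat \<Rightarrow> 'a) \<Rightarrow> trm \<Rightarrow> 'a" where
  "tval M e (Var x) = e x"
| "tval M e (Fn f ts) = fn M f (map (tval M e) ts)"

primrec sat :: "'a fo_struct \<Rightarrow> (nat \<Rightarrow> 'a) \<Rightarrow> fm \<Rightarrow> bool" where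
  "sat M e (Equal s t) \<longleftrightarrow> tval M e s = tval M e t"
| "sat M e (Rel r ts) \<longleftrightarrow> rl M r (map (tval M e) ts)"
| "sat M e (Neg \<phi>) \<longleftrightarrow> \<not> sat M e \<phi>"
| "sat M e (And \<phi> \<psi>) \<longleftrightarrow> sat M e \<phi> \<and> sat M e \<psi>"
| "sat M e (All x \<phi>) \<longleftrightarrow> (\<forall>a\<in>univ M. sat M (e(x := a)) \<phi>)"

definition holds :: "'a fo_struct \<Rightarrow> fm \<Rightarrow> bool" where
  "holds M \<phi> \<longleftrightarrow> (\<forall>e. range e \<subseteq> univ M \<longrightarrow> sat M e \<phi>)"

definition elementary_embedding ::
  "sym set \<Rightarrow> 'a fo_struct \<Rightarrow> 'b fo_struct \<Rightarrow> ('a \<Rightarrow> 'b) \<Rightarrow> bool" where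
  "elementary_embedding L M N j \<longleftrightarrow> j ` univ M \<subseteq> univ N \<and>
     (\<forall>\<phi>\<in>formulas L. \<forall>e. range e \<subseteq> univ M \<longrightarrow> (sat M e \<phi> \<longleftrightarrow> sat N (j \<circ> e) \<phi>))"

text \<open>A pair \<open>(\<phi>, as)\<close> stands for the formula \<open>\<phi>(x\<^sub>0, \<dots>, x\<^sub>n\<^sub>-\<^sub>1, as)\<close> with parameters \<open>as\<close>: the
  variables below \<open>n\<close> are those of the type, variable \<open>n + i\<close> is replaced by the \<open>i\<close>-th
  parameter.\<close>

definition param_formulas :: "sym set \<Rightarrow> 'a set \<Rightarrow> nat \<Rightarrow> (fm \<times> 'a list) set" where
  "param_formulas L A n =
     {(\<phi>, as). \<phi> \<in> formulas L \<and> set as \<subseteq> A \<and> fv \<phi> \<subseteq> {..<n + length as}}"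

definition satisfies_all :: "'a fo_struct \<Rightarrow> 'a list \<Rightarrow> (fm \<times> 'a list) set \<Rightarrow> bool" where
  "satisfies_all M b p \<longleftrightarrow> (\<forall>(\<phi>, as)\<in>p. sat M ((!) (b @ as)) \<phi>)"

definition tuples :: "'a set \<Rightarrow> nat \<Rightarrow> 'a list set" where
  "tuples D n = {b. length b = n \<and> set b \<subseteq> D}"

definition complete_type ::
  "sym set \<Rightarrow> 'a fo_struct \<Rightarrow> 'a set \<Rightarrow> nat \<Rightarrow> (fm \<times> 'a list) set \<Rightarrow> bool" where
  "complete_type L M A n p \<longleftrightarrow>
     p \<subseteq> param_formulas L A n \<and>
     (\<forall>q\<subseteq>p. finite q \<longrightarrow> (\<exists>b\<in>tuples (univ M) n. satisfies_all M b q)) \<and>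
     (\<forall>(\<phi>, as)\<in>param_formulas L A n. (\<phi>, as) \<in> p \<or> (Neg \<phi>, as) \<in> p)"

definition realizes_types_over :: "sym set \<Rightarrow> 'a fo_struct \<Rightarrow> 'a set \<Rightarrow> bool" where
  "realizes_types_over L M A \<longleftrightarrow>
     (\<forall>n p. complete_type L M A n p \<longrightarrow> (\<exists>b\<in>tuples (univ M) n. satisfies_all M b p))"

definition saturated :: "'k rel \<Rightarrow> sym set \<Rightarrow> 'a fo_struct \<Rightarrow> bool" where
  "saturated \<kappa> L M \<longleftrightarrow> (\<forall>A\<subseteq>univ M. |A| <o \<kappa> \<longrightarrow> realizes_types_over L M A)"


section \<open>Structures for the language of set theory\<close>

text \<open>A structure for the language of set theory is a type with a membership relation \<open>V\<close>;
  \<open>V x a\<close> reads \<open>x \<in> a\<close>. Notions defined below with quantifiers ranging over the whole type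
  are thereby the notions relativized to \<open>V\<close>.\<close>

definition set_lang :: "sym set" where
  "set_lang = {RelSym 0 2}"

definition set_struct :: "('v \<Rightarrow> 'v \<Rightarrow> bool) \<Rightarrow> 'v fo_struct" where
  "set_struct V = \<lparr>univ = UNIV, fn = (\<lambda>_ _. undefined), rl = (\<lambda>_ as. V (as ! 0) (as ! 1))\<rparr>"

definition ext :: "('v \<Rightarrow> 'v \<Rightarrow> bool) \<Rightarrow> 'v \<Rightarrow> 'v set" where
  "ext V a = {x. V x a}"

definition in_model :: "('v \<Rightarrow> 'v \<Rightarrow> bool) \<Rightarrow> 'v set \<Rightarrow> bool" where
  "in_model V X \<longleftrightarrow> (\<exists>a. ext V a = X)"

definition elem :: "('v \<Rightarrow> 'v \<Rightarrow> bool) \<Rightarrow> 'v set \<Rightarrow> 'v" where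
  "elem V X = (THE a. ext V a = X)"

definition opair :: "('v \<Rightarrow> 'v \<Rightarrow> bool) \<Rightarrow> 'v \<Rightarrow> 'v \<Rightarrow> 'v" where
  "opair V x y = elem V {elem V {x}, elem V {x, y}}"

definition succ_elem :: "('v \<Rightarrow> 'v \<Rightarrow> bool) \<Rightarrow> 'v \<Rightarrow> 'v" where
  "succ_elem V x = elem V (insert x (ext V x))"

definition inductive_elem :: "('v \<Rightarrow> 'v \<Rightarrow> bool) \<Rightarrow> 'v \<Rightarrow> bool" where
  "inductive_elem V w \<longleftrightarrow> V (elem V {}) w \<and> (\<forall>x. V x w \<longrightarrow> V (succ_elem V x) w)"

definition omega :: "('v \<Rightarrow> 'v \<Rightarrow> bool) \<Rightarrow> 'v" where
  "omega V = (THE w. inductive_elem V w \<and> (\<forall>i. inductive_elem V i \<longrightarrow> ext V w \<subseteq> ext V i))"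

primrec num :: "('v \<Rightarrow> 'v \<Rightarrow> bool) \<Rightarrow> nat \<Rightarrow> 'v" where
  "num V 0 = elem V {}"
| "num V (Suc n) = succ_elem V (num V n)"

text \<open>\<open>function_on V f X Y\<close>: the element \<open>f\<close> is the graph of a function from \<open>X\<close> to \<open>Y\<close>.\<close>

definition function_on :: "('v \<Rightarrow> 'v \<Rightarrow> bool) \<Rightarrow> 'v \<Rightarrow> 'v set \<Rightarrow> 'v set \<Rightarrow> bool" where
  "function_on V f X Y \<longleftrightarrow>
     (\<forall>p. V p f \<longrightarrow> (\<exists>x\<in>X. \<exists>y\<in>Y. p = opair V x y)) \<and>
     (\<forall>x\<in>X. \<exists>!y. V (opair V x y) f)"

definition app :: "('v \<Rightarrow> 'v \<Rightarrow> bool) \<Rightarrow> 'v \<Rightarrow> 'v \<Rightarrow> 'v" where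
  "app V f x = (THE y. V (opair V x y) f)"

definition believes_finite :: "('v \<Rightarrow> 'v \<Rightarrow> bool) \<Rightarrow> 'v \<Rightarrow> bool" where
  "believes_finite V a \<longleftrightarrow>
     (\<exists>n f. V n (omega V) \<and> function_on V f (ext V a) (ext V n) \<and>
            bij_betw (app V f) (ext V a) (ext V n))"

text \<open>ZFC without power set, with the separation and collection schemes (arbitrary
  parameters, supplied by the assignment \<open>e\<close>) and the well-ordering principle.\<close>

definition zfc_minus :: "('v \<Rightarrow> 'v \<Rightarrow> bool) \<Rightarrow> bool" where
  "zfc_minus V \<longleftrightarrow>
     \<comment> \<open>extensionality\<close>
     (\<forall>a b. (\<forall>x. V x a \<longleftrightarrow> V x b) \<longrightarrow> a = b) \<and>
     \<comment> \<open>foundation\<close>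
     (\<forall>a. (\<exists>x. V x a) \<longrightarrow> (\<exists>x. V x a \<and> \<not> (\<exists>y. V y x \<and> V y a))) \<and>
     \<comment> \<open>pairing\<close>
     (\<forall>a b. \<exists>c. \<forall>x. V x c \<longleftrightarrow> x = a \<or> x = b) \<and>
     \<comment> \<open>union\<close>
     (\<forall>a. \<exists>u. \<forall>x. V x u \<longleftrightarrow> (\<exists>y. V y a \<and> V x y)) \<and>
     \<comment> \<open>infinity\<close>
     (\<exists>w. (\<exists>z. V z w \<and> (\<forall>x. \<not> V x z)) \<and>
          (\<forall>x. V x w \<longrightarrow> (\<exists>y. V y w \<and> (\<forall>z. V z y \<longleftrightarrow> V z x \<or> z = x)))) \<and>
     \<comment> \<open>separation\<close>
     (\<forall>\<phi>\<in>formulas set_lang. \<forall>e a. \<exists>b. \<forall>x. V x b \<longleftrightarrow> V x a \<and> sat (set_struct V) (e(0 := x)) \<phi>) \<and>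
     \<comment> \<open>collection\<close>
     (\<forall>\<phi>\<in>formulas set_lang. \<forall>e a.
        (\<forall>x. V x a \<longrightarrow> (\<exists>y. sat (set_struct V) (e(0 := x, 1 := y)) \<phi>)) \<longrightarrow>
        (\<exists>b. \<forall>x. V x a \<longrightarrow> (\<exists>y. V y b \<and> sat (set_struct V) (e(0 := x, 1 := y)) \<phi>))) \<and>
     \<comment> \<open>well-ordering principle\<close>
     (\<forall>a. \<exists>r. let R = {(x, y). V x a \<and> V y a \<and> V (opair V x y) r} in
        irrefl R \<and> trans R \<and> total_on (ext V a) R \<and>
        (\<forall>b. ext V b \<subseteq> ext V a \<and> ext V b \<noteq> {} \<longrightarrow>
             (\<exists>x. V x b \<and> (\<forall>y. V y b \<and> y \<noteq> x \<longrightarrow> (x, y) \<in> R))))"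

text \<open>By Mostowski's theorem the well-founded extensional structures are, up to a unique
  isomorphism, the transitive sets with the true membership relation.\<close>

definition transitive_zfc_minus :: "('v \<Rightarrow> 'v \<Rightarrow> bool) \<Rightarrow> bool" where
  "transitive_zfc_minus V \<longleftrightarrow> wfp V \<and> zfc_minus V"

definition omega_nonstandard :: "('w \<Rightarrow> 'w \<Rightarrow> bool) \<Rightarrow> bool" where
  "omega_nonstandard W \<longleftrightarrow> (\<exists>n. W n (omega W) \<and> infinite (ext W n))"

definition pseudofinite :: "('w \<Rightarrow> 'w \<Rightarrow> bool) \<Rightarrow> 'w set \<Rightarrow> bool" where
  "pseudofinite W X \<longleftrightarrow> (\<exists>a. believes_finite W a \<and> X \<subseteq> ext W a)"


section \<open>Theories and their models in \<open>V\<close>\<close>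

text \<open>Finite sequences of standard length are coded as iterated ordered pairs.\<close>

primrec seq :: "('v \<Rightarrow> 'v \<Rightarrow> bool) \<Rightarrow> 'v list \<Rightarrow> 'v" where
  "seq V [] = elem V {}"
| "seq V (a # as) = opair V a (seq V as)"

primrec code_sym :: "('v \<Rightarrow> 'v \<Rightarrow> bool) \<Rightarrow> sym \<Rightarrow> 'v" where
  "code_sym V (FunSym f n) = opair V (num V 0) (opair V (num V f) (num V n))"
| "code_sym V (RelSym r n) = opair V (num V 1) (opair V (num V r) (num V n))"

primrec code_trm :: "('v \<Rightarrow> 'v \<Rightarrow> bool) \<Rightarrow> trm \<Rightarrow> 'v" where
  "code_trm V (Var x) = opair V (num V 0) (num V x)"
| "code_trm V (Fn f ts) = opair V (num V 1) (opair V (num V f) (seq V (map (code_trm V) ts)))"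

primrec code_fm :: "('v \<Rightarrow> 'v \<Rightarrow> bool) \<Rightarrow> fm \<Rightarrow> 'v" where
  "code_fm V (Equal s t) = opair V (num V 0) (opair V (code_trm V s) (code_trm V t))"
| "code_fm V (Rel r ts) = opair V (num V 1) (opair V (num V r) (seq V (map (code_trm V) ts)))"
| "code_fm V (Neg \<phi>) = opair V (num V 2) (code_fm V \<phi>)"
| "code_fm V (And \<phi> \<psi>) = opair V (num V 3) (opair V (code_fm V \<phi>) (code_fm V \<psi>))"
| "code_fm V (All x \<phi>) = opair V (num V 4) (opair V (num V x) (code_fm V \<phi>))"

text \<open>An \<open>L\<close>-structure in \<open>V\<close> is a pair \<open>(D, I)\<close> of a nonempty set and a function \<open>I\<close> that
  assigns to each \<open>n\<close>-ary symbol of \<open>L\<close> an \<open>n\<close>-ary function or relation on \<open>D\<close>.\<close>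

definition is_structure :: "('v \<Rightarrow> 'v \<Rightarrow> bool) \<Rightarrow> sym set \<Rightarrow> 'v \<Rightarrow> bool" where
  "is_structure V L M \<longleftrightarrow>
     (\<exists>D I. M = opair V D I \<and> ext V D \<noteq> {} \<and> function_on V I (code_sym V ` L) UNIV \<and>
       (\<forall>f n. FunSym f n \<in> L \<longrightarrow>
          function_on V (app V I (code_sym V (FunSym f n))) (seq V ` tuples (ext V D) n) (ext V D)) \<and>
       (\<forall>r n. RelSym r n \<in> L \<longrightarrow>
          ext V (app V I (code_sym V (RelSym r n))) \<subseteq> seq V ` tuples (ext V D) n))"

definition str_dom :: "('v \<Rightarrow> 'v \<Rightarrow> bool) \<Rightarrow> 'v \<Rightarrow> 'v" where
  "str_dom V M = (THE D. \<exists>I. M = opair V D I)"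

definition str_int :: "('v \<Rightarrow> 'v \<Rightarrow> bool) \<Rightarrow> 'v \<Rightarrow> 'v" where
  "str_int V M = (THE I. \<exists>D. M = opair V D I)"

text \<open>The first-order structure coded by an element. Only symbols of standard name and arity are
  interpreted, so for \<open>M \<in> V\<close> an \<open>L\<close>-structure, \<open>decode W (j M)\<close> regarded as an
  \<open>L\<close>-structure is the reduct of \<open>j(M)\<close> from \<open>j(L)\<close> to \<open>L\<close>, where \<open>j\<close> maps the code of a
  symbol in \<open>V\<close> to its code in \<open>W\<close>.\<close>

definition decode :: "('v \<Rightarrow> 'v \<Rightarrow> bool) \<Rightarrow> 'v \<Rightarrow> 'v fo_struct" where
  "decode V M =
     \<lparr>univ = ext V (str_dom V M),
      fn = (\<lambda>f as. app V (app V (str_int V M) (code_sym V (FunSym f (length as)))) (seq V as)),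
      rl = (\<lambda>r as. V (seq V as) (app V (str_int V M) (code_sym V (RelSym r (length as)))))\<rparr>"

definition j_std :: "('w \<Rightarrow> 'w \<Rightarrow> bool) \<Rightarrow> ('v \<Rightarrow> 'w) \<Rightarrow> 'v \<Rightarrow> 'w fo_struct" where
  "j_std W j M = decode W (j M)"

definition is_model :: "('v \<Rightarrow> 'v \<Rightarrow> bool) \<Rightarrow> sym set \<Rightarrow> fm set \<Rightarrow> 'v \<Rightarrow> bool" where
  "is_model V L T M \<longleftrightarrow> is_structure V L M \<and> (\<forall>\<phi>\<in>T. holds (decode V M) \<phi>)"

text \<open>\<open>T \<in> V\<close> is a complete \<open>L\<close>-theory in the sense of \<open>V\<close>: a satisfiable set of sentences that
  entails each sentence or its negation.\<close>

definition complete_theory_in :: "('v \<Rightarrow> 'v \<Rightarrow> bool) \<Rightarrow> sym set \<Rightarrow> fm set \<Rightarrow> bool" where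
  "complete_theory_in V L T \<longleftrightarrow>
     in_model V (code_sym V ` L) \<and> in_model V (code_fm V ` T) \<and>
     T \<subseteq> sentences L \<and> (\<exists>M. is_model V L T M) \<and>
     (\<forall>\<phi>\<in>sentences L. (\<forall>M. is_model V L T M \<longrightarrow> holds (decode V M) \<phi>) \<or>
                      (\<forall>M. is_model V L T M \<longrightarrow> holds (decode V M) (Neg \<phi>)))"


section \<open>Pseudosaturation\<close>

definition pseudosaturated ::
  "('w \<Rightarrow> 'w \<Rightarrow> bool) \<Rightarrow> 'k rel \<Rightarrow> sym set \<Rightarrow> 'w fo_struct \<Rightarrow> bool" where
  "pseudosaturated W \<kappa> L N \<longleftrightarrow>
     (\<forall>A\<subseteq>univ N. pseudofinite W A \<and> |A| <o \<kappa> \<longrightarrow> realizes_types_over L N A)"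

definition pseudosaturates ::
  "('v \<Rightarrow> 'v \<Rightarrow> bool) \<Rightarrow> ('w \<Rightarrow> 'w \<Rightarrow> bool) \<Rightarrow> ('v \<Rightarrow> 'w) \<Rightarrow> 'k rel \<Rightarrow> sym set \<Rightarrow> fm set \<Rightarrow> bool" where
  "pseudosaturates V W j \<kappa> L T \<longleftrightarrow>
     (\<exists>M. is_model V L T M \<and> pseudosaturated W \<kappa> L (j_std W j M))"

text \<open>Only cardinals of subsets of the model \<open>W\<close> are considered here and in \<open>lambda_pattern\<close>.
  This loses nothing: if \<open>\<lambda>\<^sup>+\<close>-pseudosaturation fails for some infinite \<open>\<lambda>\<close>, it fails for some
  infinite \<open>\<lambda> \<le> |W|\<close>, since the sets \<open>A\<close> in question are subsets of \<open>W\<close>.\<close>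

definition lambda_theory ::
  "('v \<Rightarrow> 'v \<Rightarrow> bool) \<Rightarrow> ('w \<Rightarrow> 'w \<Rightarrow> bool) \<Rightarrow> ('v \<Rightarrow> 'w) \<Rightarrow> sym set \<Rightarrow> fm set \<Rightarrow> 'w ecardinal" where
  "lambda_theory V W j L T =
     least_cardinal (\<lambda>c. \<exists>X. c = cardinality X \<and> infinite X \<and>
                           \<not> pseudosaturates V W j (cardSuc |X| ) L T)"


section \<open>Patterns and local invariants\<close>

text \<open>In a transitive \<open>V\<close>, being finite in the sense of \<open>V\<close> is being finite, so that external
  finiteness is used on the \<open>V\<close> side.\<close>

definition is_pattern :: "('v \<Rightarrow> 'v \<Rightarrow> bool) \<Rightarrow> 'v \<Rightarrow> 'v \<Rightarrow> bool" where
  "is_pattern V I \<Delta> \<longleftrightarrow>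
     (\<forall>s. V s \<Delta> \<longrightarrow> finite (ext V s) \<and> ext V s \<subseteq> ext V I \<and>
          (\<forall>t. ext V t \<subseteq> ext V s \<longrightarrow> V t \<Delta>))"

definition lambda_pattern ::
  "('w \<Rightarrow> 'w \<Rightarrow> bool) \<Rightarrow> ('v \<Rightarrow> 'w) \<Rightarrow> 'v \<Rightarrow> 'v \<Rightarrow> 'w ecardinal" where
  "lambda_pattern W j I \<Delta> =
     least_cardinal (\<lambda>c. \<exists>X. pseudofinite W X \<and> X \<subseteq> ext W (j I) \<and> cardinality X \<le> c \<and>
        (\<forall>s\<subseteq>X. finite s \<longrightarrow> (\<exists>d. ext W d = s \<and> W d (j \<Delta>))) \<and>
        \<not> (\<exists>d. W d (j \<Delta>) \<and> X \<subseteq> ext W d))"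

text \<open>A partitioned formula \<open>\<phi>(x, y)\<close> with \<open>|x| = n\<close> and \<open>|y| = k\<close> has its free variables below
  \<open>n + k\<close>, the first \<open>n\<close> of which are the variables \<open>x\<close>.\<close>

definition partitioned_formulas :: "sym set \<Rightarrow> nat \<Rightarrow> nat \<Rightarrow> fm set" where
  "partitioned_formulas L n k = {\<phi> \<in> formulas L. fv \<phi> \<subseteq> {..<n + k}}"

definition power_elem :: "('v \<Rightarrow> 'v \<Rightarrow> bool) \<Rightarrow> 'v \<Rightarrow> nat \<Rightarrow> 'v" where
  "power_elem V M k = elem V (seq V ` tuples (univ (decode V M)) k)"

definition delta_set :: "('v \<Rightarrow> 'v \<Rightarrow> bool) \<Rightarrow> 'v \<Rightarrow> nat \<Rightarrow> nat \<Rightarrow> fm \<Rightarrow> 'v set" where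
  "delta_set V M n k \<phi> =
     {s. finite (ext V s) \<and> ext V s \<subseteq> seq V ` tuples (univ (decode V M)) k \<and>
         (\<exists>b\<in>tuples (univ (decode V M)) n. \<forall>as\<in>tuples (univ (decode V M)) k.
            V (seq V as) s \<longrightarrow> sat (decode V M) ((!) (b @ as)) \<phi>)}"

definition delta_elem :: "('v \<Rightarrow> 'v \<Rightarrow> bool) \<Rightarrow> 'v \<Rightarrow> nat \<Rightarrow> nat \<Rightarrow> fm \<Rightarrow> 'v" where
  "delta_elem V M n k \<phi> = elem V (delta_set V M n k \<phi>)"

lemma is_pattern_delta:
  assumes "ext V I = seq V ` tuples (univ (decode V M)) k" and "ext V \<Delta> = delta_set V M n k \<phi>"
  shows "is_pattern V I \<Delta>"
proof -
  have *: "V s \<Delta> \<longleftrightarrow> s \<in> delta_set V M n k \<phi>" for s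
    using assms(2) by (auto simp: ext_def)
  show ?thesis
    unfolding is_pattern_def * assms(1)
  proof (intro allI impI conjI)
    fix s t assume s: "s \<in> delta_set V M n k \<phi>"
    show "finite (ext V s)" and "ext V s \<subseteq> seq V ` tuples (univ (decode V M)) k"
      using s by (simp_all add: delta_set_def)
    assume t: "ext V t \<subseteq> ext V s"
    then have "V x s" if "V x t" for x using that by (auto simp: ext_def)
    moreover have "finite (ext V t)" using s t by (auto simp: delta_set_def intro: finite_subset)
    ultimately show "t \<in> delta_set V M n k \<phi>"
      using s t unfolding delta_set_def mem_Collect_eq by (meson order_trans)
  qed
qed

text \<open>The value does not depend on the model \<open>M\<close> of \<open>T\<close> in \<open>V\<close>; an arbitrary one is chosen.\<close>

definition lambda_formula ::
  "('v \<Rightarrow> 'v \<Rightarrow> bool) \<Rightarrow> ('w \<Rightarrow> 'w \<Rightarrow> bool) \<Rightarrow> ('v \<Rightarrow> 'w) \<Rightarrow> sym set \<Rightarrow> fm set \<Rightarrow>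
   nat \<Rightarrow> nat \<Rightarrow> fm \<Rightarrow> 'w ecardinal" where
  "lambda_formula V W j L T n k \<phi> =
     (let M = (SOME M. is_model V L T M)
      in lambda_pattern W j (power_elem V M k) (delta_elem V M n k \<phi>))"

text \<open>Values in \<open>'w ecardinal\<close> are well-ordered, so the minima below exist.\<close>

definition lambda_loc_n ::
  "('v \<Rightarrow> 'v \<Rightarrow> bool) \<Rightarrow> ('w \<Rightarrow> 'w \<Rightarrow> bool) \<Rightarrow> ('v \<Rightarrow> 'w) \<Rightarrow> sym set \<Rightarrow> fm set \<Rightarrow> nat \<Rightarrow>
   'w ecardinal" where
  "lambda_loc_n V W j L T n =
     (LEAST c. \<exists>m k. m \<le> n \<and> (\<exists>\<phi>\<in>partitioned_formulas L m k. c = lambda_formula V W j L T m k \<phi>))"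

definition lambda_loc ::
  "('v \<Rightarrow> 'v \<Rightarrow> bool) \<Rightarrow> ('w \<Rightarrow> 'w \<Rightarrow> bool) \<Rightarrow> ('v \<Rightarrow> 'w) \<Rightarrow> sym set \<Rightarrow> fm set \<Rightarrow> 'w ecardinal" where
  "lambda_loc V W j L T = (LEAST c. \<exists>n. c = lambda_loc_n V W j L T n)"

end

theory Submission
  imports Defs "HOL-Library.Ramsey" "HOL-Library.Countable_Set"
begin

text \<open>
  If \<open>X\<close> witnesses \<open>\<lambda>(T, \<phi>) \<le> |X|\<close>, then \<open>{\<phi>(x, a). a \<in> X}\<close> is a type over the pseudofinite set of
  coordinates of \<open>X\<close>; a realization \<open>b\<close> would put \<open>X\<close> inside the internal set of those members of
  an internally finite set that satisfy \<open>\<phi>(b, -)\<close>. Hence \<open>\<lambda>(T) \<le> \<lambda>\<^sup>l\<^sup>o\<^sup>c(T)\<close>.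

  Conversely, let \<open>\<lambda> < \<lambda>\<^sup>l\<^sup>o\<^sup>c\<^sup>,\<^sup>1(T)\<close> with \<open>\<aleph>\<^sub>1\<close>-saturation. It suffices to realize 1-types \<open>p\<close> over
  pseudofinite sets of size \<open>\<le> \<lambda>\<close>, and \<open>p\<close> is equivalent to a chain of local types \<open>p\<^sub>0, p\<^sub>1, \<dots>\<close>, each
  of which is realized, say by \<open>b\<^sub>m\<close>. Extend \<open>(b\<^sub>m)\<close> to an internal sequence.
  (A) If no \<open>\<lambda>\<close> nonstandard numbers are coinitial, then overspill yields a nonstandard \<open>m\<close> such that
  \<open>b\<^sub>m\<close> realizes \<open>p\<close>.
  (B) Otherwise no formula \<open>\<phi>(x, y)\<close> with \<open>x\<close> a single variable has the order property, as a
  cut \<open>(\<omega>, \<lambda>)\<close> in a ladder of nonstandard length would have to be filled. So for a global extension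
  of \<open>p\<close> the set \<open>D\<^sub>\<phi>\<close> of parameters of its \<open>\<phi>\<close>-instances is internal. If all infinite internally
  finite sets are larger than \<open>\<lambda>\<close>, take an internal Morley sequence of the global type: every
  instance of \<open>p\<close> fails on finitely many of its members only, so some member realizes \<open>p\<close>. If
  there is an infinite internally finite set of size \<open>\<le> \<lambda>\<close>, then consistency of instances of
  \<open>\<phi>(x, y)\<close> is decided by boundedly many at a time (no finite cover property), hence the internally
  finite parts of the sets \<open>D\<^sub>\<phi>\<close> are realized and saturation applies.
\<close>

section \<open>Renaming of variables\<close>

text \<open>Facts about internally finite sets are not proved inside \<open>W\<close>. They are
  proved in the well-founded \<open>V\<close>, where finite means finite, and carried over as one
  formula; hence the attention to definability and the habit of describing functions by graphs.

  The obstacle is that the type is external: the hypothesis realizes sets of at most \<lambda>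
  instances of one formula, while saturation handles countably many internal conditions. Each case
  trades one for the other. In (A) every instance contributes one overspill bound, at most \<lambda>
  in all. When (A) fails there is a coinitial set of at most \<lambda> nonstandard numbers, so that
  the cut of a ladder is expressed by at most \<lambda> instances of
  \<open>\<phi>(x, y) \<and> \<not> \<phi>(x, y')\<close>; an element filling it would contradict
  overspill. Without long ladders the type has an internal definition for each formula, and
  conditions on all instances become internal. The second distinction arises because the trace of
  this definition on an internally finite set may have more than \<lambda> elements, beyond the
  direct reach of the hypothesis.\<close>

instance trm :: countable by countable_datatype
instance fm :: countable by countable_datatype

lemma finite_trm_fv [simp]: "finite (trm_fv t)"
  by (induct t) auto

lemma finite_fv [simp]: "finite (fv \<phi>)"
  by (induct \<phi>) auto

lemma tval_cong: "(\<And>x. x \<in> trm_fv t \<Longrightarrow> e x = e' x) \<Longrightarrow> tval M e t = tval M e' t"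
proof (induct t)
  case (Fn f ts)
  have "map (tval M e) ts = map (tval M e') ts" using Fn by auto
  then show ?case by (simp del: map_eq_conv add: comp_def)
qed simp

lemma sat_cong: "(\<And>x. x \<in> fv \<phi> \<Longrightarrow> e x = e' x) \<Longrightarrow> sat M e \<phi> = sat M e' \<phi>"
proof (induct \<phi> arbitrary: e e')
  case (Equal s t)
  then show ?case using tval_cong[of s e e' M] tval_cong[of t e e' M] by simp
next
  case (Rel r ts)
  have "map (tval M e) ts = map (tval M e') ts"
    using Rel by (auto intro!: tval_cong)
  then show ?case by (simp del: map_eq_conv add: comp_def)
next
  case (Neg \<phi>)
  then show ?case by (metis fv.simps(3) sat.simps(3))
next
  case (And \<phi> \<psi>)
  have "sat M e \<phi> = sat M e' \<phi>" "sat M e \<psi> = sat M e' \<psi>"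
    by (intro And; simp add: And.prems)+
  then show ?case by simp
next
  case (All x \<phi>)
  have "sat M (e(x := a)) \<phi> = sat M (e'(x := a)) \<phi>" for a
    by (rule All(1)) (use All(2) in auto)
  then show ?case by simp
qed

primrec trm_ren :: "(nat \<Rightarrow> nat) \<Rightarrow> trm \<Rightarrow> trm" where
  "trm_ren r (Var x) = Var (r x)"
| "trm_ren r (Fn f ts) = Fn f (map (trm_ren r) ts)"

text \<open>The bound variable moves beyond the images of all free variables of the body, so that
  nothing is captured even when \<open>r\<close> is not injective. The inserted 0 keeps
  \<open>Max\<close> meaningful for a body without free variables.\<close>

primrec ren :: "fm \<Rightarrow> (nat \<Rightarrow> nat) \<Rightarrow> fm" where
  "ren (Equal s t) r = Equal (trm_ren r s) (trm_ren r t)"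
| "ren (Rel p ts) r = Rel p (map (trm_ren r) ts)"
| "ren (Neg \<phi>) r = Neg (ren \<phi> r)"
| "ren (And \<phi> \<psi>) r = And (ren \<phi> r) (ren \<psi> r)"
| "ren (All x \<phi>) r = (let y = Suc (Max (insert 0 (r ` fv \<phi>))) in All y (ren \<phi> (r(x := y))))"

lemma Suc_Max_notin: "finite A \<Longrightarrow> Suc (Max (insert 0 A)) \<notin> A"
  by (metis Max_ge finite_insert insertCI not_less_eq_eq order_refl)

lemma tval_trm_ren [simp]: "tval M e (trm_ren r t) = tval M (e \<circ> r) t"
proof (induct t)
  case (Fn f ts)
  have "map (tval M e \<circ> trm_ren r) ts = map (tval M (e \<circ> r)) ts" using Fn by (simp add: comp_def)
  then show ?case by (simp del: map_eq_conv add: comp_def)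
qed simp

lemma sat_ren: "sat M e (ren \<phi> r) = sat M (e \<circ> r) \<phi>"
proof (induct \<phi> arbitrary: e r)
  case (Rel p ts)
  have "map (tval M e \<circ> trm_ren r) ts = map (tval M (e \<circ> r)) ts" by (simp add: comp_def)
  then show ?case by (simp del: map_eq_conv add: comp_def)
next
  case (All x \<phi>)
  define y where "y = Suc (Max (insert 0 (r ` fv \<phi>)))"
  have y: "y \<notin> r ` fv \<phi>" unfolding y_def by (intro Suc_Max_notin) simp
  have *: "sat M (e(y := a) \<circ> r(x := y)) \<phi> = sat M ((e \<circ> r)(x := a)) \<phi>" for a
    by (rule sat_cong) (use y in auto)
  show ?case by (simp only: ren.simps Let_def y_def[symmetric] sat.simps All *)
qed simp_all

lemma trm_fv_ren [simp]: "trm_fv (trm_ren r t) = r ` trm_fv t"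
  by (induct t) auto

lemma fv_ren: "fv (ren \<phi> r) \<subseteq> r ` fv \<phi>"
proof (induct \<phi> arbitrary: r)
  case (All x \<phi>)
  define y where "y = Suc (Max (insert 0 (r ` fv \<phi>)))"
  have "fv (ren \<phi> (r(x := y))) \<subseteq> insert y (r ` (fv \<phi> - {x}))"
    using order.trans[OF All[of "r(x := y)"], of "insert y (r ` (fv \<phi> - {x}))"] by (auto simp del: fun_upd_apply simp: fun_upd_def split: if_splits)
  then show ?case by (auto simp: Let_def y_def[symmetric])
qed (simp_all, blast+)

lemma trm_syms_ren [simp]: "trm_syms (trm_ren r t) = trm_syms t"
  by (induct t) auto

lemma syms_ren [simp]: "syms (ren \<phi> r) = syms \<phi>"
  by (induct \<phi> arbitrary: r) (auto simp: Let_def)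

lemma ren_formulas [simp]: "ren \<phi> r \<in> formulas L \<longleftrightarrow> \<phi> \<in> formulas L"
  by (simp add: formulas_def)

lemma Neg_formulas [simp]: "Neg \<phi> \<in> formulas L \<longleftrightarrow> \<phi> \<in> formulas L"
  by (simp add: formulas_def)

lemma And_formulas [simp]: "And \<phi> \<psi> \<in> formulas L \<longleftrightarrow> \<phi> \<in> formulas L \<and> \<psi> \<in> formulas L"
  by (simp add: formulas_def)

lemma All_formulas [simp]: "All x \<phi> \<in> formulas L \<longleftrightarrow> \<phi> \<in> formulas L"
  by (simp add: formulas_def)

text \<open>Quantification in de Bruijn style: variable 0 is bound and every other variable moves
  down by one. Quantifiers can then be introduced over environments without choosing names.\<close>

definition all0 :: "fm \<Rightarrow> fm" where
  "all0 \<phi> = (let N = Suc (Max (insert 0 (fv \<phi>))) in All N (ren \<phi> (case_nat N id)))"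

lemma sat_all0: "sat M e (all0 \<phi>) \<longleftrightarrow> (\<forall>a\<in>univ M. sat M (case_nat a e) \<phi>)"
proof -
  define N where "N = Suc (Max (insert 0 (fv \<phi>)))"
  have N: "i < N" if "i \<in> fv \<phi>" for i
    using that unfolding N_def by (simp add: less_Suc_eq_le)
  have "sat M (e(N := a) \<circ> case_nat N id) \<phi> = sat M (case_nat a e) \<phi>" for a
    by (rule sat_cong) (use N in \<open>force split: nat.splits\<close>)
  then show ?thesis by (simp add: all0_def N_def[symmetric] Let_def sat_ren)
qed

lemma all0_formulas [simp]: "all0 \<phi> \<in> formulas L \<longleftrightarrow> \<phi> \<in> formulas L"
  by (simp add: all0_def Let_def)

lemma fv_all0: "fv (all0 \<phi>) \<subseteq> {i. Suc i \<in> fv \<phi>}"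
proof -
  define N where "N = Suc (Max (insert 0 (fv \<phi>)))"
  have "fv (ren \<phi> (case_nat N id)) \<subseteq> case_nat N id ` fv \<phi>" by (rule fv_ren)
  also have "\<dots> \<subseteq> insert N {i. Suc i \<in> fv \<phi>}" by (force split: nat.splits)
  finally show ?thesis by (auto simp: all0_def N_def[symmetric] Let_def)
qed

section \<open>Uniform definability along an elementary embedding\<close>

text \<open>Even variables are arguments and odd variables are parameters, so that a formula always
  has room for more of either kind.\<close>

definition mix :: "(nat \<Rightarrow> 'a) \<Rightarrow> (nat \<Rightarrow> 'a) \<Rightarrow> nat \<Rightarrow> 'a" where
  "mix e c i = (if even i then e (i div 2) else c (i div 2))"

lemma mix_simps [simp]: "mix e c (2 * i) = e i" "mix e c (Suc (2 * i)) = c i" "mix e c 0 = e 0"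
  by (simp_all add: mix_def)

lemma comp_mix: "j \<circ> mix e c = mix (j \<circ> e) (j \<circ> c)"
  by (auto simp: mix_def)

lemma univ_set_struct [simp]: "univ (set_struct V) = UNIV"
  by (simp add: set_struct_def)

locale elem_emb =
  fixes V :: "'v \<Rightarrow> 'v \<Rightarrow> bool" and W :: "'w \<Rightarrow> 'w \<Rightarrow> bool" and j :: "'v \<Rightarrow> 'w"
  assumes emb: "elementary_embedding set_lang (set_struct V) (set_struct W) j"
begin

lemma sat_j: "\<phi> \<in> formulas set_lang \<Longrightarrow> sat (set_struct V) e \<phi> \<longleftrightarrow> sat (set_struct W) (j \<circ> e) \<phi>"
  using emb by (auto simp: elementary_embedding_def)

text \<open>One formula defines both predicates, with parameters \<open>c\<close> on the side of
  \<open>V\<close> and their images under \<open>j\<close> on the side of \<open>W\<close>. Since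
  predicates on environments are related rather than syntax, definability is derived by recursion on
  the HOL term through \<open>def_intros\<close>, and elementarity of \<open>j\<close> is applied
  only at the end.\<close>

definition Def :: "((nat \<Rightarrow> 'v) \<Rightarrow> bool) \<Rightarrow> ((nat \<Rightarrow> 'w) \<Rightarrow> bool) \<Rightarrow> bool" where
  "Def P Q \<longleftrightarrow> (\<exists>\<phi>\<in>formulas set_lang. \<exists>c. (\<forall>e. P e \<longleftrightarrow> sat (set_struct V) (mix e c) \<phi>) \<and>
     (\<forall>e. Q e \<longleftrightarrow> sat (set_struct W) (mix e (j \<circ> c)) \<phi>))"

lemma DefI:
  assumes "\<phi> \<in> formulas set_lang" "\<And>e. P e \<longleftrightarrow> sat (set_struct V) (mix e c) \<phi>"
    "\<And>e. Q e \<longleftrightarrow> sat (set_struct W) (mix e (j \<circ> c)) \<phi>"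
  shows "Def P Q"
  unfolding Def_def using assms by blast

lemma DefE:
  assumes "Def P Q"
  obtains \<phi> c where "\<phi> \<in> formulas set_lang" "\<And>e. P e \<longleftrightarrow> sat (set_struct V) (mix e c) \<phi>"
    "\<And>e. Q e \<longleftrightarrow> sat (set_struct W) (mix e (j \<circ> c)) \<phi>"
  using assms unfolding Def_def by blast

named_theorems def_intros

lemma Def_transfer: "Def P Q \<Longrightarrow> P e \<longleftrightarrow> Q (j \<circ> e)"
  by (erule DefE) (simp add: sat_j comp_mix)

lemma Def_closed: "Def (\<lambda>_. A) (\<lambda>_. B) \<Longrightarrow> A \<longleftrightarrow> B"
  using Def_transfer by blast

lemma Def_mem_var: "Def (\<lambda>e. V (e i) (e k)) (\<lambda>e. W (e i) (e k))"
  by (rule DefI[where \<phi> = "Rel 0 [Var (2*i), Var (2*k)]"])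
    (simp_all add: formulas_def set_lang_def set_struct_def numeral_2_eq_2 del: add_mult_distrib mult_Suc flip: numeral_2_eq_2)

lemma Def_eq_var: "Def (\<lambda>e. e i = e k) (\<lambda>e. e i = e k)"
  by (rule DefI[where \<phi> = "Equal (Var (2*i)) (Var (2*k))"])
    (simp_all add: formulas_def)

lemma Def_neg [def_intros]: "Def P Q \<Longrightarrow> Def (\<lambda>e. \<not> P e) (\<lambda>e. \<not> Q e)"
  by (erule DefE, rule DefI[where \<phi> = "Neg \<phi>" for \<phi>]) auto

lemma Def_conj [def_intros]:
  assumes "Def P Q" "Def P' Q'"
  shows "Def (\<lambda>e. P e \<and> P' e) (\<lambda>e. Q e \<and> Q' e)"
proof -
  obtain \<phi> c where 1: "\<phi> \<in> formulas set_lang" "\<And>e. P e \<longleftrightarrow> sat (set_struct V) (mix e c) \<phi>"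
    "\<And>e. Q e \<longleftrightarrow> sat (set_struct W) (mix e (j \<circ> c)) \<phi>" by (rule DefE[OF assms(1)]) blast
  obtain \<psi> d where 2: "\<psi> \<in> formulas set_lang" "\<And>e. P' e \<longleftrightarrow> sat (set_struct V) (mix e d) \<psi>"
    "\<And>e. Q' e \<longleftrightarrow> sat (set_struct W) (mix e (j \<circ> d)) \<psi>" by (rule DefE[OF assms(2)]) blast
  \<comment> \<open>The two parameter sequences are themselves interleaved: variable
    \<open>2k+1\<close> is redirected to \<open>4k+1\<close>, where \<open>c k\<close> now stands,
    or to \<open>4k+3\<close>, where \<open>d k\<close> stands.\<close>
  let ?r = "\<lambda>i. if even i then i else Suc (2 * (i - 1))"
  let ?s = "\<lambda>i. if even i then i else Suc (2 * i)"
  have *: "mix e (mix c d) \<circ> ?r = mix e c \<and> mix e (mix c d) \<circ> ?s = mix e d"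
    for e c d :: "nat \<Rightarrow> 'x"
    by (auto simp: mix_def fun_eq_iff elim!: oddE)
  show ?thesis
    by (rule DefI[where \<phi> = "And (ren \<phi> ?r) (ren \<psi> ?s)" and c = "mix c d"])
      (simp_all add: 1 2 sat_ren * comp_mix)
qed

lemma Def_rename:
  assumes "Def P Q"
  shows "Def (\<lambda>e. P (\<lambda>i. e (r i))) (\<lambda>e. Q (\<lambda>i. e (r i)))"
proof -
  obtain \<phi> c where 1: "\<phi> \<in> formulas set_lang" "\<And>e. P e \<longleftrightarrow> sat (set_struct V) (mix e c) \<phi>"
    "\<And>e. Q e \<longleftrightarrow> sat (set_struct W) (mix e (j \<circ> c)) \<phi>" by (rule DefE[OF assms(1)]) blast
  let ?r = "\<lambda>i. if even i then 2 * r (i div 2) else i"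
  have *: "mix e c \<circ> ?r = mix (\<lambda>i. e (r i)) c" for e c :: "nat \<Rightarrow> 'x"
    by (auto simp: mix_def)
  show ?thesis
    by (rule DefI[where \<phi> = "ren \<phi> ?r" and c = c]) (simp_all add: 1 sat_ren *)
qed

lemma Def_param:
  assumes "Def (\<lambda>e. P (e 0) (\<lambda>i. e (Suc i))) (\<lambda>e. Q (e 0) (\<lambda>i. e (Suc i)))"
  shows "Def (P a) (Q (j a))"
proof -
  obtain \<phi> c where 1: "\<phi> \<in> formulas set_lang"
    "\<And>e. P (e 0) (\<lambda>i. e (Suc i)) \<longleftrightarrow> sat (set_struct V) (mix e c) \<phi>"
    "\<And>e. Q (e 0) (\<lambda>i. e (Suc i)) \<longleftrightarrow> sat (set_struct W) (mix e (j \<circ> c)) \<phi>"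
    by (rule DefE[OF assms(1)]) blast
  \<comment> \<open>Argument 0 becomes the first parameter: the other arguments move down one place
    and the old parameters up one.\<close>
  let ?r = "\<lambda>i. if i = 0 then 1 else if even i then i - 2 else i + 2"
  have *: "mix e (case_nat a c) \<circ> ?r = mix (case_nat a e) c" for e c and a :: 'x
  proof
    fix i show "(mix e (case_nat a c) \<circ> ?r) i = mix (case_nat a e) c i"
    proof (cases "even i")
      case True
      then obtain k where "i = 2 * k" by blast
      then show ?thesis by (cases k) (auto simp: mix_def)
    next
      case False
      then obtain k where "i = 2 * k + 1" by (elim oddE)
      then show ?thesis by (auto simp: mix_def)
    qed
  qed
  have **: "j \<circ> case_nat a c = case_nat (j a) (j \<circ> c)"
    by (auto simp: fun_eq_iff split: nat.splits)
  show ?thesis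
    by (rule DefI[where \<phi> = "ren \<phi> ?r" and c = "case_nat a c"])
      (use 1(2)[of "case_nat a e" for e] 1(3)[of "case_nat (j a) e" for e]
        in \<open>simp_all add: 1(1) sat_ren * **\<close>)
qed

lemma Def_all [def_intros]:
  assumes "Def (\<lambda>e. P (e 0) (\<lambda>i. e (Suc i))) (\<lambda>e. Q (e 0) (\<lambda>i. e (Suc i)))"
  shows "Def (\<lambda>e. \<forall>x. P x e) (\<lambda>e. \<forall>x. Q x e)"
proof -
  obtain \<phi> c where 1: "\<phi> \<in> formulas set_lang"
    "\<And>e. P (e 0) (\<lambda>i. e (Suc i)) \<longleftrightarrow> sat (set_struct V) (mix e c) \<phi>"
    "\<And>e. Q (e 0) (\<lambda>i. e (Suc i)) \<longleftrightarrow> sat (set_struct W) (mix e (j \<circ> c)) \<phi>"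
    by (rule DefE[OF assms(1)]) blast
  let ?r = "\<lambda>i. if i = 0 then 0 else if even i then i - 1 else Suc i"
  have *: "case_nat a (mix e c) \<circ> ?r = mix (case_nat a e) c" for e c and a :: 'x
  proof
    fix i show "(case_nat a (mix e c) \<circ> ?r) i = mix (case_nat a e) c i"
    proof (cases "even i")
      case True
      then obtain k where "i = 2 * k" by blast
      then show ?thesis by (cases k) (auto simp: mix_def)
    next
      case False
      then obtain k where "i = 2 * k + 1" by (elim oddE)
      then show ?thesis by simp
    qed
  qed
  show ?thesis
    by (rule DefI[where \<phi> = "all0 (ren \<phi> ?r)" and c = c])
      (use 1(2)[of "case_nat a e" for e a] 1(3)[of "case_nat a e" for e a]
        in \<open>simp_all add: 1(1) sat_ren sat_all0 *\<close>)
qed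

lemma Def_True [def_intros]: "Def (\<lambda>_. True) (\<lambda>_. True)"
  using Def_eq_var[of 0 0] by simp

lemma Def_False [def_intros]: "Def (\<lambda>_. False) (\<lambda>_. False)"
  using Def_neg[OF Def_True] by simp

lemma Def_disj [def_intros]: "Def P Q \<Longrightarrow> Def P' Q' \<Longrightarrow> Def (\<lambda>e. P e \<or> P' e) (\<lambda>e. Q e \<or> Q' e)"
  using Def_neg[OF Def_conj[OF Def_neg Def_neg, of P Q P' Q']] by simp

lemma Def_imp [def_intros]: "Def P Q \<Longrightarrow> Def P' Q' \<Longrightarrow> Def (\<lambda>e. P e \<longrightarrow> P' e) (\<lambda>e. Q e \<longrightarrow> Q' e)"
  using Def_neg[OF Def_conj[OF _ Def_neg, of P Q P' Q']] by simp

lemma Def_iff [def_intros]: "Def P Q \<Longrightarrow> Def P' Q' \<Longrightarrow> Def (\<lambda>e. P e \<longleftrightarrow> P' e) (\<lambda>e. Q e \<longleftrightarrow> Q' e)"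
  using Def_conj[OF Def_imp Def_imp, of P Q P' Q' P' Q' P Q] by (simp add: iff_conv_conj_imp)

lemma Def_ex [def_intros]:
  assumes "Def (\<lambda>e. P (e 0) (\<lambda>i. e (Suc i))) (\<lambda>e. Q (e 0) (\<lambda>i. e (Suc i)))"
  shows "Def (\<lambda>e. \<exists>x. P x e) (\<lambda>e. \<exists>x. Q x e)"
  using Def_neg[OF Def_all[OF Def_neg[OF assms]]] by simp

text \<open>Quantifying over whole environments is not first-order, but a formula has finitely many
  free variables; the induction in \<open>cl\<close> binds the relevant arguments one at a time
  until a closed pair is left. This serves the separation scheme, whose parameters form an arbitrary
  assignment.\<close>

lemma Def_all_env: assumes "Def P Q" shows "(\<forall>e. P e) \<longleftrightarrow> (\<forall>e. Q e)"
proof -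
  obtain \<phi> c where 1: "\<phi> \<in> formulas set_lang" "\<And>e. P e \<longleftrightarrow> sat (set_struct V) (mix e c) \<phi>"
    "\<And>e. Q e \<longleftrightarrow> sat (set_struct W) (mix e (j \<circ> c)) \<phi>" by (rule DefE[OF assms(1)]) blast
  have "\<exists>N. \<forall>i\<in>fv \<phi>. i < N" by (metis finite_fv finite_nat_set_iff_bounded)
  then obtain N where N: "\<And>i. i \<in> fv \<phi> \<Longrightarrow> i < N" by blast
  have cl: "\<exists>P' Q'. Def (\<lambda>_. P') (\<lambda>_. Q') \<and> (P' \<longleftrightarrow> (\<forall>e. P e)) \<and> (Q' \<longleftrightarrow> (\<forall>e. Q e))"
    if "Def P Q" "\<And>e e'. (\<And>i. i < N \<Longrightarrow> e i = e' i) \<Longrightarrow> P e = P e'"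
       "\<And>e e'. (\<And>i. i < N \<Longrightarrow> e i = e' i) \<Longrightarrow> Q e = Q e'" for N P Q
    using that
  proof (induct N arbitrary: P Q)
    case 0
    then have p: "P e = P undefined" "Q e' = Q undefined" for e e' by blast+
    have "Def (\<lambda>_. P undefined) (\<lambda>_. Q undefined)"
      using 0(1) by (subst (asm) p(1)[abs_def], subst (asm) p(2)[abs_def])
    then show ?case using p by blast
  next
    case (Suc N)
    have e: "case_nat (e 0) (\<lambda>i. e (Suc i)) = e" for e :: "nat \<Rightarrow> 'x"
      by (auto split: nat.splits)
    have d: "Def (\<lambda>e. \<forall>x. P (case_nat x e)) (\<lambda>e. \<forall>x. Q (case_nat x e))"
      by (rule Def_all) (use Suc(2) in \<open>simp add: e\<close>)
    have "(\<forall>x. P (case_nat x e)) \<longleftrightarrow> (\<forall>x. P (case_nat x e'))" if "\<And>i. i < N \<Longrightarrow> e i = e' i" for e e'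
      proof -
      have "P (case_nat x e) = P (case_nat x e')" for x
        by (rule Suc(3)) (use that in \<open>auto split: nat.splits\<close>)
      then show ?thesis by simp
    qed
    moreover have "(\<forall>x. Q (case_nat x e)) \<longleftrightarrow> (\<forall>x. Q (case_nat x e'))"
      if "\<And>i. i < N \<Longrightarrow> e i = e' i" for e e'
      proof -
      have "Q (case_nat x e) = Q (case_nat x e')" for x
        by (rule Suc(4)) (use that in \<open>auto split: nat.splits\<close>)
      then show ?thesis by simp
    qed
    ultimately obtain P' Q' where *: "Def (\<lambda>_. P') (\<lambda>_. Q')" "P' \<longleftrightarrow> (\<forall>e x. P (case_nat x e))"
      "Q' \<longleftrightarrow> (\<forall>e x. Q (case_nat x e))" using Suc(1)[OF d] by blast
    have "(\<forall>e x. P (case_nat x e)) \<longleftrightarrow> (\<forall>e. P e)" "(\<forall>e x. Q (case_nat x e)) \<longleftrightarrow> (\<forall>e. Q e)"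
      by (metis e)+
    then show ?case using * by blast
  qed
  have "P e = P e'" if "\<And>i. i < N \<Longrightarrow> e i = e' i" for e e'
    unfolding 1 by (rule sat_cong) (use that N in \<open>force simp: mix_def dest!: N\<close>)
  moreover have "Q e = Q e'" if "\<And>i. i < N \<Longrightarrow> e i = e' i" for e e'
    unfolding 1 by (rule sat_cong) (use that N in \<open>force simp: mix_def dest!: N\<close>)
  ultimately show ?thesis using cl[OF assms] Def_closed by blast
qed

text \<open>A term is handled through its graph, with the value in argument 0. Substituting a term
  into a predicate then costs one existential quantifier.\<close>

definition FDef :: "((nat \<Rightarrow> 'v) \<Rightarrow> 'v) \<Rightarrow> ((nat \<Rightarrow> 'w) \<Rightarrow> 'w) \<Rightarrow> bool" where
  "FDef t u \<longleftrightarrow> Def (\<lambda>e. e 0 = t (\<lambda>i. e (Suc i))) (\<lambda>e. e 0 = u (\<lambda>i. e (Suc i)))"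

lemma FDef_var [def_intros]: "FDef (\<lambda>e. e i) (\<lambda>e. e i)"
  unfolding FDef_def by (rule Def_eq_var)

lemma FDef_const [def_intros]: "FDef (\<lambda>_. a) (\<lambda>_. j a)"
  unfolding FDef_def
  using Def_param[of "\<lambda>x e. e 0 = x" "\<lambda>x e. e 0 = x" a] Def_eq_var[of 1 0] by simp

lemma FDef_rename:
  assumes "FDef t u" shows "FDef (\<lambda>e. t (\<lambda>i. e (r i))) (\<lambda>e. u (\<lambda>i. e (r i)))"
  using Def_rename[OF assms[unfolded FDef_def], of "case_nat 0 (\<lambda>i. Suc (r i))"]
  by (simp add: FDef_def)

lemma FDef_transfer: "FDef t u \<Longrightarrow> j (t e) = u (j \<circ> e)"
  unfolding FDef_def by (drule Def_transfer[of _ _ "case_nat (t e) e"]) (simp add: comp_def)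

lemma Def_subst:
  assumes "FDef t u" "Def (\<lambda>e. P (e 0) (\<lambda>i. e (Suc i))) (\<lambda>e. Q (e 0) (\<lambda>i. e (Suc i)))"
  shows "Def (\<lambda>e. P (t e) e) (\<lambda>e. Q (u e) e)"
proof -
  have "Def (\<lambda>e. \<exists>x. x = t e \<and> P x e) (\<lambda>e. \<exists>x. x = u e \<and> Q x e)"
    using assms unfolding FDef_def by (intro Def_ex Def_conj) auto
  then show ?thesis by simp
qed

lemma Def_lift1:
  assumes "Def (\<lambda>e. P (e 0)) (\<lambda>e. Q (e 0))" "FDef t u"
  shows "Def (\<lambda>e. P (t e)) (\<lambda>e. Q (u e))"
  by (rule Def_subst[OF assms(2)]) (rule assms)

lemma Def_lift2:
  assumes "Def (\<lambda>e. P (e 0) (e 1)) (\<lambda>e. Q (e 0) (e 1))" "FDef t u" "FDef t' u'"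
  shows "Def (\<lambda>e. P (t e) (t' e)) (\<lambda>e. Q (u e) (u' e))"
proof -
  have "Def (\<lambda>e. P (e (Suc 0)) (e 0)) (\<lambda>e. Q (e (Suc 0)) (e 0))"
    using Def_rename[OF assms(1), of "\<lambda>i. 1 - i"] by simp
  then have "Def (\<lambda>e. P (e 0) (t' (\<lambda>i. e (Suc i)))) (\<lambda>e. Q (e 0) (u' (\<lambda>i. e (Suc i))))"
    by (intro Def_subst[where P = "\<lambda>x e. P (e 0) x" and Q = "\<lambda>x e. Q (e 0) x"]
      FDef_rename[OF assms(3)])
  then show ?thesis
    by (rule Def_subst[OF assms(2), where P = "\<lambda>x e. P x (t' e)" and Q = "\<lambda>x e. Q x (u' e)"])
qed

lemma Def_lift3:
  assumes "Def (\<lambda>e. P (e 0) (e 1) (e 2)) (\<lambda>e. Q (e 0) (e 1) (e 2))" "FDef t u" "FDef t' u'" "FDef t'' u''"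
  shows "Def (\<lambda>e. P (t e) (t' e) (t'' e)) (\<lambda>e. Q (u e) (u' e) (u'' e))"
proof -
  have "Def (\<lambda>e. P (e 0) (e (Suc 0)) (e (Suc (Suc 0)))) (\<lambda>e. Q (e 0) (e (Suc 0)) (e (Suc (Suc 0))))"
    using assms(1) by (simp add: numeral_2_eq_2)
  then have "Def (\<lambda>e. P (t (\<lambda>i. e (Suc (Suc i)))) (e 0) (e (Suc 0)))
      (\<lambda>e. Q (u (\<lambda>i. e (Suc (Suc i)))) (e 0) (e (Suc 0)))"
    by (intro Def_subst[where P = "\<lambda>x e. P x (e 0) (e (Suc 0))" and Q = "\<lambda>x e. Q x (e 0) (e (Suc 0))"]
      FDef_rename[OF assms(2)])
  then have "Def (\<lambda>e. P (t (\<lambda>i. e (Suc i))) (t' (\<lambda>i. e (Suc i))) (e 0))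
      (\<lambda>e. Q (u (\<lambda>i. e (Suc i))) (u' (\<lambda>i. e (Suc i))) (e 0))"
    by (intro Def_subst[where P = "\<lambda>x e. P (t (\<lambda>i. e (Suc i))) x (e 0)"
        and Q = "\<lambda>x e. Q (u (\<lambda>i. e (Suc i))) x (e 0)"] FDef_rename[OF assms(3)])
  then show ?thesis
    by (rule Def_subst[OF assms(4), where P = "\<lambda>x e. P (t e) (t' e) x" and Q = "\<lambda>x e. Q (u e) (u' e) x"])
qed

lemma FDef_lift2:
  assumes "Def (\<lambda>e. e 0 = P (e 1) (e 2)) (\<lambda>e. e 0 = Q (e 1) (e 2))" "FDef t u" "FDef t' u'"
  shows "FDef (\<lambda>e. P (t e) (t' e)) (\<lambda>e. Q (u e) (u' e))"
  unfolding FDef_def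
  by (rule Def_lift3[where P = "\<lambda>x y z. x = P y z" and Q = "\<lambda>x y z. x = Q y z"])
    (auto simp: assms(1)[simplified] FDef_var FDef_rename[OF assms(2)] FDef_rename[OF assms(3)])

lemma Def_mem [def_intros]: "FDef t u \<Longrightarrow> FDef t' u' \<Longrightarrow> Def (\<lambda>e. V (t e) (t' e)) (\<lambda>e. W (u e) (u' e))"
  by (rule Def_lift2[where P = V and Q = W]) (rule Def_mem_var)

lemma Def_eq [def_intros]: "FDef t u \<Longrightarrow> FDef t' u' \<Longrightarrow> Def (\<lambda>e. t e = t' e) (\<lambda>e. u e = u' e)"
  by (rule Def_lift2[where P = "(=)" and Q = "(=)"]) (rule Def_eq_var)

lemma Def_in_ext [def_intros]:
  "FDef t u \<Longrightarrow> FDef t' u' \<Longrightarrow> Def (\<lambda>e. t e \<in> ext V (t' e)) (\<lambda>e. u e \<in> ext W (u' e))"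
  using Def_mem by (simp add: ext_def)

lemma Def_ball_ext [def_intros]:
  assumes "FDef t u" "Def (\<lambda>e. P (e 0) (\<lambda>i. e (Suc i))) (\<lambda>e. Q (e 0) (\<lambda>i. e (Suc i)))"
  shows "Def (\<lambda>e. \<forall>x\<in>ext V (t e). P x e) (\<lambda>e. \<forall>x\<in>ext W (u e). Q x e)"
  unfolding Ball_def
  by (intro def_intros FDef_rename[OF assms(1)] assms(2))

lemma Def_bex_ext [def_intros]:
  assumes "FDef t u" "Def (\<lambda>e. P (e 0) (\<lambda>i. e (Suc i))) (\<lambda>e. Q (e 0) (\<lambda>i. e (Suc i)))"
  shows "Def (\<lambda>e. \<exists>x\<in>ext V (t e). P x e) (\<lambda>e. \<exists>x\<in>ext W (u e). Q x e)"
  unfolding Bex_def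
  by (intro def_intros FDef_rename[OF assms(1)] assms(2))

lemma Def_ex1 [def_intros]:
  assumes "Def (\<lambda>e. P (e 0) (\<lambda>i. e (Suc i))) (\<lambda>e. Q (e 0) (\<lambda>i. e (Suc i)))"
  shows "Def (\<lambda>e. \<exists>!x. P x e) (\<lambda>e. \<exists>!x. Q x e)"
proof -
  have "Def (\<lambda>e. P (e 0) (\<lambda>i. e (Suc (Suc i)))) (\<lambda>e. Q (e 0) (\<lambda>i. e (Suc (Suc i))))"
    using Def_rename[OF assms, of "case_nat 0 (\<lambda>i. Suc (Suc i))"] by simp
  then have "Def (\<lambda>e. \<exists>x. P x e \<and> (\<forall>y. P y e \<longrightarrow> y = x)) (\<lambda>e. \<exists>x. Q x e \<and> (\<forall>y. Q y e \<longrightarrow> y = x))"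
    by (intro def_intros assms)
  then show ?thesis by (simp add: Ex1_def)
qed

lemma Def_subset_ext [def_intros]:
  "FDef t u \<Longrightarrow> FDef t' u' \<Longrightarrow> Def (\<lambda>e. ext V (t e) \<subseteq> ext V (t' e)) (\<lambda>e. ext W (u e) \<subseteq> ext W (u' e))"
  by (rule Def_lift2[where P = "\<lambda>x y. ext V x \<subseteq> ext V y" and Q = "\<lambda>x y. ext W x \<subseteq> ext W y"])
    (unfold subset_eq, intro def_intros)

lemma j_inj: "j x = j y \<longleftrightarrow> x = y"
  using Def_closed[of "x = y" "j x = j y"] Def_eq[OF FDef_const[of x] FDef_const[of y]] by simp

lemma j_mem: "W (j x) (j y) \<longleftrightarrow> V x y"
  using Def_closed[of "V x y" "W (j x) (j y)"] Def_mem[OF FDef_const[of x] FDef_const[of y]] by simp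

end

text \<open>For the identity embedding, \<open>Def P P\<close> is plain definability with arbitrary
  parameters from one model. In this form the calculus feeds separation, overspill and saturation
  inside \<open>W\<close>.\<close>

lemma elem_emb_id: "elem_emb V V (\<lambda>x. x)"
  by unfold_locales (auto simp: elementary_embedding_def comp_def)

lemma (in elem_emb) Def_target: "Def P Q \<Longrightarrow> elem_emb.Def W W (\<lambda>x. x) Q Q"
  by (erule DefE, rule elem_emb.DefI[OF elem_emb_id]) (auto simp: comp_def)

section \<open>A fragment of set theory common to \<open>V\<close> and its elementary extension\<close>

text \<open>These axioms are used inside \<open>W\<close> as well and hold there by elementarity.
  Collection and well-foundedness are exploited in \<open>V\<close>, and their consequences reach
  \<open>W\<close> by transfer.\<close>

locale weak_set_theory =
  fixes V :: "'v \<Rightarrow> 'v \<Rightarrow> bool"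
  assumes extensionality: "(\<And>x. V x a \<longleftrightarrow> V x b) \<Longrightarrow> a = b"
    and pairing: "\<exists>c. \<forall>x. V x c \<longleftrightarrow> x = a \<or> x = b"
    and union: "\<exists>u. \<forall>x. V x u \<longleftrightarrow> (\<exists>y. V y a \<and> V x y)"
    and infinity: "\<exists>w. (\<exists>z. V z w \<and> (\<forall>x. \<not> V x z)) \<and>
      (\<forall>x. V x w \<longrightarrow> (\<exists>y. V y w \<and> (\<forall>z. V z y \<longleftrightarrow> V z x \<or> z = x)))"
    and separation: "\<phi> \<in> formulas set_lang \<Longrightarrow>
      \<exists>b. \<forall>x. V x b \<longleftrightarrow> V x a \<and> sat (set_struct V) (e(0 := x)) \<phi>"
begin

lemma ext_inject [simp]: "ext V a = ext V b \<longleftrightarrow> a = b"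
  using extensionality[of a b] by (auto simp: ext_def)

lemma elem_ext [simp]: "elem V (ext V a) = a"
  unfolding elem_def by (rule the_equality) auto

lemma ext_elem: "in_model V X \<Longrightarrow> ext V (elem V X) = X"
  unfolding in_model_def by auto

lemma eq_elem_iff: "in_model V X \<Longrightarrow> z = elem V X \<longleftrightarrow> ext V z = X"
  by (metis ext_elem elem_ext)

lemma in_model_ext [simp]: "in_model V (ext V a)"
  by (auto simp: in_model_def)

lemma in_model_empty [simp]: "in_model V {}"
proof -
  have "Neg (Equal (Var 0) (Var 0)) \<in> formulas set_lang" by (simp add: formulas_def)
  from separation[OF this] show ?thesis by (auto simp: in_model_def ext_def)
qed

lemma in_model_pair [simp]: "in_model V {a, b}"
  using pairing[of a b] by (auto simp: in_model_def ext_def)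

lemma in_model_single [simp]: "in_model V {a}"
  using in_model_pair[of a a] by simp

lemma in_model_Union:
  assumes "in_model V A" "\<And>a. a \<in> A \<Longrightarrow> B a = ext V a"
  shows "in_model V (\<Union>a\<in>A. B a)"
proof -
  obtain c where c: "ext V c = A" using assms(1) by (auto simp: in_model_def)
  obtain u where "\<forall>x. V x u \<longleftrightarrow> (\<exists>y. V y c \<and> V x y)" using union by blast
  then have "ext V u = (\<Union>a\<in>A. B a)" using assms(2) c by (auto simp: ext_def)
  then show ?thesis by (auto simp: in_model_def)
qed

lemma in_model_Un [simp]: "in_model V X \<Longrightarrow> in_model V Y \<Longrightarrow> in_model V (X \<union> Y)"
  using in_model_Union[OF in_model_pair[of "elem V X" "elem V Y"], of "ext V"] by (simp add: ext_elem)

lemma in_model_insert [simp]: "in_model V X \<Longrightarrow> in_model V (insert a X)"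
  using in_model_Un[OF in_model_single[of a]] by simp

lemma in_model_finite: "finite X \<Longrightarrow> in_model V X"
  by (induct X rule: finite_induct) auto

lemma ext_empty [simp]: "ext V (elem V {}) = {}"
  by (simp add: ext_elem)

lemma ext_single [simp]: "ext V (elem V {a}) = {a}"
  by (simp add: ext_elem)

lemma ext_insert [simp]: "ext V (elem V (insert a (ext V b))) = insert a (ext V b)"
  by (simp add: ext_elem)

lemma ext_succ [simp]: "ext V (succ_elem V x) = insert x (ext V x)"
  by (simp add: succ_elem_def)

lemma ext_num: "ext V (num V n) = num V ` {..<n}"
  by (induct n) (auto simp: lessThan_Suc)

lemma elem_eq_iff: "in_model V X \<Longrightarrow> in_model V Y \<Longrightarrow> elem V X = elem V Y \<longleftrightarrow> X = Y"
  by (metis ext_elem)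

lemma opair_inject [simp]: "opair V a b = opair V c d \<longleftrightarrow> a = c \<and> b = d"
  unfolding opair_def by (simp add: elem_eq_iff doubleton_eq_iff) auto

lemma seq_inject: "length as = length bs \<Longrightarrow> seq V as = seq V bs \<longleftrightarrow> as = bs"
  by (induct as bs rule: list_induct2) auto

lemma inj_on_seq: "inj_on (seq V) (tuples D k)"
  by (auto simp: inj_on_def tuples_def seq_inject)

end

text \<open>Where \<open>app\<close> is not determined its value is arbitrary in each model and cannot be transferred
  along \<open>j\<close>; \<open>app0\<close> is the empty set there.\<close>

definition app0 :: "('v \<Rightarrow> 'v \<Rightarrow> bool) \<Rightarrow> 'v \<Rightarrow> 'v \<Rightarrow> 'v" where
  "app0 V f x = (if \<exists>!y. V (opair V x y) f then app V f x else elem V {})"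

locale set_emb = elem_emb V W j + V: weak_set_theory V + W: weak_set_theory W
  for V :: "'v \<Rightarrow> 'v \<Rightarrow> bool" and W :: "'w \<Rightarrow> 'w \<Rightarrow> bool" and j :: "'v \<Rightarrow> 'w"
begin

lemma Def_eq_elem:
  assumes "\<And>e. in_model V (X e)" "\<And>e. in_model W (Y e)"
    "Def (\<lambda>e. \<forall>w. V w (e 0) \<longleftrightarrow> w \<in> X (\<lambda>i. e (Suc i))) (\<lambda>e. \<forall>w. W w (e 0) \<longleftrightarrow> w \<in> Y (\<lambda>i. e (Suc i)))"
  shows "FDef (\<lambda>e. elem V (X e)) (\<lambda>e. elem W (Y e))"
  unfolding FDef_def using assms(3)
  by (simp add: V.eq_elem_iff W.eq_elem_iff assms(1,2) ext_def set_eq_iff)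

lemma FDef_empty [def_intros]: "FDef (\<lambda>e. elem V {}) (\<lambda>e. elem W {})"
  by (rule Def_eq_elem; simp?) (intro def_intros)

lemma FDef_insert [def_intros]:
  assumes "FDef t u" "FDef t' u'"
  shows "FDef (\<lambda>e. elem V (insert (t e) (ext V (t' e)))) (\<lambda>e. elem W (insert (u e) (ext W (u' e))))"
proof -
  have *: "FDef (\<lambda>e. elem V (insert (e 1) (ext V (e 2)))) (\<lambda>e. elem W (insert (e 1) (ext W (e 2))))"
    by (rule Def_eq_elem; simp?) (intro def_intros)
  have "Def (\<lambda>e. e 0 = elem V (insert (e 1) (ext V (e 2)))) (\<lambda>e. e 0 = elem W (insert (e 1) (ext W (e 2))))"
    using Def_rename[OF *[unfolded FDef_def], of "\<lambda>i. i - 1"] by simp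
  from FDef_lift2[OF this assms] show ?thesis .
qed

lemma FDef_pair [def_intros]:
  assumes "FDef t u" "FDef t' u'"
  shows "FDef (\<lambda>e. elem V {t e, t' e}) (\<lambda>e. elem W {u e, u' e})"
  using FDef_insert[OF assms(1) FDef_insert[OF assms(2) FDef_empty]] by simp

lemma FDef_single [def_intros]:
  assumes "FDef t u"
  shows "FDef (\<lambda>e. elem V {t e}) (\<lambda>e. elem W {u e})"
  using FDef_insert[OF assms(1) FDef_empty] by simp

lemma FDef_opair [def_intros]:
  "FDef t u \<Longrightarrow> FDef t' u' \<Longrightarrow> FDef (\<lambda>e. opair V (t e) (t' e)) (\<lambda>e. opair W (u e) (u' e))"
  unfolding opair_def by (intro def_intros)

lemma FDef_succ [def_intros]: "FDef t u \<Longrightarrow> FDef (\<lambda>e. succ_elem V (t e)) (\<lambda>e. succ_elem W (u e))"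
  unfolding succ_elem_def by (intro def_intros)

lemma FDef_num [def_intros]: "FDef (\<lambda>e. num V n) (\<lambda>e. num W n)"
  by (induct n) (simp_all add: def_intros)

lemma FDef_seq [def_intros]:
  "(\<And>a. a \<in> set as \<Longrightarrow> FDef (t a) (u a)) \<Longrightarrow>
    FDef (\<lambda>e. seq V (map (\<lambda>a. t a e) as)) (\<lambda>e. seq W (map (\<lambda>a. u a e) as))"
  by (induct as) (simp_all add: def_intros)

lemma FDef_code_sym [def_intros]: "FDef (\<lambda>e. code_sym V s) (\<lambda>e. code_sym W s)"
  by (cases s) (auto intro!: def_intros simp del: num.simps)

lemma Def_inductive: "FDef t u \<Longrightarrow> Def (\<lambda>e. inductive_elem V (t e)) (\<lambda>e. inductive_elem W (u e))"
  by (rule Def_lift1) (unfold inductive_elem_def, intro def_intros)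

lemma FDef_app0 [def_intros]:
  assumes "FDef t u" "FDef t' u'"
  shows "FDef (\<lambda>e. app0 V (t e) (t' e)) (\<lambda>e. app0 W (u e) (u' e))"
proof (rule FDef_lift2[OF _ assms])
  have V: "z = app0 V f x \<longleftrightarrow> (\<exists>!y. V (opair V x y) f) \<and> V (opair V x z) f \<or>
    \<not> (\<exists>!y. V (opair V x y) f) \<and> z = elem V {}" for z f x
  proof (cases "\<exists>!y. V (opair V x y) f")
    case True
    then show ?thesis unfolding app0_def app_def using theI'[OF True] by auto
  qed (simp add: app0_def)
  have W: "z = app0 W f x \<longleftrightarrow> (\<exists>!y. W (opair W x y) f) \<and> W (opair W x z) f \<or>
    \<not> (\<exists>!y. W (opair W x y) f) \<and> z = elem W {}" for z f x
  proof (cases "\<exists>!y. W (opair W x y) f")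
    case True
    then show ?thesis unfolding app0_def app_def using theI'[OF True] by auto
  qed (simp add: app0_def)
  show "Def (\<lambda>e. e 0 = app0 V (e 1) (e 2)) (\<lambda>e. e 0 = app0 W (e 1) (e 2))"
    unfolding V W by (intro def_intros)
qed

lemma V_sep:
  assumes "Def (\<lambda>e. P (e 0) (\<lambda>i. e (Suc i))) Q"
  shows "in_model V {x \<in> ext V a. P x e}"
proof -
  obtain \<phi> c where 1: "\<phi> \<in> formulas set_lang"
    "\<And>e. P (e 0) (\<lambda>i. e (Suc i)) \<longleftrightarrow> sat (set_struct V) (mix e c) \<phi>"
    by (rule DefE[OF assms(1)]) blast
  have "(mix (case_nat x e) c)(0 := y) = mix (case_nat y e) c" for x y e
  proof
    fix i show "((mix (case_nat x e) c)(0 := y)) i = mix (case_nat y e) c i"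
      by (cases "even i") (auto simp: mix_def elim!: evenE split: nat.splits)
  qed
  then have "sat (set_struct V) ((mix (case_nat undefined e) c)(0 := x)) \<phi> \<longleftrightarrow> P x e" for x
    using 1(2)[of "case_nat x e"] by simp
  then show ?thesis
    using V.separation[OF 1(1), of a "mix (case_nat undefined e) c"]
    by (auto simp: in_model_def ext_def)
qed

end

lemma in_ext: "x \<in> ext V a \<longleftrightarrow> V x a"
  by (simp add: ext_def)

lemma set_emb_id: "weak_set_theory V \<Longrightarrow> set_emb V V (\<lambda>x. x)"
  by (simp add: set_emb_def elem_emb_id)

lemma (in elem_emb) weak_set_theory_transfer:
  assumes "weak_set_theory V" shows "weak_set_theory W"
proof -
  interpret V: weak_set_theory V by fact
  show ?thesis
  proof
    fix a b assume *: "\<And>x. W x a \<longleftrightarrow> W x b"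
    have "(\<forall>a b. (\<forall>x. V x a \<longleftrightarrow> V x b) \<longrightarrow> a = b) \<longleftrightarrow> (\<forall>a b. (\<forall>x. W x a \<longleftrightarrow> W x b) \<longrightarrow> a = b)"
      by (rule Def_closed) (intro def_intros)
    then show "a = b" using * V.extensionality by blast
  next
    fix a b
    have "(\<forall>a b. \<exists>c. \<forall>x. V x c \<longleftrightarrow> x = a \<or> x = b) \<longleftrightarrow> (\<forall>a b. \<exists>c. \<forall>x. W x c \<longleftrightarrow> x = a \<or> x = b)"
      by (rule Def_closed) (intro def_intros)
    then show "\<exists>c. \<forall>x. W x c \<longleftrightarrow> x = a \<or> x = b" using V.pairing by blast
  next
    fix a
    have "(\<forall>a. \<exists>u. \<forall>x. V x u \<longleftrightarrow> (\<exists>y. V y a \<and> V x y)) \<longleftrightarrow>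
      (\<forall>a. \<exists>u. \<forall>x. W x u \<longleftrightarrow> (\<exists>y. W y a \<and> W x y))"
      by (rule Def_closed) (intro def_intros)
    then show "\<exists>u. \<forall>x. W x u \<longleftrightarrow> (\<exists>y. W y a \<and> W x y)" using V.union by blast
  next
    have "(\<exists>w. (\<exists>z. V z w \<and> (\<forall>x. \<not> V x z)) \<and>
        (\<forall>x. V x w \<longrightarrow> (\<exists>y. V y w \<and> (\<forall>z. V z y \<longleftrightarrow> V z x \<or> z = x)))) \<longleftrightarrow>
      (\<exists>w. (\<exists>z. W z w \<and> (\<forall>x. \<not> W x z)) \<and>
        (\<forall>x. W x w \<longrightarrow> (\<exists>y. W y w \<and> (\<forall>z. W z y \<longleftrightarrow> W z x \<or> z = x))))"
      by (rule Def_closed) (intro def_intros)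
    then show "\<exists>w. (\<exists>z. W z w \<and> (\<forall>x. \<not> W x z)) \<and>
      (\<forall>x. W x w \<longrightarrow> (\<exists>y. W y w \<and> (\<forall>z. W z y \<longleftrightarrow> W z x \<or> z = x)))" using V.infinity by blast
  next
    fix \<phi> a and e :: "nat \<Rightarrow> 'w"
    assume \<phi>: "\<phi> \<in> formulas set_lang"
    have *: "mix e c \<circ> (\<lambda>i. 2 * i) = e" for e c :: "nat \<Rightarrow> 'x" by auto
    have "Def (\<lambda>e. sat (set_struct V) e \<phi>) (\<lambda>e. sat (set_struct W) e \<phi>)"
      by (intro DefI[where \<phi> = "ren \<phi> (\<lambda>i. 2 * i)" and c = "\<lambda>_. undefined"])
        (simp_all add: \<phi> sat_ren *)
    from Def_rename[OF this, of "\<lambda>i. if i = 0 then 0 else Suc (Suc i)"]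
    have d: "Def (\<lambda>e. sat (set_struct V) (\<lambda>i. e (if i = 0 then 0 else Suc (Suc i))) \<phi>)
      (\<lambda>e. sat (set_struct W) (\<lambda>i. e (if i = 0 then 0 else Suc (Suc i))) \<phi>)" .
    \<comment> \<open>The formula sees \<open>x\<close> in place of variable 0, so slot 0 of the
      assignment is free to carry the set \<open>a\<close>. An instance of the scheme is thus a
      property of a single environment.\<close>
    have d2: "Def (\<lambda>e. \<exists>b. \<forall>x. V x b \<longleftrightarrow> V x (e 0) \<and> sat (set_struct V) (\<lambda>i. if i = 0 then x else e i) \<phi>)
      (\<lambda>e. \<exists>b. \<forall>x. W x b \<longleftrightarrow> W x (e 0) \<and> sat (set_struct W) (\<lambda>i. if i = 0 then x else e i) \<phi>)"
      by (intro def_intros) (use d in \<open>simp add: if_distrib\<close>)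
    have "\<exists>b. \<forall>x. V x b \<longleftrightarrow> V x (e 0) \<and> sat (set_struct V) (\<lambda>i. if i = 0 then x else e i) \<phi>" for e
      using V.separation[OF \<phi>, of "e 0" e] by (simp add: fun_upd_def)
    then have *: "\<forall>e. \<exists>b. \<forall>x. W x b \<longleftrightarrow> W x (e 0) \<and> sat (set_struct W) (\<lambda>i. if i = 0 then x else e i) \<phi>"
      by (intro iffD1[OF Def_all_env[OF d2]] allI)
    have "(e(0 := a))(0 := x) = (\<lambda>i. if i = 0 then x else (e(0 := a)) i)" for x by auto
    then show "\<exists>b. \<forall>x. W x b \<longleftrightarrow> W x a \<and> sat (set_struct W) (e(0 := x)) \<phi>"
      using *[rule_format, of "e(0 := a)"] by simp
  qed
qed

lemma (in set_emb) W_sep: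
  assumes "Def P (\<lambda>e. Q (e 0) (\<lambda>i. e (Suc i)))"
  shows "in_model W {x \<in> ext W a. Q x e}"
  by (rule set_emb.V_sep[OF set_emb_id[OF W.weak_set_theory_axioms] Def_target[OF assms]])

context weak_set_theory begin

interpretation ID: set_emb V V "\<lambda>x. x"
  by (rule set_emb_id) unfold_locales

lemma sep1: "ID.Def (\<lambda>e. P (e 0)) (\<lambda>e. P (e 0)) \<Longrightarrow> in_model V {x \<in> ext V a. P x}"
  by (rule ID.V_sep[where P = "\<lambda>x e. P x"])

lemma ex1_omega: "\<exists>!w. inductive_elem V w \<and> (\<forall>i. inductive_elem V i \<longrightarrow> ext V w \<subseteq> ext V i)"
proof -
  obtain w z where w: "V z w" "\<And>x. \<not> V x z" "\<And>x. V x w \<Longrightarrow> \<exists>y. V y w \<and> (\<forall>z. V z y \<longleftrightarrow> V z x \<or> z = x)"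
    using infinity by blast
  have z: "elem V {} = z" using w(2) by (metis elem_ext ext_def Collect_empty_eq)
  have "V (succ_elem V x) w" if xw: "V x w" for x
  proof -
    obtain y where y: "V y w" "\<forall>z. V z y \<longleftrightarrow> V z x \<or> z = x" using w(3)[OF xw] by blast
    then have "ext V y = ext V (succ_elem V x)" unfolding ext_succ by (auto simp: in_ext)
    then have "y = succ_elem V x" by (rule iffD1[OF ext_inject])
    then show ?thesis using y by simp
  qed
  then have w': "inductive_elem V w" using w(1) z by (auto simp: inductive_elem_def)
  have "in_model V {x \<in> ext V w. \<forall>i. inductive_elem V i \<longrightarrow> V x i}"
    by (rule sep1) (intro ID.def_intros ID.Def_inductive)
  then obtain v where v: "ext V v = {x \<in> ext V w. \<forall>i. inductive_elem V i \<longrightarrow> V x i}"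
    by (auto simp: in_model_def)
  then have vm: "V x v \<longleftrightarrow> V x w \<and> (\<forall>i. inductive_elem V i \<longrightarrow> V x i)" for x
    by (auto simp: set_eq_iff in_ext)
  have "inductive_elem V v"
    using w' by (auto simp: inductive_elem_def vm)
  moreover have "ext V v \<subseteq> ext V i" if "inductive_elem V i" for i
    using that by (auto simp: in_ext vm)
  ultimately show ?thesis
    by (intro ex1I[of _ v]) (simp, metis ext_inject subset_antisym)
qed

lemma inductive_omega: "inductive_elem V (omega V)"
  and omega_least: "inductive_elem V i \<Longrightarrow> ext V (omega V) \<subseteq> ext V i"
  using theI'[OF ex1_omega] by (auto simp: omega_def[symmetric])

lemma omega_eq_iff: "w = omega V \<longleftrightarrow> inductive_elem V w \<and> (\<forall>i. inductive_elem V i \<longrightarrow> ext V w \<subseteq> ext V i)"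
  using ex1_omega inductive_omega omega_least by blast

lemma num_in_omega [simp]: "V (num V n) (omega V)"
  using inductive_omega by (induct n) (auto simp: inductive_elem_def)

lemma omega_cases:
  assumes "V x (omega V)"
  shows "x = elem V {} \<or> (\<exists>y. V y (omega V) \<and> x = succ_elem V y)"
proof -
  let ?P = "\<lambda>x. x = elem V {} \<or> (\<exists>y. V y (omega V) \<and> x = succ_elem V y)"
  have "in_model V {x \<in> ext V (omega V). ?P x}"
    by (rule sep1) (intro ID.def_intros)
  then obtain v where v: "ext V v = {x \<in> ext V (omega V). ?P x}"
    by (auto simp: in_model_def)
  then have vm: "V x v \<longleftrightarrow> V x (omega V) \<and> ?P x" for x
    by (auto simp: set_eq_iff in_ext)
  have "inductive_elem V v"
    using inductive_omega by (auto simp: inductive_elem_def vm)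
  from omega_least[OF this] have "V x v" using assms by (auto simp: in_ext)
  then show ?thesis by (simp add: vm)
qed

lemma app_eq:
  assumes "function_on V f X Y" "x \<in> X" shows "app V f x = y \<longleftrightarrow> V (opair V x y) f"
proof -
  have e: "\<exists>!y. V (opair V x y) f" using assms by (auto simp: function_on_def)
  show ?thesis unfolding app_def using theI'[OF e] e by auto
qed

text \<open>The definition mentions \<open>app\<close> and \<open>bij_betw\<close>, which are not
  visibly first-order. In terms of the pairs in \<open>f\<close> they become quantifiers over
  elements, to which \<open>def_intros\<close> applies.\<close>

lemma believes_finite_iff:
  "believes_finite V a \<longleftrightarrow> (\<exists>n f. V n (omega V) \<and>
     (\<forall>p. V p f \<longrightarrow> (\<exists>x\<in>ext V a. \<exists>y\<in>ext V n. p = opair V x y)) \<and>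
     (\<forall>x\<in>ext V a. \<exists>!y. V (opair V x y) f) \<and>
     (\<forall>x\<in>ext V a. \<forall>x'\<in>ext V a. \<forall>y. V (opair V x y) f \<and> V (opair V x' y) f \<longrightarrow> x = x') \<and>
     (\<forall>y\<in>ext V n. \<exists>x\<in>ext V a. V (opair V x y) f))"
proof -
  have "bij_betw (app V f) (ext V a) (ext V n) \<longleftrightarrow>
     (\<forall>x\<in>ext V a. \<forall>x'\<in>ext V a. \<forall>y. V (opair V x y) f \<and> V (opair V x' y) f \<longrightarrow> x = x') \<and>
     (\<forall>y\<in>ext V n. \<exists>x\<in>ext V a. V (opair V x y) f)"
    if f: "function_on V f (ext V a) (ext V n)" for f n
  proof -
    have 1: "V (opair V x y) f \<longleftrightarrow> app V f x = y" if "x \<in> ext V a" for x y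
      using app_eq[OF f that] by blast
    have 2: "app V f x \<in> ext V n" if "x \<in> ext V a" for x
    proof -
      have "V (opair V x (app V f x)) f" using 1 that by blast
      then show ?thesis using f unfolding function_on_def by auto
    qed
    have "app V f ` ext V a = ext V n \<longleftrightarrow> (\<forall>y\<in>ext V n. \<exists>x\<in>ext V a. app V f x = y)"
      using 2 by force
    then show ?thesis unfolding bij_betw_def inj_on_def using 1 by auto
  qed
  then show ?thesis unfolding believes_finite_def function_on_def by blast
qed

end

context set_emb begin

lemma FDef_omega [def_intros]: "FDef (\<lambda>e. omega V) (\<lambda>e. omega W)"
  unfolding FDef_def V.omega_eq_iff W.omega_eq_iff by (intro def_intros Def_inductive)

lemma Def_believes_finite [def_intros]:
  "FDef t u \<Longrightarrow> Def (\<lambda>e. believes_finite V (t e)) (\<lambda>e. believes_finite W (u e))"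
  by (rule Def_lift1) (unfold V.believes_finite_iff W.believes_finite_iff, intro def_intros)

lemma j_num: "j (num V n) = num W n"
  using FDef_transfer[OF FDef_num] by simp

lemma j_opair: "j (opair V x y) = opair W (j x) (j y)"
  using FDef_transfer[OF FDef_opair[OF FDef_const FDef_const]] by simp

end

lemma tuples_0 [simp]: "tuples D 0 = {[]}"
  by (auto simp: tuples_def)

lemma tuples_Suc: "tuples D (Suc k) = {a # as |a as. a \<in> D \<and> as \<in> tuples D k}"
  by (auto simp: tuples_def length_Suc_conv)

subsection \<open>Transitive models\<close>

locale zfc_model =
  fixes V :: "'v \<Rightarrow> 'v \<Rightarrow> bool"
  assumes zfc: "transitive_zfc_minus V"

sublocale zfc_model \<subseteq> weak_set_theory V
proof unfold_locales
  have z: "zfc_minus V" using zfc by (simp add: transitive_zfc_minus_def)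
  note z = z[unfolded zfc_minus_def]
  show "\<And>a b. (\<And>x. V x a = V x b) \<Longrightarrow> a = b" using z[THEN conjunct1] by blast
  show "\<And>a b. \<exists>c. \<forall>x. V x c = (x = a \<or> x = b)" using z[THEN conjunct2, THEN conjunct2, THEN conjunct1] by blast
  show "\<And>a. \<exists>u. \<forall>x. V x u = (\<exists>y. V y a \<and> V x y)" using z[THEN conjunct2, THEN conjunct2, THEN conjunct2, THEN conjunct1] by blast
  show "\<exists>w. (\<exists>z. V z w \<and> (\<forall>x. \<not> V x z)) \<and> (\<forall>x. V x w \<longrightarrow> (\<exists>y. V y w \<and> (\<forall>z. V z y = (V z x \<or> z = x))))"
    using z[THEN conjunct2, THEN conjunct2, THEN conjunct2, THEN conjunct2, THEN conjunct1] by blast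
  show "\<And>\<phi> a e. \<phi> \<in> formulas set_lang \<Longrightarrow> \<exists>b. \<forall>x. V x b = (V x a \<and> sat (set_struct V) (e(0 := x)) \<phi>)"
    using z[THEN conjunct2, THEN conjunct2, THEN conjunct2, THEN conjunct2, THEN conjunct2, THEN conjunct1] by blast
qed

context zfc_model begin

interpretation ID: set_emb V V "\<lambda>x. x"
  by (rule set_emb_id) unfold_locales

lemma wfp: "wfp V"
  using zfc by (simp add: transitive_zfc_minus_def)

lemma not_self: "\<not> V x x"
  by (induct x rule: wfp_induct_rule[OF wfp]) blast

lemma num_inject [simp]: "num V m = num V n \<longleftrightarrow> m = n"
proof -
  have "V (num V m) (num V n)" if "m < n" for m n
    using that ext_num[of n] by (auto simp: ext_def)
  then show ?thesis by (metis not_self nat_neq_iff)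
qed

text \<open>Well-founded induction along predecessors: an element of omega is empty or a successor,
  and the descent must end.\<close>

lemma ext_omega: "ext V (omega V) = range (num V)"
proof -
  have "V x (omega V) \<longrightarrow> x \<in> range (num V)" for x
  proof (induct x rule: wfp_induct_rule[OF wfp])
    case (1 x)
    show ?case
    proof
      assume x: "V x (omega V)"
      show "x \<in> range (num V)"
      proof (cases "x = elem V {}")
        case True
        then show ?thesis by (metis num.simps(1) rangeI)
      next
        case False
        then obtain y where y: "V y (omega V)" "x = succ_elem V y" using omega_cases[OF x] by blast
        then have "V y x" using ext_succ[of y] by (auto simp: ext_def)
        then obtain n where "y = num V n" using 1 y by blast
        then show ?thesis using y by (metis num.simps(2) rangeI)
      qed
    qed
  qed
  then show ?thesis by (auto simp: ext_def)
qed

text \<open>Numbers of \<open>V\<close> are standard, and \<open>V\<close> contains every finite set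
  of its elements, in particular the graph of an external enumeration. Through this equivalence
  elementary facts on finite sets turn into facts on internally finite sets of
  \<open>W\<close>.\<close>

lemma believes_finite_finite: "believes_finite V a \<longleftrightarrow> finite (ext V a)"
proof
  assume "believes_finite V a"
  then obtain n f where "V n (omega V)" "bij_betw (app V f) (ext V a) (ext V n)"
    by (auto simp: believes_finite_def)
  moreover then obtain k where "n = num V k" using ext_omega by (auto simp: ext_def)
  ultimately show "finite (ext V a)" using bij_betw_finite[of "app V f" "ext V a" "ext V n"]
    by (simp add: ext_num)
next
  assume fin: "finite (ext V a)"
  then obtain h where h: "bij_betw h (ext V a) {..<card (ext V a)}"
    by (metis ex_bij_betw_finite_nat atLeast0LessThan)
  define n where "n = card (ext V a)"
  have "in_model V ((\<lambda>x. opair V x (num V (h x))) ` ext V a)"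
    by (rule in_model_finite) (use fin in auto)
  then obtain f where "ext V f = (\<lambda>x. opair V x (num V (h x))) ` ext V a"
    by (auto simp: in_model_def)
  then have f: "V p f \<longleftrightarrow> (\<exists>x\<in>ext V a. p = opair V x (num V (h x)))" for p by (auto simp: ext_def)
  have hn: "h x < n" if "x \<in> ext V a" for x using h that by (auto simp: bij_betw_def n_def)
  have hs: "\<exists>x\<in>ext V a. k = h x" if "k < n" for k using h that by (auto simp: bij_betw_def n_def)
  have hi: "h x = h y \<longleftrightarrow> x = y" if "x \<in> ext V a" "y \<in> ext V a" for x y
    using h that by (auto simp: bij_betw_def inj_on_def)
  show "believes_finite V a"
    unfolding believes_finite_iff
    by (rule exI[of _ "num V n"], rule exI[of _ f]) (auto simp: f ext_num hn hi dest!: hs)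
qed

lemma collection:
  assumes "ID.Def (\<lambda>e. P (e 0) (e 1)) Q" "\<And>x. x \<in> ext V a \<Longrightarrow> \<exists>y. P x y"
  shows "\<exists>b. \<forall>x\<in>ext V a. \<exists>y\<in>ext V b. P x y"
proof -
  obtain \<phi> c where 1: "\<phi> \<in> formulas set_lang"
    "\<And>e. P (e 0) (e 1) \<longleftrightarrow> sat (set_struct V) (mix e c) \<phi>"
    by (rule ID.DefE[OF assms(1)]) blast
  let ?r = "\<lambda>i. if i = 0 then 0 else if even i then 1 else i + 2"
  let ?e = "\<lambda>i. c ((i - 2) div 2)"
  have "?e(0 := x, 1 := y) \<circ> ?r = mix (\<lambda>i. if i = 0 then x else y) c" for x y
  proof
    fix i show "(?e(0 := x, 1 := y) \<circ> ?r) i = mix (\<lambda>i. if i = 0 then x else y) c i"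
      by (cases "even i") (auto simp: mix_def elim!: evenE)
  qed
  then have *: "sat (set_struct V) (?e(0 := x, 1 := y)) (ren \<phi> ?r) \<longleftrightarrow> P x y" for x y
    using 1(2)[of "\<lambda>i. if i = 0 then x else y"] by (simp add: sat_ren)
  have "(\<forall>x. V x a \<longrightarrow> (\<exists>y. sat (set_struct V) (?e(0 := x, 1 := y)) (ren \<phi> ?r))) \<longrightarrow>
        (\<exists>b. \<forall>x. V x a \<longrightarrow> (\<exists>y. V y b \<and> sat (set_struct V) (?e(0 := x, 1 := y)) (ren \<phi> ?r)))"
    using zfc[unfolded transitive_zfc_minus_def zfc_minus_def, THEN conjunct2, THEN conjunct2, THEN conjunct2,
        THEN conjunct2, THEN conjunct2, THEN conjunct2, THEN conjunct2, THEN conjunct1] 1(1)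
      ren_formulas[of \<phi> ?r] by blast
  then show ?thesis unfolding * using assms(2) by (auto simp: ext_def)
qed

lemma in_model_image:
  assumes "ID.Def (\<lambda>e. P (e 0) (e 1)) (\<lambda>e. P (e 0) (e 1))" "\<And>x. x \<in> ext V a \<Longrightarrow> \<exists>!y. P x y"
  shows "in_model V {y. \<exists>x\<in>ext V a. P x y}"
proof -
  obtain b where b: "\<forall>x\<in>ext V a. \<exists>y\<in>ext V b. P x y"
    using collection[OF assms(1)] assms(2) by blast
  have "in_model V {y \<in> ext V b. \<exists>x\<in>ext V a. P x y}"
    by (rule sep1, rule ID.Def_bex_ext[OF ID.FDef_const],
      use ID.Def_rename[OF assms(1)] in simp)
  also have "{y \<in> ext V b. \<exists>x\<in>ext V a. P x y} = {y. \<exists>x\<in>ext V a. P x y}" using assms(2) b by blast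
  finally show ?thesis .
qed

text \<open>Products without power set: replacement yields the slice over each \<open>x\<close>, a
  second replacement collects the slices, and union flattens the result.\<close>

lemma in_model_image2:
  assumes "ID.Def (\<lambda>e. e 0 = F (e 1) (e 2)) (\<lambda>e. e 0 = F (e 1) (e 2))"
  shows "in_model V {z. \<exists>x\<in>ext V a. \<exists>y\<in>ext V b. z = F x y}"
proof -
  have F: "ID.FDef (\<lambda>e. F (t e) (t' e)) (\<lambda>e. F (t e) (t' e))" if "ID.FDef t t" "ID.FDef t' t'" for t t'
    by (rule ID.FDef_lift2) (use assms that in auto)
  have c: "in_model V {z. \<exists>y\<in>ext V b. z = F x y}" for x
    by (rule in_model_image) (intro ID.def_intros F, blast)
  have "in_model V {c. \<exists>x\<in>ext V a. \<forall>z. V z c \<longleftrightarrow> (\<exists>y\<in>ext V b. z = F x y)}"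
  proof (rule in_model_image)
    fix x
    show "\<exists>!c. \<forall>z. V z c = (\<exists>y\<in>ext V b. z = F x y)"
      using c[of x] by (auto simp: in_model_def ext_def set_eq_iff intro: extensionality)
  qed (intro ID.def_intros F)
  from in_model_Union[OF this, of "ext V"]
  have "in_model V (\<Union>c\<in>{c. \<exists>x\<in>ext V a. \<forall>z. V z c \<longleftrightarrow> (\<exists>y\<in>ext V b. z = F x y)}. ext V c)" by simp
  also have "(\<Union>c\<in>{c. \<exists>x\<in>ext V a. \<forall>z. V z c \<longleftrightarrow> (\<exists>y\<in>ext V b. z = F x y)}. ext V c) =
    {z. \<exists>x\<in>ext V a. \<exists>y\<in>ext V b. z = F x y}" (is "?l = ?r")
  proof
    show "?l \<subseteq> ?r" by (auto simp: ext_def)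
    show "?r \<subseteq> ?l"
    proof safe
      fix x y assume *: "x \<in> ext V a" "y \<in> ext V b"
      obtain c where "ext V c = {z. \<exists>y\<in>ext V b. z = F x y}" using c[of x] by (auto simp: in_model_def)
      then show "F x y \<in> ?l" using * by (intro UN_I[of c]) (auto simp: ext_def)
    qed
  qed
  finally show ?thesis .
qed

lemma in_model_tuples: "in_model V (seq V ` tuples (ext V D) k)"
proof (induct k)
  case (Suc k)
  then obtain c where c: "ext V c = seq V ` tuples (ext V D) k" by (auto simp: in_model_def)
  have "in_model V {z. \<exists>x\<in>ext V D. \<exists>y\<in>ext V c. z = opair V x y}"
    by (rule in_model_image2) (intro ID.def_intros)
  also have "{z. \<exists>x\<in>ext V D. \<exists>y\<in>ext V c. z = opair V x y} = seq V ` tuples (ext V D) (Suc k)"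
    unfolding c tuples_Suc by (auto simp: image_iff) (metis seq.simps(2))
  finally show ?case .
qed simp

text \<open>Power set being absent, a bound for the finite subsets has to come from collection over
  omega. For each number \<open>n\<close> an external induction on size bounds the subsets with at
  most \<open>n\<close> elements; \<open>P\<close> says this by injections that are elements of
  \<open>V\<close>, so that it is a formula in \<open>n\<close> and \<open>q\<close>.\<close>

lemma ex_finite_subsets: "\<exists>q. \<forall>s. finite (ext V s) \<and> ext V s \<subseteq> ext V I \<longrightarrow> V s q"
proof -
  define P where "P n q \<longleftrightarrow> (\<forall>s f. ext V s \<subseteq> ext V I \<and> (\<forall>x\<in>ext V s. \<exists>y\<in>ext V n. V (opair V x y) f) \<and>
    (\<forall>x\<in>ext V s. \<forall>x'\<in>ext V s. \<forall>y. V (opair V x y) f \<and> V (opair V x' y) f \<longrightarrow> x = x') \<longrightarrow> V s q)" for n q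
  have "\<exists>q. \<forall>s. ext V s \<subseteq> ext V I \<and> finite (ext V s) \<and> card (ext V s) \<le> n \<longrightarrow> V s q" for n
  proof (induct n)
    case 0
    have "V s (elem V {elem V {}})" if "finite (ext V s)" "card (ext V s) \<le> 0" for s
    proof -
      have "ext V s = {}" using that by auto
      then have "s = elem V {}" by (metis elem_ext)
      then show ?thesis using ext_single[of "elem V {}"] by (auto simp: ext_def)
    qed
    then show ?case by blast
  next
    case (Suc n)
    then obtain q where q: "\<And>s. ext V s \<subseteq> ext V I \<Longrightarrow> finite (ext V s) \<Longrightarrow> card (ext V s) \<le> n \<Longrightarrow> V s q" by blast
    have "in_model V {z. \<exists>x\<in>ext V I. \<exists>y\<in>ext V q. z = elem V (insert x (ext V y))}"
      by (rule in_model_image2) (intro ID.def_intros)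
    then obtain r where r: "ext V r = {z. \<exists>x\<in>ext V I. \<exists>y\<in>ext V q. z = elem V (insert x (ext V y))}"
      by (auto simp: in_model_def)
    obtain u where u: "ext V u = insert (elem V {}) (ext V r)" using ext_insert by blast
    have "V s u" if s: "ext V s \<subseteq> ext V I" "finite (ext V s)" "card (ext V s) \<le> Suc n" for s
    proof (cases "ext V s = {}")
      case True
      then have "s = elem V {}" by (metis elem_ext)
      then show ?thesis using u by (auto simp: ext_def)
    next
      case False
      then obtain x where x: "x \<in> ext V s" by blast
      have "in_model V (ext V s - {x})" using s by (intro in_model_finite) auto
      then obtain y where y: "ext V y = ext V s - {x}" by (auto simp: in_model_def)
      have "V y q" by (rule q) (use s x y in auto)
      moreover have "s = elem V (insert x (ext V y))" using x y by (metis elem_ext insert_Diff)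
      ultimately have "s \<in> ext V r" using r x s(1) by (auto simp: ext_def)
      then show ?thesis using u by (auto simp: ext_def)
    qed
    then show ?case by blast
  qed
  note ex = this
  have "\<exists>q. P n q" if n_om: "n \<in> ext V (omega V)" for n
  proof -
    obtain k where n: "n = num V k" using n_om ext_omega by auto
    obtain q where q: "\<forall>s. ext V s \<subseteq> ext V I \<and> finite (ext V s) \<and> card (ext V s) \<le> k \<longrightarrow> V s q" using ex by blast
    have "P n q" unfolding P_def
    proof (intro allI impI, elim conjE)
      fix s f assume s: "ext V s \<subseteq> ext V I" and f: "\<forall>x\<in>ext V s. \<exists>y\<in>ext V n. V (opair V x y) f"
        "\<forall>x\<in>ext V s. \<forall>x'\<in>ext V s. \<forall>y. V (opair V x y) f \<and> V (opair V x' y) f \<longrightarrow> x = x'"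
      obtain h where h: "\<And>x. x \<in> ext V s \<Longrightarrow> h x \<in> ext V n \<and> V (opair V x (h x)) f" using f(1) by metis
      have i: "inj_on h (ext V s)" using h f(2) by (metis inj_onI)
      have fin: "finite (ext V n)" "card (ext V n) = k"
        by (auto simp: n ext_num card_image inj_on_def)
      have "h ` ext V s \<subseteq> ext V n" using h by auto
      then have "finite (ext V s)" "card (ext V s) \<le> k"
        using i fin finite_imageD finite_subset card_inj_on_le by metis+
      then show "V s q" using q s by blast
    qed
    then show ?thesis by blast
  qed
  moreover have "ID.Def (\<lambda>e. P (e 0) (e 1)) (\<lambda>e. P (e 0) (e 1))"
    unfolding P_def by (intro ID.def_intros)
  ultimately obtain b where b: "\<forall>n\<in>ext V (omega V). \<exists>q\<in>ext V b. P n q"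
    using collection[of P] by blast
  obtain u where u: "\<forall>x. V x u \<longleftrightarrow> (\<exists>y. V y b \<and> V x y)" using union by blast
  have "V s u" if s: "finite (ext V s)" "ext V s \<subseteq> ext V I" for s
  proof -
    have "believes_finite V s" using s believes_finite_finite by blast
    then obtain n f where n: "V n (omega V)" and f:
     "\<forall>p. V p f \<longrightarrow> (\<exists>x\<in>ext V s. \<exists>y\<in>ext V n. p = opair V x y)"
     "\<forall>x\<in>ext V s. \<exists>!y. V (opair V x y) f"
     "\<forall>x\<in>ext V s. \<forall>x'\<in>ext V s. \<forall>y. V (opair V x y) f \<and> V (opair V x' y) f \<longrightarrow> x = x'"
      unfolding believes_finite_iff by blast
    obtain q where q: "V q b" "P n q" using b n by (auto simp: ext_def)
    have "\<forall>x\<in>ext V s. \<exists>y\<in>ext V n. V (opair V x y) f"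
      using f(1,2) by (metis opair_inject)
    then have "V s q" using q(2) s(2) f(3) unfolding P_def by blast
    then show ?thesis using q u by blast
  qed
  then show ?thesis by blast
qed

end

section \<open>Ultrafilters and complete types\<close>

lemma ultrafilter_extension:
  assumes fip: "\<And>H. finite H \<Longrightarrow> H \<subseteq> F \<Longrightarrow> U \<inter> \<Inter>H \<noteq> {}"
  obtains G where "F \<subseteq> G" "\<And>H. finite H \<Longrightarrow> H \<subseteq> G \<Longrightarrow> U \<inter> \<Inter>H \<noteq> {}"
    "\<And>S. S \<in> G \<or> U - S \<in> G"
proof -
  define A where "A = {G. F \<subseteq> G \<and> (\<forall>H. finite H \<longrightarrow> H \<subseteq> G \<longrightarrow> U \<inter> \<Inter>H \<noteq> {})}"
  have "\<exists>M\<in>A. \<forall>X\<in>A. M \<subseteq> X \<longrightarrow> X = M"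
  proof (rule subset_Zorn_nonempty)
    show "A \<noteq> {}" using fip by (auto simp: A_def)
    fix C assume C: "C \<noteq> {}" "subset.chain A C"
    have "U \<inter> \<Inter>H \<noteq> {}" if H: "finite H" "H \<subseteq> \<Union>C" for H
    proof -
      obtain G where "G \<in> C" "H \<subseteq> G" using finite_subset_Union_chain[OF H C(1) C(2)] by blast
      then show ?thesis using C(2) H(1) by (auto simp: subset.chain_def A_def)
    qed
    moreover have "F \<subseteq> \<Union>C" using C by (fastforce simp: subset.chain_def A_def)
    ultimately show "\<Union>C \<in> A" by (simp add: A_def)
  qed
  then obtain G where G: "G \<in> A" "\<And>X. X \<in> A \<Longrightarrow> G \<subseteq> X \<Longrightarrow> X = G" by blast
  \<comment> \<open>By maximality a set outside \<open>G\<close> is incompatible with finitely many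
    members of \<open>G\<close>. If this held for \<open>S\<close> and for \<open>U - S\<close>, the
    two finite families together would have no common point in \<open>U\<close>.\<close>
  have bad: "\<exists>H. finite H \<and> H \<subseteq> G \<and> U \<inter> S \<inter> \<Inter>H = {}" if "S \<notin> G" for S
  proof -
    have "insert S G \<notin> A" using G(2)[of "insert S G"] that by blast
    then obtain H where H: "finite H" "H \<subseteq> insert S G" "U \<inter> \<Inter>H = {}" using G(1) by (auto simp: A_def)
    then show ?thesis by (intro exI[of _ "H - {S}"]) auto
  qed
  have "S \<in> G \<or> U - S \<in> G" for S
  proof (rule ccontr)
    assume "\<not> (S \<in> G \<or> U - S \<in> G)"
    then obtain H K where H: "finite H" "H \<subseteq> G" "U \<inter> S \<inter> \<Inter>H = {}"
      and K: "finite K" "K \<subseteq> G" "U \<inter> (U - S) \<inter> \<Inter>K = {}" using bad by metis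
    have "U \<inter> \<Inter>(H \<union> K) = {}" using H(3) K(3) by auto
    moreover have "finite (H \<union> K)" "H \<union> K \<subseteq> G" using H K by auto
    ultimately show False using G(1) by (auto simp: A_def)
  qed
  then show ?thesis using that G(1) by (auto simp: A_def)
qed

text \<open>The solution sets of \<open>p0\<close> generate a family of sets of
  \<open>n\<close>-tuples with the finite intersection property; an ultrafilter containing it
  decides every formula over \<open>A\<close>.\<close>

lemma extend_to_complete_type:
  assumes p0: "p0 \<subseteq> param_formulas L A n"
    and fin: "\<And>q. q \<subseteq> p0 \<Longrightarrow> finite q \<Longrightarrow> \<exists>b\<in>tuples (univ M) n. satisfies_all M b q"
  shows "\<exists>p. complete_type L M A n p \<and> p0 \<subseteq> p"
proof -
  define T where "T = (\<lambda>(\<phi>, as). {b \<in> tuples (univ M) n. sat M ((!) (b @ as)) \<phi>})"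
  have fip: "tuples (univ M) n \<inter> \<Inter>H \<noteq> {}" if H: "finite H" "H \<subseteq> T ` p0" for H
  proof -
    obtain q where q: "q \<subseteq> p0" "finite q" "H = T ` q" using finite_subset_image[OF H] by blast
    obtain b where "b \<in> tuples (univ M) n" "satisfies_all M b q" using fin[OF q(1,2)] by blast
    then have "b \<in> tuples (univ M) n \<inter> \<Inter>H" unfolding q(3) T_def satisfies_all_def by auto
    then show ?thesis by blast
  qed
  obtain G where G: "T ` p0 \<subseteq> G" "\<And>H. finite H \<Longrightarrow> H \<subseteq> G \<Longrightarrow> tuples (univ M) n \<inter> \<Inter>H \<noteq> {}"
    "\<And>S. S \<in> G \<or> tuples (univ M) n - S \<in> G"
    by (rule ultrafilter_extension[OF fip]) (assumption, assumption, rule that)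
  define p where "p = {x \<in> param_formulas L A n. T x \<in> G}"
  have neg: "T (Neg \<phi>, as) = tuples (univ M) n - T (\<phi>, as)" for \<phi> as by (auto simp: T_def)
  have "complete_type L M A n p"
    unfolding complete_type_def
  proof (intro conjI allI impI)
    show "p \<subseteq> param_formulas L A n" by (auto simp: p_def)
    fix q assume q: "q \<subseteq> p" "finite q"
    then have "T ` q \<subseteq> G" by (auto simp: p_def)
    then obtain b where "b \<in> tuples (univ M) n" "b \<in> \<Inter>(T ` q)" using G(2)[of "T ` q"] q(2) by blast
    then show "\<exists>b\<in>tuples (univ M) n. satisfies_all M b q"
      by (intro bexI[of _ b]) (auto simp: satisfies_all_def T_def)
  next
    show "\<forall>(\<phi>, as)\<in>param_formulas L A n. (\<phi>, as) \<in> p \<or> (Neg \<phi>, as) \<in> p"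
    proof safe
      fix \<phi> as assume *: "(\<phi>, as) \<in> param_formulas L A n" "(Neg \<phi>, as) \<notin> p"
      then have "T (Neg \<phi>, as) \<notin> G" by (auto simp: p_def param_formulas_def)
      then have "T (\<phi>, as) \<in> G" using G(3)[of "T (\<phi>, as)"] neg by auto
      then show "(\<phi>, as) \<in> p" using * by (auto simp: p_def)
    qed
  qed
  then show ?thesis using G(1) p0 by (intro exI[of _ p]) (auto simp: p_def)
qed

lemma (in elem_emb) Def_conv:
  assumes "Def (\<lambda>e. P (e 0)) R"
  obtains \<phi> as where "\<phi> \<in> formulas set_lang" "fv \<phi> \<subseteq> {..<1 + length as}"
    "\<And>x. P x \<longleftrightarrow> sat (set_struct V) ((!) ([x] @ as)) \<phi>"
proof -
  obtain \<phi> c where 1: "\<phi> \<in> formulas set_lang" "\<And>e. P (e 0) \<longleftrightarrow> sat (set_struct V) (mix e c) \<phi>"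
    by (rule DefE[OF assms]) blast
  have "\<exists>N. \<forall>i\<in>fv \<phi>. i < N" by (metis finite_fv finite_nat_set_iff_bounded)
  then obtain N where N: "\<And>i. i \<in> fv \<phi> \<Longrightarrow> i < N" by blast
  \<comment> \<open>Only argument 0 matters, so all argument slots may carry the same
    \<open>x\<close> and every even variable is identified with variable 0. Parameters beyond the
    free variables are cut off, since types use finite lists.\<close>
  let ?r = "\<lambda>i. if even i then 0 else 1 + i div 2"
  let ?as = "map c [0..<N]"
  show ?thesis
  proof (rule that)
    show "ren \<phi> ?r \<in> formulas set_lang" using 1 by simp
    have "?r ` fv \<phi> \<subseteq> {..<1 + length ?as}" using N by fastforce
    then show "fv (ren \<phi> ?r) \<subseteq> {..<1 + length ?as}" using fv_ren[of \<phi> ?r] by (rule order.trans[rotated])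
    fix x
    have "P x \<longleftrightarrow> sat (set_struct V) (mix (\<lambda>_. x) c) \<phi>" using 1(2)[of "\<lambda>_. x"] .
    also have "\<dots> \<longleftrightarrow> sat (set_struct V) ((!) ([x] @ ?as) \<circ> ?r) \<phi>"
      by (rule sat_cong) (use N in \<open>force simp: mix_def\<close>)
    finally show "P x \<longleftrightarrow> sat (set_struct V) ((!) ([x] @ ?as)) (ren \<phi> ?r)" by (simp add: sat_ren)
  qed
qed

text \<open>Each predicate uses finitely many parameters, hence all of them together use a countable
  set, over which saturation realizes types. Later uses of saturation go through this form.\<close>

lemma (in elem_emb) countable_saturation:
  assumes s: "saturated (cardSuc natLeq) set_lang (set_struct V)"
    and D: "\<And>i::nat. Def (\<lambda>e. Q i (e 0)) (R i)"
    and fin: "\<And>m. \<exists>x. \<forall>i<m. Q i x"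
  shows "\<exists>x. \<forall>i. Q i x"
proof -
  have "\<exists>\<phi> as. \<phi> \<in> formulas set_lang \<and> fv \<phi> \<subseteq> {..<1 + length as} \<and>
    (\<forall>x. Q i x \<longleftrightarrow> sat (set_struct V) ((!) ([x] @ as)) \<phi>)" for i
    by (rule Def_conv[OF D[of i]]) blast
  then obtain \<phi> as where \<phi>: "\<And>i. \<phi> i \<in> formulas set_lang" "\<And>i. fv (\<phi> i) \<subseteq> {..<1 + length (as i)}"
    "\<And>i x. Q i x \<longleftrightarrow> sat (set_struct V) ((!) ([x] @ as i)) (\<phi> i)" by metis
  define A where "A = (\<Union>i. set (as i))"
  let ?p = "range (\<lambda>i. (\<phi> i, as i))"
  have pf: "?p \<subseteq> param_formulas set_lang A 1" using \<phi> by (auto simp: param_formulas_def A_def)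
  have sa: "satisfies_all (set_struct V) [x] ((\<lambda>i. (\<phi> i, as i)) ` I) \<longleftrightarrow> (\<forall>i\<in>I. Q i x)" for x I
    using \<phi>(3) by (auto simp: satisfies_all_def)
  have "\<exists>b\<in>tuples (univ (set_struct V)) 1. satisfies_all (set_struct V) b q" if "q \<subseteq> ?p" "finite q" for q
  proof -
    obtain I where I: "finite I" "q = (\<lambda>i. (\<phi> i, as i)) ` I" using finite_subset_image[OF \<open>finite q\<close> \<open>q \<subseteq> ?p\<close>] by blast
    then obtain m where "\<forall>i\<in>I. i < m" using finite_nat_set_iff_bounded by blast
    then obtain x where "\<forall>i\<in>I. Q i x" using fin by blast
    then show ?thesis using sa I(2) by (intro bexI[of _ "[x]"]) (auto simp: tuples_def)
  qed
  from extend_to_complete_type[OF pf this]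
  obtain p where p: "complete_type set_lang (set_struct V) A 1 p" "?p \<subseteq> p" by blast
  have "countable A" unfolding A_def by (auto intro: countable_finite)
  then have "|A| \<le>o |UNIV :: nat set|" by (metis card_of_ordLeq countable_def subset_UNIV)
  then have "|A| \<le>o natLeq" using card_of_nat ordLeq_ordIso_trans by blast
  then have "|A| <o cardSuc natLeq" by (simp add: cardSuc_ordLess_ordLeq cardSuc_greater natLeq_Card_order card_of_Card_order ordLeq_ordLess_trans)
  then have "realizes_types_over set_lang (set_struct V) A" using s by (auto simp: saturated_def)
  then obtain b where b: "b \<in> tuples UNIV 1" "satisfies_all (set_struct V) b p"
    using p(1) unfolding realizes_types_over_def by (metis univ_set_struct)
  then obtain x where x: "b = [x]" using b(1) by (auto simp: tuples_def length_Suc_conv)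
  have "satisfies_all (set_struct V) [x] ?p" using b(2) p(2) x by (auto simp: satisfies_all_def)
  then show ?thesis using sa by blast
qed

section \<open>Transfer to the nonstandard model\<close>

locale ext_model = V: zfc_model V + elem_emb V W j
  for V :: "'v \<Rightarrow> 'v \<Rightarrow> bool" and W :: "'w \<Rightarrow> 'w \<Rightarrow> bool" and j :: "'v \<Rightarrow> 'w"

sublocale ext_model \<subseteq> set_emb V W j
  by (intro set_emb.intro elem_emb_axioms weak_set_theory_transfer V.weak_set_theory_axioms)

sublocale ext_model \<subseteq> WW: set_emb W W "\<lambda>x. x"
  by (rule set_emb_id[OF W.weak_set_theory_axioms])

text \<open>For a standard number this is first-order and independent of the omega of the model.
  Infinity thereby becomes a countable list of conditions, ready for saturation.\<close>

definition at_least :: "nat \<Rightarrow> 'a set \<Rightarrow> bool" where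
  "at_least n S \<longleftrightarrow> (\<exists>s\<subseteq>S. finite s \<and> card s = n)"

lemma at_least_0 [simp]: "at_least 0 S"
  unfolding at_least_def by (rule exI[of _ "{}"]) simp

lemma at_least_Suc: "at_least (Suc n) S \<longleftrightarrow> (\<exists>x\<in>S. at_least n (S - {x}))"
proof
  assume "at_least (Suc n) S"
  then obtain s where s: "s \<subseteq> S" "finite s" "card s = Suc n" by (auto simp: at_least_def)
  then obtain x where x: "x \<in> s" by fastforce
  have "at_least n (S - {x})" unfolding at_least_def
    by (intro exI[of _ "s - {x}"]) (use s x in auto)
  then show "\<exists>x\<in>S. at_least n (S - {x})" using x s by blast
next
  assume "\<exists>x\<in>S. at_least n (S - {x})"
  then obtain x s where "x \<in> S" "s \<subseteq> S - {x}" "finite s" "card s = n" by (auto simp: at_least_def)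
  then show "at_least (Suc n) S" unfolding at_least_def
    by (intro exI[of _ "insert x s"]) (auto simp: card_insert_if)
qed

lemma at_least_finite:
  assumes "finite S" shows "at_least n S \<longleftrightarrow> n \<le> card S"
proof
  assume "n \<le> card S"
  then obtain s where "s \<subseteq> S" "card s = n" "finite s" by (rule obtain_subset_with_card_n)
  then show "at_least n S" by (auto simp: at_least_def)
qed (use assms card_mono in \<open>auto simp: at_least_def\<close>)

lemma at_least_infinite: "infinite S \<Longrightarrow> at_least n S"
  using infinite_arbitrarily_large[of S n] by (auto simp: at_least_def)

lemma infinite_if_at_least: "(\<And>n. at_least n S) \<Longrightarrow> infinite S"
  using at_least_finite[of S "Suc (card S)"] by force

lemma (in elem_emb) Def_at_least:
  assumes "Def (\<lambda>e. P (e 0) (\<lambda>i. e (Suc i))) (\<lambda>e. Q (e 0) (\<lambda>i. e (Suc i)))"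
  shows "Def (\<lambda>e. at_least n {x. P x e}) (\<lambda>e. at_least n {x. Q x e})"
  using assms
proof (induct n arbitrary: P Q)
  case (Suc n)
  have "Def (\<lambda>e. P (e 0) (\<lambda>i. e (Suc (Suc i))) \<and> e 0 \<noteq> e (Suc 0)) (\<lambda>e. Q (e 0) (\<lambda>i. e (Suc (Suc i))) \<and> e 0 \<noteq> e (Suc 0))"
    using Def_rename[OF Suc(2), of "case_nat 0 (\<lambda>i. Suc (Suc i))"] by (intro def_intros) simp
  from Suc(1)[of "\<lambda>x e. P x (\<lambda>i. e (Suc i)) \<and> x \<noteq> e 0" "\<lambda>x e. Q x (\<lambda>i. e (Suc i)) \<and> x \<noteq> e 0", OF this]
  have "Def (\<lambda>e. \<exists>x. P x e \<and> at_least n {y. P y e \<and> y \<noteq> x}) (\<lambda>e. \<exists>x. Q x e \<and> at_least n {y. Q y e \<and> y \<noteq> x})"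
    by (intro Def_ex Def_conj Suc(2))
  moreover have "{x. P x e} - {x} = {y. P y e \<and> y \<noteq> x}" "{x. Q x e'} - {x'} = {y. Q y e' \<and> y \<noteq> x'}"
    for e e' x x' by auto
  ultimately show ?case by (simp add: at_least_Suc)
qed (simp add: def_intros)

lemma seq_tuples_Suc:
  "z \<in> seq V ` tuples X (Suc k) \<longleftrightarrow> (\<exists>a. a \<in> X \<and> (\<exists>y. y \<in> seq V ` tuples X k \<and> z = opair V a y))"
proof
  assume "\<exists>a. a \<in> X \<and> (\<exists>y. y \<in> seq V ` tuples X k \<and> z = opair V a y)"
  then obtain a as where "a \<in> X" "as \<in> tuples X k" "z = seq V (a # as)" by auto
  then show "z \<in> seq V ` tuples X (Suc k)"
    by (intro image_eqI[of _ _ "a # as"]) (auto simp: tuples_Suc)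
next
  assume "z \<in> seq V ` tuples X (Suc k)"
  then obtain a as where "a \<in> X" "as \<in> tuples X k" "z = opair V a (seq V as)"
    by (auto simp: tuples_Suc)
  then show "\<exists>a. a \<in> X \<and> (\<exists>y. y \<in> seq V ` tuples X k \<and> z = opair V a y)" by blast
qed

lemma (in set_emb) Def_in_tuples [def_intros]:
  assumes "FDef t u" "FDef t' u'"
  shows "Def (\<lambda>e. t e \<in> seq V ` tuples (ext V (t' e)) k) (\<lambda>e. u e \<in> seq W ` tuples (ext W (u' e)) k)"
  using assms
proof (induct k arbitrary: t u t' u')
  case 0
  have "Def (\<lambda>e. t e = elem V {}) (\<lambda>e. u e = elem W {})" by (intro def_intros 0)
  then show ?case by simp
next
  case (Suc k)
  show ?case unfolding seq_tuples_Suc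
    by (intro def_intros Suc(1) FDef_rename[OF Suc(2)] FDef_rename[OF Suc(3)])
qed

section \<open>Order and overspill in the omega of \<open>W\<close>\<close>

context ext_model begin

lemma num_W_inject [simp]: "num W m = num W n \<longleftrightarrow> m = n"
  by (metis j_num j_inj V.num_inject)

lemma omega_linear:
  assumes "W x (omega W)" "W y (omega W)" shows "x = y \<or> W x y \<or> W y x"
proof -
  have lt: "V (num V m) (num V n)" if "m < n" for m n
    using that V.ext_num[of n] by (auto simp: ext_def)
  have "m = n \<or> V (num V m) (num V n) \<or> V (num V n) (num V m)" for m n
    using lt[of m n] lt[of n m] by linarith
  then have "\<forall>x\<in>ext V (omega V). \<forall>y\<in>ext V (omega V). x = y \<or> V x y \<or> V y x"
    unfolding V.ext_omega by simp
  also have "?this \<longleftrightarrow> (\<forall>x\<in>ext W (omega W). \<forall>y\<in>ext W (omega W). x = y \<or> W x y \<or> W y x)"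
    by (rule Def_closed) (intro def_intros)
  finally show ?thesis using assms by (simp add: in_ext)
qed

lemma omega_trans:
  assumes "W y z" "W z (omega W)" shows "W y (omega W)"
proof -
  have "\<forall>z\<in>ext V (omega V). ext V z \<subseteq> ext V (omega V)"
    unfolding V.ext_omega by (auto simp: V.ext_num)
  also have "?this \<longleftrightarrow> (\<forall>z\<in>ext W (omega W). ext W z \<subseteq> ext W (omega W))"
    by (rule Def_closed) (intro def_intros)
  finally show ?thesis using assms by (auto simp: in_ext subset_eq)
qed

lemma omega_trans': assumes "W x y" "W y z" "W z (omega W)" shows "W x z"
proof -
  have "\<forall>z\<in>ext V (omega V). \<forall>y\<in>ext V z. ext V y \<subseteq> ext V z"
    unfolding V.ext_omega by (auto simp: V.ext_num)
  also have "?this \<longleftrightarrow> (\<forall>z\<in>ext W (omega W). \<forall>y\<in>ext W z. ext W y \<subseteq> ext W z)"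
    by (rule Def_closed) (intro def_intros)
  finally show ?thesis using assms by (auto simp: in_ext subset_eq)
qed

text \<open>\<open>W\<close> may be ill-founded, but the statement that every nonempty set has a
  membership-minimal element is first-order and true in the well-founded \<open>V\<close>.\<close>

lemma omega_least_elem:
  assumes "ext W u \<subseteq> ext W (omega W)" "ext W u \<noteq> {}"
  shows "\<exists>x\<in>ext W u. \<forall>y\<in>ext W u. \<not> W y x"
proof -
  have "\<exists>x\<in>ext V u. \<forall>y\<in>ext V u. \<not> V y x" if "\<exists>x. x \<in> ext V u" for u
  proof -
    have "wfp V" by (rule V.wfp)
    then show ?thesis using that unfolding wfp_eq_minimal by (metis in_ext)
  qed
  then have "\<forall>u. (\<exists>x. x \<in> ext V u) \<longrightarrow> (\<exists>x\<in>ext V u. \<forall>y\<in>ext V u. \<not> V y x)" by blast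
  also have "?this \<longleftrightarrow> (\<forall>u. (\<exists>x. x \<in> ext W u) \<longrightarrow> (\<exists>x\<in>ext W u. \<forall>y\<in>ext W u. \<not> W y x))"
    by (rule Def_closed) (intro def_intros)
  finally show ?thesis using assms by blast
qed

definition NS :: "'w set" where
  "NS = {N. W N (omega W) \<and> N \<notin> range (num W)}"

lemma num_less_NS: "N \<in> NS \<Longrightarrow> W (num W n) N"
  using omega_linear[of N "num W n"] W.num_in_omega[of n] W.ext_num[of n]
  by (auto simp: NS_def ext_def set_eq_iff)

text \<open>The counterexamples form an internal subset of omega. Its least element, if there is
  one, is nonstandard because standard numbers satisfy \<open>P\<close>, and it serves as
  \<open>N\<close>; otherwise any nonstandard number does.\<close>

lemma overspill:
  assumes "WW.Def (\<lambda>e. P (e 0)) (\<lambda>e. P (e 0))" "\<And>n. P (num W n)" "NS \<noteq> {}"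
  shows "\<exists>N\<in>NS. \<forall>m. W m N \<longrightarrow> P m"
proof -
  have "in_model W {x \<in> ext W (omega W). \<not> P x}"
    by (rule W.sep1) (rule WW.Def_neg[OF assms(1)])
  then obtain u where u: "ext W u = {x \<in> ext W (omega W). \<not> P x}" by (auto simp: in_model_def)
  show ?thesis
  proof (cases "ext W u = {}")
    case True
    then show ?thesis using assms(3) u omega_trans by (auto simp: NS_def in_ext)
  next
    case False
    then obtain x where x: "x \<in> ext W u" "\<forall>y\<in>ext W u. \<not> W y x"
      using omega_least_elem[of u] u by blast
    then have "x \<in> NS" using u assms(2) by (auto simp: NS_def in_ext)
    moreover have "P m" if "W m x" for m
      using x u that omega_trans[of m x] by (auto simp: in_ext)
    ultimately show ?thesis by blast
  qed
qed

section \<open>Internally finite sets\<close>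

lemma bf_empty: "believes_finite W (elem W {})"
proof -
  have "believes_finite V (elem V {})" by (simp add: V.believes_finite_finite)
  also have "?this \<longleftrightarrow> believes_finite W (elem W {})"
    by (rule Def_closed) (intro def_intros)
  finally show ?thesis .
qed

lemma bf_insert: assumes "believes_finite W a" shows "believes_finite W (elem W (insert x (ext W a)))"
proof -
  have "\<forall>a x. believes_finite V a \<longrightarrow> believes_finite V (elem V (insert x (ext V a)))"
    by (simp add: V.believes_finite_finite)
  also have "?this \<longleftrightarrow> (\<forall>a x. believes_finite W a \<longrightarrow> believes_finite W (elem W (insert x (ext W a))))"
    by (rule Def_closed) (intro def_intros)
  finally show ?thesis using assms by blast
qed

lemma bf_finite_set: "finite X \<Longrightarrow> \<exists>a. ext W a = X \<and> believes_finite W a"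
proof (induct X rule: finite_induct)
  case empty
  show ?case using bf_empty by (intro exI[of _ "elem W {}"]) simp
next
  case (insert x F)
  then obtain a where "ext W a = F" "believes_finite W a" by blast
  then show ?case using bf_insert[of a x] W.ext_insert[of x a] by (intro exI[of _ "elem W (insert x (ext W a))"]) auto
qed

lemma bf_subset: assumes "believes_finite W b" "ext W a \<subseteq> ext W b" shows "believes_finite W a"
proof -
  have "\<forall>a b. believes_finite V b \<and> ext V a \<subseteq> ext V b \<longrightarrow> believes_finite V a"
    using finite_subset by (auto simp: V.believes_finite_finite)
  also have "?this \<longleftrightarrow> (\<forall>a b. believes_finite W b \<and> ext W a \<subseteq> ext W b \<longrightarrow> believes_finite W a)"
    by (rule Def_closed) (intro def_intros)
  finally show ?thesis using assms by blast
qed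

lemma bf_tuples: assumes "believes_finite W B"
  shows "\<exists>C. believes_finite W C \<and> ext W C = seq W ` tuples (ext W B) k"
proof -
  have "finite (tuples X k)" if "finite X" for X :: "'v set"
    using finite_lists_length_eq[OF that, of k] by (auto simp: tuples_def conj_commute)
  then have "\<exists>C. believes_finite V C \<and> (\<forall>z. V z C \<longleftrightarrow> z \<in> seq V ` tuples (ext V B) k)"
    if "believes_finite V B" for B
  proof -
    obtain C where C: "ext V C = seq V ` tuples (ext V B) k"
      using V.in_model_tuples[of B k] by (auto simp: in_model_def)
    then have "V z C \<longleftrightarrow> z \<in> seq V ` tuples (ext V B) k" for z by (metis in_ext)
    then show ?thesis using C \<open>believes_finite V B\<close> \<open>\<And>X. finite X \<Longrightarrow> finite (tuples X k)\<close>
      by (intro exI[of _ C]) (auto simp: V.believes_finite_finite)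
  qed
  then have "\<forall>B. believes_finite V B \<longrightarrow> (\<exists>C. believes_finite V C \<and> (\<forall>z. V z C \<longleftrightarrow> z \<in> seq V ` tuples (ext V B) k))"
    by blast
  also have "?this \<longleftrightarrow> (\<forall>B. believes_finite W B \<longrightarrow> (\<exists>C. believes_finite W C \<and> (\<forall>z. W z C \<longleftrightarrow> z \<in> seq W ` tuples (ext W B) k)))"
    by (rule Def_closed) (intro def_intros)
  finally show ?thesis using assms by (auto simp: set_eq_iff in_ext)
qed

text \<open>Patterns live on coded tuples while types have single elements as parameters; this
  passes from the former to the latter and stays internally finite. In \<open>V\<close> it amounts
  to collecting the entries of finitely many lists.\<close>

lemma bf_coordinates:
  assumes "believes_finite W F" "ext W F \<subseteq> seq W ` tuples (ext W D) k"
  shows "\<exists>B. believes_finite W B \<and> ext W B \<subseteq> ext W D \<and> ext W F \<subseteq> seq W ` tuples (ext W B) k"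
proof -
  have "\<exists>B. believes_finite V B \<and> ext V B \<subseteq> ext V D \<and> (\<forall>z\<in>ext V F. z \<in> seq V ` tuples (ext V B) k)"
    if F: "believes_finite V F" "\<forall>z\<in>ext V F. z \<in> seq V ` tuples (ext V D) k" for F D
  proof -
    have "\<forall>z\<in>ext V F. \<exists>as. as \<in> tuples (ext V D) k \<and> z = seq V as" using F(2) by blast
    from bchoice[OF this] obtain f
      where f: "\<And>z. z \<in> ext V F \<Longrightarrow> f z \<in> tuples (ext V D) k \<and> z = seq V (f z)" by blast
    let ?B = "\<Union>z\<in>ext V F. set (f z)"
    have fin: "finite ?B" using F by (simp add: V.believes_finite_finite)
    then obtain B where B: "ext V B = ?B" using V.in_model_finite[OF fin] unfolding in_model_def by blast
    have "?B \<subseteq> ext V D" using f by (auto simp: tuples_def)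
    moreover have "z \<in> seq V ` tuples ?B k" if "z \<in> ext V F" for z
      using f[OF that] that by (intro image_eqI[of _ _ "f z"]) (auto simp: tuples_def)
    ultimately show ?thesis using fin by (intro exI[of _ B]) (auto simp: B V.believes_finite_finite)
  qed
  then have "\<forall>F D. believes_finite V F \<and> (\<forall>z\<in>ext V F. z \<in> seq V ` tuples (ext V D) k) \<longrightarrow>
    (\<exists>B. believes_finite V B \<and> ext V B \<subseteq> ext V D \<and> (\<forall>z\<in>ext V F. z \<in> seq V ` tuples (ext V B) k))" by blast
  also have "?this \<longleftrightarrow> (\<forall>F D. believes_finite W F \<and> (\<forall>z\<in>ext W F. z \<in> seq W ` tuples (ext W D) k) \<longrightarrow>
    (\<exists>B. believes_finite W B \<and> ext W B \<subseteq> ext W D \<and> (\<forall>z\<in>ext W F. z \<in> seq W ` tuples (ext W B) k)))"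
    by (rule Def_closed) (intro def_intros)
  finally show ?thesis using assms by (auto simp: subset_eq)
qed

lemma pseudofinite_insert: "pseudofinite W X \<Longrightarrow> pseudofinite W (insert x X)"
  unfolding pseudofinite_def using bf_insert by (metis W.ext_insert insert_mono)

lemma pseudofinite_in:
  assumes "pseudofinite W X" "X \<subseteq> ext W D"
  shows "\<exists>F. believes_finite W F \<and> ext W F \<subseteq> ext W D \<and> X \<subseteq> ext W F"
proof -
  obtain a where a: "believes_finite W a" "X \<subseteq> ext W a" using assms by (auto simp: pseudofinite_def)
  have "in_model W {x \<in> ext W a. x \<in> ext W D}"
    by (rule W.sep1) (intro WW.def_intros)
  then obtain F where F: "ext W F = {x \<in> ext W a. x \<in> ext W D}" by (auto simp: in_model_def)
  then show ?thesis using bf_subset[OF a(1), of F] a assms by blast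
qed

end

section \<open>Realizing a chain of local types\<close>

lemma finite_ordLeq_infinite: "finite B \<Longrightarrow> infinite C \<Longrightarrow> |B| \<le>o |C|"
  by (metis card_of_Well_order card_of_ordLeq_infinite ordLeq_total)

text \<open>\<open>X i\<close> is the set of instances of the \<open>i\<close>-th formula \<open>R i\<close> in the type to be realized, where
  each formula implies the previous one; \<open>Y i\<close> is an internally finite set containing it, and \<open>U\<close>
  is an ultrafilter extending the type.\<close>

locale type_core = ext_model V W j for V :: "'v \<Rightarrow> 'v \<Rightarrow> bool" and W :: "'w \<Rightarrow> 'w \<Rightarrow> bool" and j +
  fixes B :: 'w and I Y :: "nat \<Rightarrow> 'w" and R :: "nat \<Rightarrow> 'w \<Rightarrow> 'w \<Rightarrow> bool" and X :: "nat \<Rightarrow> 'w set"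
    and U :: "'w set set" and lam :: "'w set"
  fixes real :: "nat \<Rightarrow> 'w set \<Rightarrow> bool" and minimal :: "nat \<Rightarrow> 'w \<Rightarrow> bool"
  defines "real \<equiv> \<lambda>i Z. \<exists>b\<in>ext W B. \<forall>z\<in>Z. R i b z"
    and "minimal \<equiv> \<lambda>i F. believes_finite W F \<and> ext W F \<subseteq> ext W (I i) \<and> \<not> real i (ext W F) \<and>
      (\<forall>G. ext W G \<subseteq> ext W F \<and> G \<noteq> F \<longrightarrow> real i (ext W G))"
  assumes lam: "infinite lam"
    and sat: "saturated (cardSuc natLeq) set_lang (set_struct W)"
    and NS_ne: "NS \<noteq> {}"
    and R_Def: "WW.Def (\<lambda>e. R i (e 0) (e 1)) (\<lambda>e. R i (e 0) (e 1))"
    and XY: "X i \<subseteq> ext W (Y i)" and YI: "ext W (Y i) \<subseteq> ext W (I i)"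
    and Y_bf: "believes_finite W (Y i)" and X_card: "|X i| \<le>o |lam|"
    and U_fip: "finite H \<Longrightarrow> H \<subseteq> U \<Longrightarrow> ext W B \<inter> \<Inter>H \<noteq> {}"
    and U_max: "S \<in> U \<or> ext W B - S \<in> U"
    and XU: "z \<in> X i \<Longrightarrow> {b \<in> ext W B. R i b z} \<in> U"
    and chain: "z \<in> ext W (Y i) \<Longrightarrow> \<exists>z'\<in>ext W (Y (Suc i)). (z \<in> X i \<longrightarrow> z' \<in> X (Suc i)) \<and>
      (\<forall>b\<in>ext W B. R (Suc i) b z' \<longrightarrow> R i b z) \<and>
      ({b \<in> ext W B. R i b z} \<in> U \<longrightarrow> {b \<in> ext W B. R (Suc i) b z'} \<in> U)"
    and local: "pseudofinite W Z \<Longrightarrow> Z \<subseteq> ext W (I i) \<Longrightarrow> |Z| \<le>o |lam| \<Longrightarrow>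
      (\<And>s. s \<subseteq> Z \<Longrightarrow> finite s \<Longrightarrow> real i s) \<Longrightarrow> real i Z"
    and local_diff: "believes_finite W F \<Longrightarrow> ext W F \<subseteq> ext W (I i) \<Longrightarrow> P \<subseteq> ext W F \<times> ext W F \<Longrightarrow> |P| \<le>o |lam| \<Longrightarrow>
      (\<And>s. s \<subseteq> P \<Longrightarrow> finite s \<Longrightarrow> \<exists>b\<in>ext W B. \<forall>(u, v)\<in>s. R i b u \<and> \<not> R i b v) \<Longrightarrow>
      \<exists>b\<in>ext W B. \<forall>(u, v)\<in>P. R i b u \<and> \<not> R i b v"
    and ex_minimal: "believes_finite W F \<Longrightarrow> ext W F \<subseteq> ext W (I i) \<Longrightarrow> \<not> real i (ext W F) \<Longrightarrow>
      \<exists>G. ext W G \<subseteq> ext W F \<and> minimal i G"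
    and reflect_minimal: "minimal i F \<Longrightarrow> at_least n (ext W F) \<Longrightarrow>
      \<exists>G. minimal i G \<and> at_least n (ext W G) \<and> finite (ext W G)"
begin

section \<open>The global type given by the ultrafilter\<close>

lemma Def_R [WW.def_intros]: "WW.FDef t t \<Longrightarrow> WW.FDef u u \<Longrightarrow> WW.Def (\<lambda>e. R i (t e) (u e)) (\<lambda>e. R i (t e) (u e))"
  by (rule WW.Def_lift2[OF R_Def])

lemma saturation:
  assumes "\<And>i::nat. WW.Def (\<lambda>e. Q i (e 0)) (\<lambda>e. Q i (e 0))" "\<And>m. \<exists>x. \<forall>i<m. Q i x"
  shows "\<exists>x. \<forall>i. Q i x"
  by (rule WW.countable_saturation[OF sat assms])

lemma FDef_param [WW.def_intros]: "WW.FDef (\<lambda>_. a) (\<lambda>_. a)"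
  by (rule WW.FDef_const)

text \<open>The defining set of the global type \<open>U\<close> for the relation
  \<open>R i\<close>. Absence of long ladders will make it internal, which cannot be expected of
  \<open>X i\<close>.\<close>

definition D :: "nat \<Rightarrow> 'w set" where
  "D i = {z \<in> ext W (I i). {b \<in> ext W B. R i b z} \<in> U}"

lemma XD: "X i \<subseteq> D i"
  using XU XY YI by (fastforce simp: D_def)

lemma pick: "finite H \<Longrightarrow> H \<subseteq> U \<Longrightarrow> \<exists>b\<in>ext W B. \<forall>S\<in>H. b \<in> S"
  using U_fip[of H] by blast

text \<open>Membership in \<open>D i\<close> decides each of the finitely many instances; the sets
  so chosen, complements included, are in \<open>U\<close> and have a common point.\<close>

lemma pick_D:
  assumes "finite T" "T \<subseteq> ext W (I i)"
  shows "\<exists>b\<in>ext W B. \<forall>z\<in>T. R i b z \<longleftrightarrow> z \<in> D i"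
proof -
  let ?S = "\<lambda>z. if z \<in> D i then {b \<in> ext W B. R i b z} else ext W B - {b \<in> ext W B. R i b z}"
  have "?S ` T \<subseteq> U" using U_max assms(2) by (auto simp: D_def)
  then obtain b where b: "b \<in> ext W B" "\<forall>S\<in>?S ` T. b \<in> S" using pick[of "?S ` T"] assms(1) by blast
  have "R i b z \<longleftrightarrow> z \<in> D i" if "z \<in> T" for z
    using bspec[OF b(2) imageI[OF that]] b(1) by (cases "z \<in> D i") auto
  then show ?thesis using b(1) by blast
qed

lemma real_finite: "finite T \<Longrightarrow> T \<subseteq> D i \<Longrightarrow> real i T"
  using pick_D[of T i] by (auto simp: real_def D_def)

lemma X_mono:
  assumes "i \<le> m" "b \<in> ext W B" "\<forall>z\<in>X m. R m b z"
  shows "\<forall>z\<in>X i. R i b z"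
  using assms(1,3)
proof (induct m rule: dec_induct)
  case (step n)
  have "R n b z" if "z \<in> X n" for z
    using chain[of z n] XY that step.prems assms(2) by blast
  then show ?case using step.hyps by blast
qed

text \<open>The internal sets \<open>D i \<inter> ext W (Y i)\<close> may be larger than
  \<open>X i\<close> and yet have to form a chain. This is why \<open>chain\<close> provides a
  successor for every \<open>z\<close> in \<open>Y i\<close>, with a clause on membership in
  \<open>U\<close>.\<close>

lemma D_mono:
  assumes "i \<le> m" "b \<in> ext W B" "\<forall>z\<in>D m \<inter> ext W (Y m). R m b z"
  shows "\<forall>z\<in>D i \<inter> ext W (Y i). R i b z"
  using assms(1,3)
proof (induct m rule: dec_induct)
  case (step n)
  have "R n b z" if z: "z \<in> D n \<inter> ext W (Y n)" for z
  proof -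
    obtain z' where z': "z' \<in> ext W (Y (Suc n))" "R (Suc n) b z' \<longrightarrow> R n b z"
      "{b \<in> ext W B. R n b z} \<in> U \<longrightarrow> {b \<in> ext W B. R (Suc n) b z'} \<in> U"
      using chain[of z n] z assms(2) by blast
    then have "z' \<in> D (Suc n)" using z YI by (auto simp: D_def)
    then show ?thesis using z' step.prems by blast
  qed
  then show ?case using step.hyps by blast
qed

lemma card_UN: "(\<And>i::nat. |A i| \<le>o |lam| ) \<Longrightarrow> |\<Union>i. A i| \<le>o |lam|"
  using card_of_UNION_ordLeq_infinite[OF lam, of "UNIV :: nat set" A] infinite_iff_card_of_nat lam by blast

lemma NS_pred: assumes "N \<in> NS" shows "\<exists>m\<in>NS. W m N"
proof -
  have N: "W N (omega W)" using assms by (simp add: NS_def)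
  have "N \<noteq> num W 0" using assms by (auto simp: NS_def simp del: num.simps)
  then have "N \<noteq> elem W {}" by simp
  then obtain y where y: "W y (omega W)" "N = succ_elem W y" using W.omega_cases[OF N] by blast
  have "y \<notin> range (num W)"
  proof
    assume "y \<in> range (num W)"
    then obtain k where "y = num W k" by blast
    then have "N = num W (Suc k)" using y by simp
    then show False using assms by (auto simp: NS_def simp del: num.simps)
  qed
  moreover have "W y N" using y W.ext_succ[of y] by (auto simp: ext_def)
  ultimately show ?thesis using y by (auto simp: NS_def)
qed

lemma real_X: "real i (X i)"
proof (rule local)
  show "pseudofinite W (X i)" using XY Y_bf by (auto simp: pseudofinite_def)
  show "X i \<subseteq> ext W (I i)" using XY YI by blast
  show "|X i| \<le>o |lam|" by (rule X_card)
  show "real i s" if "s \<subseteq> X i" "finite s" for s using real_finite[OF that(2)] that(1) XD by blast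
qed

text \<open>Saturation extends the sequence \<open>b\<close> of local realizations to an internal
  partial function \<open>f\<close>. An instance in \<open>X i\<close> holds at \<open>f m\<close>
  for all \<open>m\<close> from \<open>i\<close> up to some nonstandard bound. There are at most
  \<open>|lam|\<close> such bounds, so a nonstandard \<open>n\<close> lies below all of them, and
  \<open>f n\<close> satisfies every instance.\<close>

lemma realize_large_cofinality:
  assumes cof: "\<And>N. N \<subseteq> NS \<Longrightarrow> |N| \<le>o |lam| \<Longrightarrow> \<exists>n\<in>NS. \<forall>y\<in>N. W n y"
  shows "\<exists>b\<in>ext W B. \<forall>i. \<forall>z\<in>X i. R i b z"
proof -
  have "\<forall>i. \<exists>b. b \<in> ext W B \<and> (\<forall>z\<in>X i. R i b z)" using real_X unfolding real_def by blast
  from choice[OF this] obtain b where b: "\<And>i. b i \<in> ext W B" "\<And>i z. z \<in> X i \<Longrightarrow> R i (b i) z" by blast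
  define Q where "Q k f \<longleftrightarrow> (\<forall>n x y. W (opair W n x) f \<and> W (opair W n y) f \<longrightarrow> x = y) \<and>
    (\<forall>n x. W (opair W n x) f \<longrightarrow> x \<in> ext W B) \<and> W (opair W (num W k) (b k)) f" for k :: nat and f
  have "\<exists>f. \<forall>k. Q k f"
  proof (rule saturation)
    show "WW.Def (\<lambda>e. Q i (e 0)) (\<lambda>e. Q i (e 0))" for i
      unfolding Q_def by (intro WW.def_intros FDef_param)
    fix m
    let ?F = "(\<lambda>k. opair W (num W k) (b k)) ` {..<m}"
    have "in_model W ?F" by (rule W.in_model_finite) simp
    then obtain f where f: "ext W f = ?F" by (auto simp: in_model_def)
    then have "W p f \<longleftrightarrow> p \<in> ?F" for p by (metis in_ext)
    then show "\<exists>f. \<forall>i<m. Q i f"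
      by (intro exI[of _ f]) (auto simp: Q_def b)
  qed
  then obtain f where "\<And>k. Q k f" by blast
  then have f: "\<And>n x y. W (opair W n x) f \<Longrightarrow> W (opair W n y) f \<Longrightarrow> x = y"
    "\<And>n x. W (opair W n x) f \<Longrightarrow> x \<in> ext W B" "\<And>k. W (opair W (num W k) (b k)) f"
    unfolding Q_def by blast+
  \<comment> \<open>The first disjunct exempts the stages before \<open>i\<close>, at which nothing
    is known about \<open>R i\<close>. A nonstandard \<open>m\<close> never falls under it.\<close>
  define P where "P i z m \<longleftrightarrow> W m (num W i) \<or> (\<exists>x. W (opair W m x) f \<and> R i x z)" for i z m
  have ex_N: "\<exists>N\<in>NS. \<forall>m. W m N \<longrightarrow> P i z m" if z: "z \<in> X i" for i z
  proof (rule overspill)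
    show "WW.Def (\<lambda>e. P i z (e 0)) (\<lambda>e. P i z (e 0))"
      unfolding P_def by (intro WW.def_intros FDef_param)
    show "P i z (num W n)" for n
    proof (cases "n < i")
      case True
      then show ?thesis using W.ext_num[of i] by (auto simp: P_def ext_def set_eq_iff)
    next
      case False
      then have "R i (b n) z" using X_mono[of i n "b n"] b z by auto
      then show ?thesis using f(3) by (auto simp: P_def)
    qed
  qed (rule NS_ne)
  define N where "N i z = (SOME N. N \<in> NS \<and> (\<forall>m. W m N \<longrightarrow> P i z m))" for i z
  have N: "N i z \<in> NS" "W m (N i z) \<Longrightarrow> P i z m" if "z \<in> X i" for i z m
    using someI_ex[OF ex_N[OF that, unfolded Bex_def]] by (auto simp: N_def)
  have "|\<Union>i. N i ` X i| \<le>o |lam|"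
    by (rule card_UN) (rule ordLeq_transitive[OF card_of_image X_card])
  moreover have "(\<Union>i. N i ` X i) \<subseteq> NS" using N(1) by blast
  ultimately have "\<exists>n\<in>NS. \<forall>y\<in>(\<Union>i. N i ` X i). W n y" by (intro cof)
  then obtain n where n: "n \<in> NS" "\<And>i z. z \<in> X i \<Longrightarrow> W n (N i z)" by blast
  have ex: "\<exists>x. W (opair W n x) f \<and> R i x z" if z: "z \<in> X i" for i z
  proof -
    have "\<not> W n (num W i)" using n(1) W.ext_num[of i] by (auto simp: NS_def ext_def set_eq_iff)
    then show ?thesis using N(2)[OF z n(2)[OF z]] by (auto simp: P_def)
  qed
  \<comment> \<open>An instance is what puts \<open>n\<close> into the domain of \<open>f\<close>.
    If there is none, any element of \<open>B\<close> will do.\<close>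
  show ?thesis
  proof (cases "\<exists>i z. z \<in> X i")
    case True
    then obtain i0 z0 where "z0 \<in> X i0" by blast
    then obtain x where x: "W (opair W n x) f" using ex by blast
    then have "R i x z" if "z \<in> X i" for i z using ex[OF that] f(1) by blast
    then show ?thesis using f(2)[OF x] by blast
  qed (use b(1) in blast)
qed

text \<open>The order property up to length \<open>K\<close>: each initial segment of the parameters
  \<open>c l\<close>, the empty and the full one included, is cut out by an element of
  \<open>B\<close>. A bound on \<open>K\<close> expresses stability of \<open>R i\<close>.\<close>

definition ladder :: "nat \<Rightarrow> nat \<Rightarrow> bool" where
  "ladder i K \<longleftrightarrow> (\<exists>c. (\<forall>l<K. c l \<in> ext W (I i)) \<and>
    (\<forall>m\<le>K. \<exists>b\<in>ext W B. \<forall>l<K. R i b (c l) \<longleftrightarrow> l < m))"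

text \<open>Here \<open>N0\<close> is the small coinitial set left by the failure of case (A). In a
  ladder of nonstandard length one asks for \<open>b\<close> that satisfies all standard rungs and
  none with index in \<open>N0\<close>: at most \<open>|lam|\<close> pairs of instances, hence
  realizable by \<open>local_diff\<close>. By overspill \<open>b\<close> satisfies all rungs up to
  some nonstandard index, and \<open>N0\<close> has an element below it.\<close>

lemma no_long_ladder:
  assumes Y0: "N0 \<subseteq> NS" "|N0| \<le>o |lam|" "\<And>n. n \<in> NS \<Longrightarrow> \<exists>y\<in>N0. \<not> W n y"
  shows "\<exists>K. \<not> ladder i K"
proof (rule ccontr)
  assume "\<not> ?thesis"
  then have lad: "ladder i K" for K by blast
  \<comment> \<open>Going to a smaller nonstandard number first turns the weak inequality obtained
    from \<open>Y0\<close> into a strict one.\<close>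
  have coinit: "\<exists>y\<in>N0. W y n" if n: "n \<in> NS" for n
  proof -
    obtain m where m: "m \<in> NS" "W m n" using NS_pred[OF n] by blast
    obtain y where y: "y \<in> N0" "\<not> W m y" using Y0(3)[OF m(1)] by blast
    then have "y = m \<or> W y m" using omega_linear[of y m] m Y0(1) by (auto simp: NS_def)
    then show ?thesis using y(1) m n omega_trans'[of y m n] by (auto simp: NS_def)
  qed
  \<comment> \<open>Besides being a ladder, \<open>f\<close> must have its values in an internally
    finite set, because \<open>local_diff\<close> concerns pairs from such a set.\<close>
  define Q where "Q k f \<longleftrightarrow> (\<forall>n x y. W (opair W n x) f \<and> W (opair W n y) f \<longrightarrow> x = y) \<and>
    (\<exists>F. believes_finite W F \<and> ext W F \<subseteq> ext W (I i) \<and> (\<forall>n x. W (opair W n x) f \<longrightarrow> x \<in> ext W F)) \<and>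
    (\<forall>m\<in>ext W (omega W). \<exists>b\<in>ext W B. \<forall>l x. W (opair W l x) f \<longrightarrow> (R i b x \<longleftrightarrow> W l m)) \<and>
    (\<exists>x. W (opair W (num W k) x) f)" for k :: nat and f
  have "\<exists>f. \<forall>k. Q k f"
  proof (rule saturation)
    show "WW.Def (\<lambda>e. Q i (e 0)) (\<lambda>e. Q i (e 0))" for i
      unfolding Q_def by (intro WW.def_intros FDef_param)
    fix m :: nat
    obtain c where c: "\<And>l. l < m \<Longrightarrow> c l \<in> ext W (I i)"
      "\<And>k. k \<le> m \<Longrightarrow> \<exists>b\<in>ext W B. \<forall>l<m. R i b (c l) \<longleftrightarrow> l < k"
      using lad[of m] unfolding ladder_def by blast
    let ?F = "(\<lambda>k. opair W (num W k) (c k)) ` {..<m}"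
    have "in_model W ?F" by (rule W.in_model_finite) simp
    then obtain f where f: "ext W f = ?F" by (auto simp: in_model_def)
    then have fm: "W p f \<longleftrightarrow> p \<in> ?F" for p by (metis in_ext)
    have 1: "\<exists>F. believes_finite W F \<and> ext W F \<subseteq> ext W (I i) \<and> (\<forall>n x. W (opair W n x) f \<longrightarrow> x \<in> ext W F)"
    proof -
      obtain F where "ext W F = c ` {..<m}" "believes_finite W F" using bf_finite_set[of "c ` {..<m}"] by auto
      then show ?thesis using c(1) by (intro exI[of _ F]) (auto simp: fm)
    qed
    have 2: "\<exists>b\<in>ext W B. \<forall>l x. W (opair W l x) f \<longrightarrow> (R i b x \<longleftrightarrow> W l M)" if M: "W M (omega W)" for M
    proof -
      \<comment> \<open>On a ladder of standard length \<open>m\<close> a nonstandard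
        \<open>M\<close> cuts above all rungs, as does a standard one beyond
        \<open>m\<close>.\<close>
      have "\<exists>k\<le>m. \<forall>l<m. W (num W l) M \<longleftrightarrow> l < k"
      proof (cases "M \<in> NS")
        case True
        then show ?thesis using num_less_NS by blast
      next
        case False
        then obtain k where k: "M = num W k" using M by (auto simp: NS_def)
        have "W (num W l) M \<longleftrightarrow> l < k" for l using W.ext_num[of k] k by (auto simp: ext_def set_eq_iff)
        then show ?thesis by (intro exI[of _ "min k m"]) auto
      qed
      then obtain k where k: "k \<le> m" "\<And>l. l < m \<Longrightarrow> W (num W l) M \<longleftrightarrow> l < k" by blast
      obtain b where "b \<in> ext W B" "\<forall>l<m. R i b (c l) \<longleftrightarrow> l < k" using c(2)[OF k(1)] by blast
      then show ?thesis using k(2) by (intro bexI[of _ b]) (auto simp: fm)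
    qed
    show "\<exists>f. \<forall>i<m. Q i f"
      unfolding Q_def by (rule exI[of _ f]) (use 1 2 in \<open>auto simp: in_ext fm\<close>)
  qed
  then obtain f where Qf: "\<And>k. Q k f" by blast
  have f: "W (opair W n x) f \<Longrightarrow> W (opair W n y) f \<Longrightarrow> x = y" for n x y
    using Qf[of 0, unfolded Q_def, THEN conjunct1] by blast
  have f2: "\<exists>F. believes_finite W F \<and> ext W F \<subseteq> ext W (I i) \<and> (\<forall>n x. W (opair W n x) f \<longrightarrow> x \<in> ext W F)"
    using Qf[of 0, unfolded Q_def, THEN conjunct2, THEN conjunct1] .
  have f3: "\<exists>b\<in>ext W B. \<forall>l x. W (opair W l x) f \<longrightarrow> (R i b x \<longleftrightarrow> W l m)" if "W m (omega W)" for m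
    using Qf[of 0, unfolded Q_def, THEN conjunct2, THEN conjunct2, THEN conjunct1, rule_format, of m] that
    by (simp add: in_ext)
  have f4: "\<exists>x. W (opair W (num W k) x) f" for k
    using Qf[of k, unfolded Q_def, THEN conjunct2, THEN conjunct2, THEN conjunct2] .
  obtain F where F: "believes_finite W F" "ext W F \<subseteq> ext W (I i)" "\<And>n x. W (opair W n x) f \<Longrightarrow> x \<in> ext W F"
    using f2 by blast
  have "\<exists>N\<in>NS. \<forall>m. W m N \<longrightarrow> (\<exists>x. W (opair W m x) f)"
    by (rule overspill[OF _ _ NS_ne]) (intro WW.def_intros FDef_param, rule f4)
  then obtain M where M: "M \<in> NS" "\<And>m. W m M \<Longrightarrow> \<exists>x. W (opair W m x) f" by blast
  define g where "g l = (SOME x. W (opair W l x) f)" for l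
  have g: "W (opair W m (g m)) f" if "W m M" for m unfolding g_def using someI_ex[OF M(2)[OF that]] .
  have gnum: "W (opair W (num W k) (g (num W k))) f" for k using g num_less_NS[OF M(1)] by blast
  define N' where "N' = {y \<in> N0. W y M}"
  define h where "h = (\<lambda>(k, y). (g (num W k), g y))"
  have "\<exists>b\<in>ext W B. \<forall>(u, v)\<in>h ` (UNIV \<times> N'). R i b u \<and> \<not> R i b v"
  proof (rule local_diff[OF F(1,2)])
    show "h ` (UNIV \<times> N') \<subseteq> ext W F \<times> ext W F"
      using gnum g F(3) by (auto simp: h_def N'_def)
    have "|\<Union>k. (\<lambda>y. (g (num W k), g y)) ` N'| \<le>o |lam|"
    proof (rule card_UN)
      have "|N'| \<le>o |N0|" by (rule card_of_mono1) (auto simp: N'_def)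
      then show "|(\<lambda>y. (g (num W k), g y)) ` N'| \<le>o |lam|" for k :: nat
        using ordLeq_transitive[OF card_of_image ordLeq_transitive[OF _ Y0(2)]] by blast
    qed
    moreover have "(\<Union>k. (\<lambda>y. (g (num W k), g y)) ` N') = h ` (UNIV \<times> N')" by (auto simp: h_def)
    ultimately show "|h ` (UNIV \<times> N')| \<le>o |lam|" by simp
    fix s assume s: "s \<subseteq> h ` (UNIV \<times> N')" "finite s"
    from finite_subset_image[OF s(2,1)] obtain P where P: "P \<subseteq> UNIV \<times> N'" "finite P" "s = h ` P" by blast
    obtain K where K: "\<forall>k\<in>fst ` P. k < K" using P(2) finite_nat_set_iff_bounded[of "fst ` P"] by blast
    \<comment> \<open>Finitely many pairs mention only standard rungs below some \<open>K\<close>;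
      the element cutting at \<open>K\<close> satisfies these and no rung of nonstandard
      index.\<close>
    obtain b where b: "b \<in> ext W B" "\<forall>l x. W (opair W l x) f \<longrightarrow> (R i b x \<longleftrightarrow> W l (num W K))"
      using f3[OF W.num_in_omega] by blast
    have "R i b (g (num W k)) \<and> \<not> R i b (g y)" if "(k, y) \<in> P" for k y
    proof -
      have "k < K" "y \<in> NS" "W y M" using K P(1) that Y0(1) by (force simp: N'_def)+
      then have "W (num W k) (num W K)" "\<not> W y (num W K)"
        using W.ext_num[of K] by (auto simp: NS_def ext_def set_eq_iff)
      then show ?thesis using b(2) gnum g[OF \<open>W y M\<close>] by blast
    qed
    then show "\<exists>b\<in>ext W B. \<forall>(u, v)\<in>s. R i b u \<and> \<not> R i b v"
      using b(1) unfolding P(3) h_def by (intro bexI[of _ b]) auto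
  qed
  then obtain b where b: "b \<in> ext W B" "\<And>k y. y \<in> N' \<Longrightarrow> R i b (g (num W k)) \<and> \<not> R i b (g y)"
    by (auto simp: h_def)
  obtain y0 where "y0 \<in> N'" using coinit[OF M(1)] by (auto simp: N'_def)
  then have "\<exists>x. W (opair W (num W k) x) f \<and> R i b x" for k using b(2) gnum by blast
  then have "\<exists>N\<in>NS. \<forall>m. W m N \<longrightarrow> (\<exists>x. W (opair W m x) f \<and> R i b x)"
    by (intro overspill[OF _ _ NS_ne] WW.def_intros FDef_param)
  then obtain N1 where N1: "N1 \<in> NS" "\<And>m. W m N1 \<Longrightarrow> \<exists>x. W (opair W m x) f \<and> R i b x" by blast
  have "\<exists>N2\<in>NS. (\<forall>m. W m N2 \<longrightarrow> W m N1 \<and> W m M)"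
    using omega_linear[of N1 M] omega_trans'[of _ N1 M] omega_trans'[of _ M N1] N1(1) M(1)
    unfolding NS_def mem_Collect_eq by blast
  then obtain N2 where N2: "N2 \<in> NS" "\<And>m. W m N2 \<Longrightarrow> W m N1 \<and> W m M" by blast
  obtain y where y: "y \<in> N0" "W y N2" using coinit[OF N2(1)] by blast
  then have "y \<in> N'" using N2(2) by (auto simp: N'_def)
  moreover obtain x where "W (opair W y x) f" "R i b x" using N1(2) N2(2) y(2) by blast
  moreover have "W (opair W y (g y)) f" using g N2(2) y(2) by blast
  ultimately show False using f b(2) by blast
qed

end

section \<open>Internality of the global type\<close>

context type_core begin

text \<open>Splitting \<open>J\<close> by the relations \<open>R i b\<close> with \<open>b\<close>
  in \<open>S\<close> leaves finitely many internal cells, and each of them lies inside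
  \<open>Z\<close> or misses it.\<close>

lemma in_model_Boolean:
  assumes "finite S" "Z \<subseteq> ext W J"
    "\<And>z z'. z \<in> ext W J \<Longrightarrow> z' \<in> ext W J \<Longrightarrow> (\<And>b. b \<in> S \<Longrightarrow> R i b z \<longleftrightarrow> R i b z') \<Longrightarrow> z \<in> Z \<longleftrightarrow> z' \<in> Z"
  shows "in_model W Z"
  using assms
proof (induct S arbitrary: Z J rule: finite_induct)
  case empty
  have "z \<in> Z \<longleftrightarrow> z' \<in> Z" if "z \<in> ext W J" "z' \<in> ext W J" for z z'
    using empty(2)[OF that] by simp
  then have "Z = {} \<or> Z = ext W J" using empty(1) by blast
  then show ?case by auto
next
  case (insert b S)
  have "in_model W {z \<in> ext W J. R i b z}" by (rule W.sep1) (intro WW.def_intros FDef_param)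
  then obtain J1 where J1: "ext W J1 = {z \<in> ext W J. R i b z}" by (auto simp: in_model_def)
  have "in_model W {z \<in> ext W J. \<not> R i b z}" by (rule W.sep1) (intro WW.def_intros FDef_param)
  then obtain J2 where J2: "ext W J2 = {z \<in> ext W J. \<not> R i b z}" by (auto simp: in_model_def)
  have "in_model W (Z \<inter> ext W J1)"
  proof (rule insert.hyps(3)[of _ J1])
    fix z z' assume *: "z \<in> ext W J1" "z' \<in> ext W J1" "\<And>b. b \<in> S \<Longrightarrow> R i b z \<longleftrightarrow> R i b z'"
    then have "z \<in> Z \<longleftrightarrow> z' \<in> Z" using insert.prems(2)[of z z'] J1 by auto
    then show "(z \<in> Z \<inter> ext W J1) \<longleftrightarrow> (z' \<in> Z \<inter> ext W J1)" using * by blast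
  qed blast
  moreover have "in_model W (Z \<inter> ext W J2)"
  proof (rule insert.hyps(3)[of _ J2])
    fix z z' assume *: "z \<in> ext W J2" "z' \<in> ext W J2" "\<And>b. b \<in> S \<Longrightarrow> R i b z \<longleftrightarrow> R i b z'"
    then have "z \<in> Z \<longleftrightarrow> z' \<in> Z" using insert.prems(2)[of z z'] J2 by auto
    then show "(z \<in> Z \<inter> ext W J2) \<longleftrightarrow> (z' \<in> Z \<inter> ext W J2)" using * by blast
  qed blast
  moreover have "Z = (Z \<inter> ext W J1) \<union> (Z \<inter> ext W J2)" using insert.prems(1) J1 J2 by auto
  ultimately show ?case using W.in_model_Un by metis
qed

text \<open>The Erdos--Makkai argument: a set that is finitely approximated by the sets \<open>R i b\<close>
  without being a Boolean combination of them yields, by Ramsey's theorem, arbitrarily long ladders.\<close>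

lemma internal_D:
  assumes lad: "\<not> ladder i K"
  shows "in_model W (D i)"
proof (rule ccontr)
  assume nint: "\<not> in_model W (D i)"
  have DI: "D i \<subseteq> ext W (I i)" by (auto simp: D_def)
  \<comment> \<open>If some finite \<open>S\<close> told apart every point of \<open>D i\<close>
    from every point outside, then \<open>D i\<close> would be a union of its cells and hence
    internal.\<close>
  have "\<exists>p. finite S \<longrightarrow> fst p \<in> D i \<and> snd p \<in> ext W (I i) - D i \<and> (\<forall>b\<in>S. R i b (fst p) \<longleftrightarrow> R i b (snd p))" for S
  proof (rule ccontr)
    assume n: "\<not> ?thesis"
    then have fin: "finite S" by blast
    have *: "z' \<in> D i" if "z \<in> D i" "z' \<in> ext W (I i)" "\<And>b. b \<in> S \<Longrightarrow> R i b z \<longleftrightarrow> R i b z'" for z z'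
      using n that by (metis DiffI fst_conv snd_conv)
    have "in_model W (D i)"
      by (rule in_model_Boolean[OF fin DI]) (use * in blast)
    then show False using nint by blast
  qed
  then have "\<forall>S. \<exists>p. finite S \<longrightarrow> fst p \<in> D i \<and> snd p \<in> ext W (I i) - D i \<and> (\<forall>b\<in>S. R i b (fst p) \<longleftrightarrow> R i b (snd p))"
    by blast
  from choice[OF this] obtain fa where fa: "\<forall>S. finite S \<longrightarrow> fst (fa S) \<in> D i \<and> snd (fa S) \<in> ext W (I i) - D i \<and>
    (\<forall>b\<in>S. R i b (fst (fa S)) \<longleftrightarrow> R i b (snd (fa S)))" ..
  note fa = fa[rule_format]
  have "\<forall>T. \<exists>b. finite T \<and> T \<subseteq> ext W (I i) \<longrightarrow> b \<in> ext W B \<and> (\<forall>z\<in>T. R i b z \<longleftrightarrow> z \<in> D i)"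
    using pick_D by blast
  from choice[OF this] obtain fb where "\<forall>T. finite T \<and> T \<subseteq> ext W (I i) \<longrightarrow>
    fb T \<in> ext W B \<and> (\<forall>z\<in>T. R i (fb T) z \<longleftrightarrow> z \<in> D i)" ..
  then have fb: "finite T \<Longrightarrow> T \<subseteq> ext W (I i) \<Longrightarrow>
    fb T \<in> ext W B \<and> (\<forall>z\<in>T. R i (fb T) z \<longleftrightarrow> z \<in> D i)" for T by simp
  \<comment> \<open>The state holds the elements \<open>b\<close> and the parameters chosen so far.
    Each round adds a pair \<open>a\<close>, \<open>a'\<close> on opposite sides of
    \<open>D i\<close> that no earlier \<open>b\<close> separates, and then a new \<open>b\<close>
    that agrees with \<open>D i\<close> on all parameters, the new pair included.\<close>
  define T' where "T' = (\<lambda>(S, T). insert (fst (fa S)) (insert (snd (fa S)) T))"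
  define st where "st = rec_nat ({}, {}) (\<lambda>_ p. (insert (fb (T' p)) (fst p), T' p))"
  have st_Suc: "st (Suc n) = (insert (fb (T' (st n))) (fst (st n)), T' (st n))" for n by (simp add: st_def)
  define a where "a n = fst (fa (fst (st n)))" for n
  define a' where "a' n = snd (fa (fst (st n)))" for n
  define b where "b n = fb (T' (st n))" for n
  have T'st: "T' (st n) = insert (a n) (insert (a' n) (snd (st n)))" for n
    by (simp add: T'_def a_def a'_def split_beta)
  have fin: "finite (fst (st n)) \<and> finite (snd (st n)) \<and> snd (st n) \<subseteq> ext W (I i)" for n
  proof (induct n)
    case (Suc n)
    have "a n \<in> D i" "a' n \<in> ext W (I i)" using fa[of "fst (st n)"] Suc by (auto simp: a_def a'_def)
    then show ?case using Suc DI by (auto simp: st_Suc T'st)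
  qed (simp add: st_def)
  have aD: "a n \<in> D i" "a' n \<in> ext W (I i) - D i" "c \<in> fst (st n) \<Longrightarrow> R i c (a n) \<longleftrightarrow> R i c (a' n)" for n c
    using fa[of "fst (st n)"] fin[of n] by (auto simp: a_def a'_def)
  have bst: "m < n \<Longrightarrow> b m \<in> fst (st n)" for m n
    by (induct n) (auto simp: st_Suc b_def less_Suc_eq)
  have "m < n \<Longrightarrow> a m \<in> snd (st n) \<and> a' m \<in> snd (st n)" for m n
    by (induct n) (auto simp: T'st st_Suc less_Suc_eq)
  then have ast: "m \<le> n \<Longrightarrow> a m \<in> T' (st n) \<and> a' m \<in> T' (st n)" for m n
    by (cases "m = n") (auto simp: T'st)
  have T'fin: "finite (T' (st n)) \<and> T' (st n) \<subseteq> ext W (I i)" for n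
    using fin[of "Suc n"] by (simp add: st_Suc)
  have bB: "b n \<in> ext W B" for n using fb[of "T' (st n)"] T'fin by (auto simp: b_def)
  have le: "n \<le> m \<Longrightarrow> R i (b m) (a n) \<and> \<not> R i (b m) (a' n)" for m n
    using fb[of "T' (st m)"] T'fin[of m] ast[of n m] aD(1,2)[of n] by (auto simp: b_def)
  have lt: "m < n \<Longrightarrow> R i (b m) (a n) \<longleftrightarrow> R i (b m) (a' n)" for m n
    using aD(3)[OF bst] .
  \<comment> \<open>For \<open>n \<le> m\<close> the truth values of \<open>R i (b m)\<close> at
    \<open>a n\<close> and \<open>a' n\<close> are known; for \<open>m < n\<close> they only agree
    with each other. Ramsey's theorem makes this common value constant.\<close>
  define f where "f s = (if R i (b (Min s)) (a (Max s)) then 1 else 0 :: nat)" for s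
  have "\<exists>Z t. Z \<subseteq> (UNIV :: nat set) \<and> infinite Z \<and> t < 2 \<and> (\<forall>x\<in>Z. \<forall>y\<in>Z. x \<noteq> y \<longrightarrow> f {x, y} = t)"
    by (rule Ramsey2) (auto simp: f_def)
  then obtain Z t where Z: "infinite Z" "t < 2" "\<And>x y. x \<in> Z \<Longrightarrow> y \<in> Z \<Longrightarrow> x \<noteq> y \<Longrightarrow> f {x, y} = t" by blast
  define e where "e = enumerate Z"
  have e: "strict_mono e" "\<And>n. e n \<in> Z" using strict_mono_enumerate[OF Z(1)] enumerate_in_set[OF Z(1)] by (auto simp: e_def)
  have elt: "e m < e n \<longleftrightarrow> m < n" "e m \<le> e n \<longleftrightarrow> m \<le> n" for m n
    using e(1) by (auto simp: strict_mono_less strict_mono_less_eq)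
  have hom: "R i (b (e m)) (a (e n)) \<longleftrightarrow> t = 1" if "m < n" for m n
  proof -
    have "e m < e n" using that elt by simp
    then show ?thesis using Z(3)[OF e(2)[of m] e(2)[of n]] by (auto simp: f_def min_def max_def split: if_splits)
  qed
  have "ladder i K"
  proof (cases "t = 1")
    case True
    \<comment> \<open>With constant value true, \<open>R i (b m) (a' n)\<close> holds exactly when
      \<open>m < n\<close>. The order is the wrong way round, hence the reversal
      \<open>K - l\<close>.\<close>
    show ?thesis unfolding ladder_def
    proof (intro exI conjI allI impI)
      show "a' (e (K - l)) \<in> ext W (I i)" for l using aD by blast
      fix m assume m: "m \<le> K"
      have "R i (b (e (K - m))) (a' (e (K - l))) \<longleftrightarrow> l < m" if "l < K" for l
      proof (cases "l < m")
        case True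
        then have "K - m < K - l" using m that by simp
        then show ?thesis using hom[of "K - m" "K - l"] lt[of "e (K - m)" "e (K - l)"] elt \<open>t = 1\<close> True by simp
      next
        case False
        then have "K - l \<le> K - m" by simp
        then show ?thesis using le[of "e (K - l)" "e (K - m)"] elt False by simp
      qed
      then show "\<exists>b\<in>ext W B. \<forall>l<K. R i b (a' (e (K - l))) \<longleftrightarrow> l < m" using bB by blast
    qed
  next
    case False
    \<comment> \<open>With constant value false, \<open>R i (b m) (a n)\<close> holds exactly when
      \<open>n \<le> m\<close>; the shift by \<open>Suc\<close> turns this into the strict
      inequality and leaves a \<open>b\<close> for the empty segment.\<close>
    show ?thesis unfolding ladder_def
    proof (intro exI conjI allI impI)
      show "a (e (Suc l)) \<in> ext W (I i)" for l using aD DI by blast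
      fix m assume m: "m \<le> K"
      have "R i (b (e m)) (a (e (Suc l))) \<longleftrightarrow> l < m" for l
      proof (cases "l < m")
        case True
        then show ?thesis using le[of "e (Suc l)" "e m"] elt by simp
      next
        case F: False
        then show ?thesis using hom[of m "Suc l"] False by simp
      qed
      then show "\<exists>b\<in>ext W B. \<forall>l<K. R i b (a (e (Suc l))) \<longleftrightarrow> l < m" using bB by blast
    qed
  qed
  then show False using lad by blast
qed

end

section \<open>Realization in the absence of long ladders\<close>

context type_core begin

text \<open>If infinite internally finite sets are large, build an approximate Morley sequence of the
  ultrafilter \<open>U\<close>: each element of \<open>D i\<close> fails on boundedly many members of the sequence.\<close>

lemma realize_stable_large:
  assumes lad: "\<And>i. \<not> ladder i (K i)"
    and big: "\<And>E. believes_finite W E \<Longrightarrow> infinite (ext W E) \<Longrightarrow> \<not> |ext W E| \<le>o |lam|"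
  shows "\<exists>b\<in>ext W B. \<forall>i. \<forall>z\<in>X i. R i b z"
proof (cases "\<exists>c\<in>ext W B. \<forall>S\<in>U. c \<in> S")
  case True
  then obtain c where c: "c \<in> ext W B" "\<And>S. S \<in> U \<Longrightarrow> c \<in> S" by blast
  have "R i c z" if "z \<in> X i" for i z using c(2)[OF XU[OF that]] by simp
  then show ?thesis using c(1) by blast
next
  case False
  \<comment> \<open>No point lies in all members of \<open>U\<close>, so any given element can be
    avoided within \<open>U\<close>; this keeps the sequence below injective.\<close>
  then have "\<forall>c. \<exists>S. c \<in> ext W B \<longrightarrow> S \<in> U \<and> c \<notin> S" by blast
  from choice[OF this] obtain avoid where avoid: "\<forall>c. c \<in> ext W B \<longrightarrow> avoid c \<in> U \<and> c \<notin> avoid c" ..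
  have "\<forall>i. \<exists>d. ext W d = D i" using internal_D[OF lad] by (simp add: in_model_def)
  from choice[OF this] obtain d where "\<forall>i. ext W (d i) = D i" ..
  then have d: "ext W (d i) = D i" for i by simp
  \<comment> \<open>The counterexample depends on \<open>S\<close> alone. For a finite set there are
    then only finitely many counterexamples to subsets, all of which the next member of the sequence
    can be made to satisfy.\<close>
  define al where "al i S = (SOME a. a \<in> D i \<and> (\<forall>b\<in>S. \<not> R i b a))" for i S
  have al: "al i S \<in> D i \<and> (\<forall>b\<in>S. \<not> R i b (al i S))" if "a \<in> D i" "\<forall>b\<in>S. \<not> R i b a" for i S a
    unfolding al_def by (rule someI[of _ a]) (use that in blast)
  have step: "\<exists>e. finite S \<and> S \<subseteq> ext W B \<longrightarrow> e \<in> ext W B \<and> e \<notin> S \<and>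
    (\<forall>i\<le>n. \<forall>S'\<subseteq>S. al i S' \<in> D i \<longrightarrow> R i e (al i S'))" for n S
  proof (cases "finite S \<and> S \<subseteq> ext W B")
    case True
    let ?G = "\<lambda>(i, S'). {b \<in> ext W B. R i b (al i S')}"
    let ?H = "avoid ` S \<union> ?G ` {(i, S'). i \<in> {..n} \<and> S' \<in> Pow S \<and> al i S' \<in> D i}"
    have "finite ({..n} \<times> Pow S)" using True by simp
    then have "finite {(i, S'). i \<in> {..n} \<and> S' \<in> Pow S \<and> al i S' \<in> D i}" by (rule rev_finite_subset) auto
    then have "finite ?H" using True by simp
    moreover have "?H \<subseteq> U" using avoid True by (auto simp: D_def)
    ultimately have "\<exists>e\<in>ext W B. \<forall>S\<in>?H. e \<in> S" by (rule pick)
    then obtain e where e: "e \<in> ext W B" "\<forall>S\<in>?H. e \<in> S" by blast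
    have "R i e (al i S')" if "i \<le> n" "S' \<subseteq> S" "al i S' \<in> D i" for i S'
    proof -
      have "?G (i, S') \<in> ?H" using that by (intro UnI2 imageI) simp
      from bspec[OF e(2) this] show ?thesis by simp
    qed
    moreover have "e \<notin> S" using e avoid True by blast
    ultimately show ?thesis using e(1) by blast
  qed blast
  then have "\<forall>n. \<forall>S. \<exists>e. finite S \<and> S \<subseteq> ext W B \<longrightarrow> e \<in> ext W B \<and> e \<notin> S \<and>
    (\<forall>i\<le>n. \<forall>S'\<subseteq>S. al i S' \<in> D i \<longrightarrow> R i e (al i S'))" by blast
  then have "\<forall>n. \<exists>g. \<forall>S. finite S \<and> S \<subseteq> ext W B \<longrightarrow> g S \<in> ext W B \<and> g S \<notin> S \<and>
    (\<forall>i\<le>n. \<forall>S'\<subseteq>S. al i S' \<in> D i \<longrightarrow> R i (g S) (al i S'))" by (intro allI choice) simp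
  from choice[OF this] obtain g where "\<forall>n S. finite S \<and> S \<subseteq> ext W B \<longrightarrow> g n S \<in> ext W B \<and> g n S \<notin> S \<and>
    (\<forall>i\<le>n. \<forall>S'\<subseteq>S. al i S' \<in> D i \<longrightarrow> R i (g n S) (al i S'))" ..
  then have g: "finite S \<Longrightarrow> S \<subseteq> ext W B \<Longrightarrow> g n S \<in> ext W B \<and> g n S \<notin> S \<and>
    (\<forall>i\<le>n. \<forall>S'\<subseteq>S. al i S' \<in> D i \<longrightarrow> R i (g n S) (al i S'))" for n S by simp
  define E where "E = rec_nat {} (\<lambda>n S. insert (g n S) S)"
  have E_Suc: "E (Suc n) = insert (g n (E n)) (E n)" for n by (simp add: E_def)
  have E0: "E 0 = {}" by (simp add: E_def)
  define e where "e n = g n (E n)" for n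
  have Efin: "finite (E n) \<and> E n \<subseteq> ext W B" for n
    by (induct n) (use g in \<open>auto simp: E0 E_Suc\<close>)
  have e: "e n \<in> ext W B" "e n \<notin> E n" "i \<le> n \<Longrightarrow> S' \<subseteq> E n \<Longrightarrow> al i S' \<in> D i \<Longrightarrow> R i (e n) (al i S')" for i n S'
    using g[of "E n" n] Efin[of n] by (auto simp: e_def)
  have E: "E n = e ` {..<n}" for n
    by (induct n) (auto simp: E0 E_Suc e_def lessThan_Suc)
  have e_ne: "e m \<noteq> e n" if "m < n" for m n using e(2)[of n] that unfolding E by (metis imageI lessThan_iff)
  then have inj: "inj e" by (metis injI linorder_neqE_nat)
  have cardE: "card (E n) = n" for n using inj by (simp add: E card_image inj_on_subset)
  \<comment> \<open>The first \<open>i\<close> members were chosen without regard to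
    \<open>R i\<close> and are discarded, which leaves \<open>K i\<close> failures. The
    counterexample \<open>c l\<close> to the first \<open>l + 1\<close> of them is satisfied by
    every later one, so these failures form a ladder.\<close>
  have few: "\<not> at_least (i + K i) {b \<in> E n. \<not> R i b a}" if a: "a \<in> D i" for i n a
  proof
    assume "at_least (i + K i) {b \<in> E n. \<not> R i b a}"
    then obtain s where s: "s \<subseteq> {b \<in> E n. \<not> R i b a}" "finite s" "card s = i + K i" by (auto simp: at_least_def)
    define M where "M = {m. e m \<in> s} - {..<i}"
    have sM: "s = e ` {m. e m \<in> s}" using s(1) by (auto simp: E)
    have "{m. e m \<in> s} \<subseteq> {..<n}" using s(1) inj by (auto simp: E inj_def)
    then have finM: "finite {m. e m \<in> s}" by (rule finite_subset) simp
    have "card {m. e m \<in> s} = i + K i" using s(3) sM inj by (metis card_image inj_on_subset subset_UNIV)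
    then have cM: "card M \<ge> K i" unfolding M_def using diff_card_le_card_Diff[of "{..<i}" "{m. e m \<in> s}"] by simp
    have fM: "finite M" using finM by (simp add: M_def)
    define h where "h = (!) (sorted_list_of_set M)"
    have len: "length (sorted_list_of_set M) = card M" by simp
    have hM: "h q \<in> M" if "q < K i" for q
      using that cM nth_mem[of q "sorted_list_of_set M"] fM len by (simp add: h_def)
    have hlt: "h q < h r" if "q < r" "r < K i" for q r
      using that cM len strict_sorted_list_of_set[of M] by (simp add: h_def sorted_wrt_nth_less)
    have bad: "\<not> R i (e (h q)) a" if "q < K i" for q using hM[OF that] s(1) by (auto simp: M_def)
    define c where "c l = al i (e ` h ` {..l})" for l
    have c: "c l \<in> D i" "\<And>q. q \<le> l \<Longrightarrow> \<not> R i (e (h q)) (c l)" if "l < K i" for l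
    proof -
      have "\<forall>b\<in>e ` h ` {..l}. \<not> R i b a" using bad that by auto
      from al[OF a this] show "c l \<in> D i" "\<And>q. q \<le> l \<Longrightarrow> \<not> R i (e (h q)) (c l)" by (auto simp: c_def)
    qed
    have c2: "R i (e (h q)) (c l)" if "l < q" "q < K i" for l q
      unfolding c_def
    proof (rule e(3))
      show "i \<le> h q" using hM[OF that(2)] by (auto simp: M_def)
      have "h r < h q" if "r \<le> l" for r using hlt[of r q] that \<open>l < q\<close> \<open>q < K i\<close> by simp
      then show "e ` h ` {..l} \<subseteq> E (h q)" by (auto simp: E)
      show "al i (e ` h ` {..l}) \<in> D i" using c(1)[of l] that by (simp add: c_def)
    qed
    have "ladder i (K i)" unfolding ladder_def
    proof (intro exI[of _ c] conjI allI impI)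
      show "c l \<in> ext W (I i)" if "l < K i" for l using c(1)[OF that] by (simp add: D_def)
      fix m assume m: "m \<le> K i"
      show "\<exists>b\<in>ext W B. \<forall>l<K i. R i b (c l) \<longleftrightarrow> l < m"
      \<comment> \<open>The full segment has no member of the sequence behind it. All
        \<open>c l\<close> lie in \<open>D i\<close>, so a common solution exists anyway.\<close>
      proof (cases "m = K i")
        case True
        have "c ` {..<K i} \<subseteq> D i" using c(1) by auto
        then have "real i (c ` {..<K i})" by (intro real_finite) auto
        then show ?thesis using True by (auto simp: real_def)
      next
        case False
        then have mK: "m < K i" using m by simp
        have "R i (e (h m)) (c l) \<longleftrightarrow> l < m" if "l < K i" for l
          using c(2)[OF that, of m] c2[of l m] mK by (cases "l < m") auto
        then show ?thesis using e(1) by blast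
      qed
    qed
    then show False using lad by blast
  qed
  \<comment> \<open>This is where internality pays off: with \<open>d k\<close> in place of the
    external \<open>D k\<close>, the uniform bound on failures is a first-order condition on
    \<open>F\<close>.\<close>
  define Q where "Q k F \<longleftrightarrow> believes_finite W F \<and> ext W F \<subseteq> ext W B \<and> at_least k {x. x \<in> ext W F} \<and>
    (\<forall>a\<in>ext W (d k). \<not> at_least (k + K k) {x. x \<in> ext W F \<and> \<not> R k x a})" for k F
  have "\<exists>F. \<forall>k. Q k F"
  proof (rule saturation)
    show "WW.Def (\<lambda>e. Q i (e 0)) (\<lambda>e. Q i (e 0))" for i
      unfolding Q_def by (intro WW.def_intros FDef_param WW.Def_at_least)
    fix m :: nat
    obtain F where F: "ext W F = E m" "believes_finite W F" using bf_finite_set[of "E m"] Efin by auto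
    have "Q k F" if "k < m" for k
      unfolding Q_def F(1) d using F Efin few[of _ k m] that cardE at_least_finite[of "E m" k] by auto
    then show "\<exists>F. \<forall>i<m. Q i F" by blast
  qed
  then obtain F where Q: "\<And>k. Q k F" by blast
  have F: "believes_finite W F" "ext W F \<subseteq> ext W B" "\<And>k. at_least k (ext W F)"
    using Q unfolding Q_def by auto
  have fewF: "\<not> at_least (k + K k) {x \<in> ext W F. \<not> R k x a}" if "a \<in> D k" for k a
    using Q[of k] that by (auto simp: Q_def d)
  have large: "\<not> |ext W F| \<le>o |lam|" by (rule big[OF F(1) infinite_if_at_least[OF F(3)]])
  have "|\<Union>i. \<Union>z\<in>X i. {x \<in> ext W F. \<not> R i x z}| \<le>o |lam|"
  proof (rule card_UN, rule card_of_UNION_ordLeq_infinite[OF lam X_card], rule ballI)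
    fix i z assume "z \<in> X i"
    then have "\<not> at_least (i + K i) {x \<in> ext W F. \<not> R i x z}" using fewF XD by blast
    then have "finite {x \<in> ext W F. \<not> R i x z}" using at_least_infinite by blast
    then show "|{x \<in> ext W F. \<not> R i x z}| \<le>o |lam|" using lam by (rule finite_ordLeq_infinite)
  qed
  then have "\<not> ext W F \<subseteq> (\<Union>i. \<Union>z\<in>X i. {x \<in> ext W F. \<not> R i x z})"
    using large card_of_mono1 ordLeq_transitive by blast
  then show ?thesis using F(2) by blast
qed

text \<open>If some infinite internally finite set is small, a minimal internal set of instances that is
  not realized would have to be small as well, so that internal sets are realized once their
  finite subsets are.\<close>

lemma realize_stable_small:
  assumes lad: "\<And>i. \<not> ladder i (K i)"
    and Z: "infinite (ext W Z)" "|ext W Z| \<le>o |lam|"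
  shows "\<exists>b\<in>ext W B. \<forall>i. \<forall>z\<in>X i. R i b z"
proof -
  have "\<forall>i. \<exists>s. ext W s = D i \<inter> ext W (Y i)"
  proof
    fix i
    obtain d where "ext W d = D i" using internal_D[OF lad] unfolding in_model_def by blast
    moreover have "in_model W {z \<in> ext W (Y i). z \<in> ext W d}" by (rule W.sep1) (intro WW.def_intros FDef_param)
    moreover have "{z \<in> ext W (Y i). z \<in> ext W d} = ext W d \<inter> ext W (Y i)" by blast
    ultimately show "\<exists>s. ext W s = D i \<inter> ext W (Y i)" by (simp add: in_model_def)
  qed
  from choice[OF this] obtain s where "\<forall>i. ext W (s i) = D i \<inter> ext W (Y i)" ..
  then have s: "ext W (s i) = D i \<inter> ext W (Y i)" for i by simp
  have real_s: "real i (ext W (s i))" for i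
  proof (rule ccontr)
    assume n: "\<not> ?thesis"
    have "believes_finite W (s i)" by (rule bf_subset[OF Y_bf]) (auto simp: s)
    moreover have "ext W (s i) \<subseteq> ext W (I i)" using YI by (auto simp: s)
    ultimately obtain G where G: "ext W G \<subseteq> ext W (s i)" "minimal i G" using ex_minimal n by blast
    have "infinite (ext W G)"
    proof
      assume "finite (ext W G)"
      then have "real i (ext W G)" using G(1) s real_finite by blast
      then show False using G(2) by (simp add: minimal_def)
    qed
    then have min: "\<exists>G. minimal i G \<and> at_least n (ext W G) \<and> finite (ext W G)" for n
      using reflect_minimal[OF G(2) at_least_infinite] by blast
    \<comment> \<open>Finite minimal sets of every size inject into the infinite \<open>Z\<close>.
      Saturation produces an infinite minimal set together with an internal injection into
      \<open>Z\<close>, and this injection bounds its true cardinality by that of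
      \<open>lam\<close>.\<close>
    define Q where "Q k F \<longleftrightarrow> minimal i F \<and> at_least k {x. x \<in> ext W F} \<and>
      (\<exists>f. (\<forall>x\<in>ext W F. \<exists>y\<in>ext W Z. W (opair W x y) f) \<and>
        (\<forall>x\<in>ext W F. \<forall>x'\<in>ext W F. \<forall>y. W (opair W x y) f \<and> W (opair W x' y) f \<longrightarrow> x = x'))" for k F
    have "\<exists>F. \<forall>k. Q k F"
    proof (rule saturation)
      show "WW.Def (\<lambda>e. Q i (e 0)) (\<lambda>e. Q i (e 0))" for i
        unfolding Q_def minimal_def real_def by (intro WW.def_intros FDef_param WW.Def_at_least)
      fix m :: nat
      obtain F where F: "minimal i F" "at_least m (ext W F)" "finite (ext W F)" using min by blast
      obtain T where T: "T \<subseteq> ext W Z" "finite T" "card T = card (ext W F)"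
        using infinite_arbitrarily_large[OF Z(1)] by blast
      then obtain h where h: "bij_betw h (ext W F) T" using finite_same_card_bij[OF F(3) T(2)] by auto
      have "in_model W ((\<lambda>x. opair W x (h x)) ` ext W F)" using F(3) by (intro W.in_model_finite) auto
      then obtain f where "ext W f = (\<lambda>x. opair W x (h x)) ` ext W F" by (auto simp: in_model_def)
      then have fm: "W p f \<longleftrightarrow> (\<exists>x\<in>ext W F. p = opair W x (h x))" for p by (metis in_ext image_iff)
      have inj: "(\<exists>f. (\<forall>x\<in>ext W F. \<exists>y\<in>ext W Z. W (opair W x y) f) \<and>
        (\<forall>x\<in>ext W F. \<forall>x'\<in>ext W F. \<forall>y. W (opair W x y) f \<and> W (opair W x' y) f \<longrightarrow> x = x'))"
        by (rule exI[of _ f]) (use h T(1) in \<open>auto simp: fm bij_betw_def inj_on_def\<close>)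
      have "at_least k (ext W F)" if "k < m" for k
        using F(2,3) that at_least_finite[OF F(3)] by simp
      then show "\<exists>F. \<forall>i<m. Q i F" using F(1) inj by (intro exI[of _ F]) (simp add: Q_def)
    qed
    then obtain F where Q: "\<And>k. Q k F" by blast
    have F: "minimal i F" "\<And>k. at_least k (ext W F)" using Q by (simp_all add: Q_def)
    have inf: "infinite (ext W F)" by (rule infinite_if_at_least[OF F(2)])
    obtain f where f: "\<forall>x\<in>ext W F. \<exists>y. y \<in> ext W Z \<and> W (opair W x y) f"
      "\<forall>x\<in>ext W F. \<forall>x'\<in>ext W F. \<forall>y. W (opair W x y) f \<and> W (opair W x' y) f \<longrightarrow> x = x'"
      using Q[of 0] unfolding Q_def by blast
    from bchoice[OF f(1)] obtain h where h: "\<forall>x\<in>ext W F. h x \<in> ext W Z \<and> W (opair W x (h x)) f" ..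
    have "inj_on h (ext W F)" using h f(2) by (metis inj_onI)
    moreover have "h ` ext W F \<subseteq> ext W Z" using h by blast
    ultimately have "|ext W F| \<le>o |ext W Z|" using card_of_ordLeq by blast
    then have small: "|ext W F| \<le>o |lam|" using Z(2) ordLeq_transitive by blast
    have "real i (ext W F)"
    proof (rule local)
      show "pseudofinite W (ext W F)" using F(1) by (auto simp: pseudofinite_def minimal_def)
      show "ext W F \<subseteq> ext W (I i)" using F(1) by (simp add: minimal_def)
      show "|ext W F| \<le>o |lam|" by (rule small)
      \<comment> \<open>A finite subset of the infinite \<open>F\<close> is proper, hence realized
        by minimality.\<close>
      fix t assume t: "t \<subseteq> ext W F" "finite t"
      then obtain G where G: "ext W G = t" using W.in_model_finite by (auto simp: in_model_def)
      then have "G \<noteq> F" using t inf by blast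
      then show "real i t" using F(1) G t by (auto simp: minimal_def)
    qed
    then show False using F(1) by (simp add: minimal_def)
  qed
  \<comment> \<open>The internal \<open>s k\<close> contains \<open>X k\<close>, so the whole type
    is implied by countably many definable conditions; \<open>D_mono\<close> reduces finitely many
    of them to a single later one.\<close>
  define Q where "Q k b \<longleftrightarrow> b \<in> ext W B \<and> (\<forall>z\<in>ext W (s k). R k b z)" for k b
  have "\<exists>b. \<forall>k. Q k b"
  proof (rule saturation)
    show "WW.Def (\<lambda>e. Q i (e 0)) (\<lambda>e. Q i (e 0))" for i
      unfolding Q_def by (intro WW.def_intros FDef_param)
    fix m :: nat
    obtain b where b: "b \<in> ext W B" "\<forall>z\<in>D m \<inter> ext W (Y m). R m b z" using real_s[of m] by (auto simp: real_def s)
    then have "Q k b" if "k < m" for k using D_mono[of k m b] that by (simp add: Q_def s)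
    then show "\<exists>b. \<forall>i<m. Q i b" by blast
  qed
  then show ?thesis using XD XY unfolding Q_def s by blast
qed

theorem realize_chain: "\<exists>b\<in>ext W B. \<forall>i. \<forall>z\<in>X i. R i b z"
proof (cases "\<forall>N. N \<subseteq> NS \<and> |N| \<le>o |lam| \<longrightarrow> (\<exists>n\<in>NS. \<forall>y\<in>N. W n y)")
  case True
  then show ?thesis by (intro realize_large_cofinality) blast
next
  case False
  then obtain N0 where "\<not> (N0 \<subseteq> NS \<and> |N0| \<le>o |lam| \<longrightarrow> (\<exists>n\<in>NS. \<forall>y\<in>N0. W n y))"
    unfolding not_all ..
  then have N0: "N0 \<subseteq> NS" "|N0| \<le>o |lam|" "\<And>n. n \<in> NS \<Longrightarrow> \<exists>y\<in>N0. \<not> W n y" by simp_all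
  have "\<forall>i. \<exists>K. \<not> ladder i K" using no_long_ladder[OF N0] by blast
  from choice[OF this] obtain K where "\<forall>i. \<not> ladder i (K i)" ..
  then have K: "\<not> ladder i (K i)" for i by simp
  show ?thesis
  proof (cases "\<exists>Z. believes_finite W Z \<and> infinite (ext W Z) \<and> |ext W Z| \<le>o |lam|")
    case True
    then show ?thesis using realize_stable_small[OF K] by blast
  next
    case False
    then show ?thesis using realize_stable_large[OF K] by blast
  qed
qed

end

section \<open>Structures coded in the models\<close>

lemma tuples_nth: "b \<in> tuples D n \<Longrightarrow> i < n \<Longrightarrow> b ! i \<in> D"
  by (auto simp: tuples_def)

text \<open>\<open>decode\<close> with \<open>app0\<close> in place of \<open>app\<close>. Values
  outside the interpretation are then definable too, so that \<open>tval\<close> and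
  \<open>sat\<close> transfer; \<open>sat_decode\<close> returns to \<open>decode\<close>.\<close>

definition dec :: "('v \<Rightarrow> 'v \<Rightarrow> bool) \<Rightarrow> 'v \<Rightarrow> 'v \<Rightarrow> 'v fo_struct" where
  "dec V D I = \<lparr>univ = ext V D,
     fn = (\<lambda>f as. app0 V (app0 V I (code_sym V (FunSym f (length as)))) (seq V as)),
     rl = (\<lambda>r as. V (seq V as) (app0 V I (code_sym V (RelSym r (length as)))))\<rparr>"

lemma univ_dec [simp]: "univ (dec V D I) = ext V D"
  by (simp add: dec_def)

context set_emb begin

lemma FDef_tval:
  assumes "\<And>i. FDef (t i) (u i)"
  shows "FDef (\<lambda>e. tval (dec V D I) (\<lambda>i. t i e) s) (\<lambda>e. tval (dec W (j D) (j I)) (\<lambda>i. u i e) s)"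
proof (induct s)
  case (Var x)
  then show ?case using assms[of x] by simp
next
  case (Fn f ts)
  show ?case unfolding tval.simps
    by (simp add: dec_def del: code_sym.simps)
      (intro FDef_app0 FDef_const FDef_code_sym FDef_seq[of ts, OF Fn[unfolded dec_def]])
qed

text \<open>For each standard formula, satisfaction in a coded structure unfolds into a formula of
  set theory by recursion outside the models.\<close>

lemma Def_sat:
  assumes "\<And>i. FDef (t i) (u i)"
  shows "Def (\<lambda>e. sat (dec V D I) (\<lambda>i. t i e) \<phi>) (\<lambda>e. sat (dec W (j D) (j I)) (\<lambda>i. u i e) \<phi>)"
  using assms
proof (induct \<phi> arbitrary: t u)
  case (Equal s s')
  then show ?case by (simp add: Def_eq FDef_tval)
next
  case (Rel r ts)
  show ?case unfolding sat.simps
    by (simp add: dec_def del: code_sym.simps)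
      (intro Def_mem FDef_app0 FDef_const FDef_code_sym FDef_seq FDef_tval[unfolded dec_def] Rel)
next
  case (Neg \<phi>)
  then show ?case by (simp add: Def_neg)
next
  case (And \<phi>1 \<phi>2)
  then show ?case by (simp add: Def_conj)
next
  case (All x \<phi>)
  let ?t = "\<lambda>i e. if i = x then e 0 else t i (\<lambda>i. e (Suc i))"
  let ?u = "\<lambda>i e. if i = x then e 0 else u i (\<lambda>i. e (Suc i))"
  have "FDef (?t i) (?u i)" for i
    by (cases "i = x") (simp_all add: FDef_var FDef_rename[OF All(2)])
  from All(1)[OF this]
  have "Def (\<lambda>e. sat (dec V D I) ((\<lambda>i. t i (\<lambda>i. e (Suc i)))(x := e 0)) \<phi>)
    (\<lambda>e. sat (dec W (j D) (j I)) ((\<lambda>i. u i (\<lambda>i. e (Suc i)))(x := e 0)) \<phi>)"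
    by (simp add: fun_upd_def)
  then show ?case unfolding sat.simps univ_dec by (intro Def_ball_ext FDef_const)
qed

lemma Def_bex_tuples:
  assumes "Def (\<lambda>e. P (map e [0..<n]) (\<lambda>i. e (i + n))) (\<lambda>e. Q (map e [0..<n]) (\<lambda>i. e (i + n)))"
  shows "Def (\<lambda>e. \<exists>b\<in>tuples (ext V D) n. P b e) (\<lambda>e. \<exists>b\<in>tuples (ext W (j D)) n. Q b e)"
  using assms
proof (induct n arbitrary: P Q)
  case (Suc n)
  have ex: "(\<exists>b\<in>tuples X (Suc n). S b) \<longleftrightarrow> (\<exists>a\<in>X. \<exists>b\<in>tuples X n. S (a # b))" for X :: "'x set" and S
    by (auto simp: tuples_Suc)
  \<comment> \<open>The induction hypothesis puts its \<open>n\<close> entries in front of the head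
    of the tuple; the renaming rotates the head back to position 0.\<close>
  let ?r = "\<lambda>i. if i = 0 then n else if i \<le> n then i - 1 else i"
  have r: "map (\<lambda>i. e (?r i)) [0..<Suc n] = e n # map e [0..<n] \<and>
    (\<lambda>i. e (?r (i + Suc n))) = (\<lambda>i. e (Suc (i + n)))" for e :: "nat \<Rightarrow> 'x"
    unfolding map_upt_Suc by auto
  have "Def (\<lambda>e. P (e n # map e [0..<n]) (\<lambda>i. e (Suc (i + n))))
     (\<lambda>e. Q (e n # map e [0..<n]) (\<lambda>i. e (Suc (i + n))))"
    using Def_rename[OF Suc(2), of ?r] unfolding r[THEN conjunct1] r[THEN conjunct2] .
  then have "Def (\<lambda>e. \<exists>b\<in>tuples (ext V D) n. P (e 0 # b) (\<lambda>i. e (Suc i)))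
    (\<lambda>e. \<exists>b\<in>tuples (ext W (j D)) n. Q (e 0 # b) (\<lambda>i. e (Suc i)))"
    by (intro Suc(1)) simp
  then show ?case unfolding ex by (intro Def_bex_ext FDef_const)
qed simp

end

definition srel :: "('v \<Rightarrow> 'v \<Rightarrow> bool) \<Rightarrow> 'v fo_struct \<Rightarrow> nat \<Rightarrow> nat \<Rightarrow> fm \<Rightarrow> 'v \<Rightarrow> 'v \<Rightarrow> bool" where
  "srel V S n k \<phi> w z \<longleftrightarrow> (\<exists>b\<in>tuples (univ S) n. \<exists>as\<in>tuples (univ S) k.
     w = seq V b \<and> z = seq V as \<and> sat S ((!) (b @ as)) \<phi>)"

lemma (in weak_set_theory) srel_seq [simp]:
  assumes "b \<in> tuples (univ S) n" "as \<in> tuples (univ S) k"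
  shows "srel V S n k \<phi> (seq V b) (seq V as) \<longleftrightarrow> sat S ((!) (b @ as)) \<phi>"
proof -
  have "b' = b" if "b' \<in> tuples (univ S) n" "seq V b = seq V b'" for b'
    using inj_on_seq[of "univ S" n] that assms by (auto simp: inj_on_def)
  moreover have "as' = as" if "as' \<in> tuples (univ S) k" "seq V as = seq V as'" for as'
    using inj_on_seq[of "univ S" k] that assms by (auto simp: inj_on_def)
  ultimately show ?thesis using assms unfolding srel_def by blast
qed

text \<open>What evaluation requires of a single symbol, as one transferable formula. Going symbol
  by symbol controls exactly the reduct of \<open>j M\<close> to the standard symbols in
  \<open>L\<close>.\<close>

definition interprets :: "('v \<Rightarrow> 'v \<Rightarrow> bool) \<Rightarrow> 'v \<Rightarrow> 'v \<Rightarrow> sym \<Rightarrow> bool" where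
  "interprets V D I s \<longleftrightarrow> (\<exists>!y. V (opair V (code_sym V s) y) I) \<and>
     (case s of RelSym r n \<Rightarrow> True | FunSym f n \<Rightarrow>
       (\<forall>z. z \<in> seq V ` tuples (ext V D) n \<longrightarrow>
         (\<exists>!y. V (opair V z y) (app0 V I (code_sym V s))) \<and>
         (\<exists>y\<in>ext V D. V (opair V z y) (app0 V I (code_sym V s)))))"

lemma (in set_emb) interprets_transfer: "interprets V D I s \<longleftrightarrow> interprets W (j D) (j I) s"
proof (cases s)
  case (FunSym f n)
  show ?thesis unfolding interprets_def FunSym sym.case
    by (rule Def_closed) (intro def_intros FDef_code_sym)
next
  case (RelSym r n)
  show ?thesis unfolding interprets_def RelSym sym.case
    by (rule Def_closed) (intro def_intros FDef_code_sym)
qed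

context weak_set_theory begin

lemma str_dom_opair [simp]: "str_dom V (opair V D I) = D"
  by (simp add: str_dom_def)

lemma str_int_opair [simp]: "str_int V (opair V D I) = I"
  by (simp add: str_int_def)

lemma univ_decode [simp]: "univ (decode V M) = ext V (str_dom V M)"
  by (simp add: decode_def)

lemma sat_decode:
  assumes int: "\<And>s. s \<in> L \<Longrightarrow> interprets V D I s"
    and "syms \<phi> \<subseteq> L" "\<And>x. x \<in> fv \<phi> \<Longrightarrow> e x \<in> ext V D"
  shows "sat (decode V (opair V D I)) e \<phi> = sat (dec V D I) e \<phi>"
proof -
  let ?S = "decode V (opair V D I)" and ?S' = "dec V D I"
  have app: "app V I (code_sym V s) = app0 V I (code_sym V s)" if "s \<in> L" for s
    using int[OF that] by (simp add: interprets_def app0_def)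
  \<comment> \<open>A function symbol is known to be well behaved on tuples from \<open>D\<close>
    only, so the induction has to carry along that values stay in \<open>D\<close>.\<close>
  have tv: "tval ?S e t = tval ?S' e t \<and> tval ?S' e t \<in> ext V D"
    if "trm_syms t \<subseteq> L" "\<And>x. x \<in> trm_fv t \<Longrightarrow> e x \<in> ext V D" for t e
    using that
  proof (induct t)
    case (Fn f ts)
    have args: "tval ?S e a = tval ?S' e a \<and> tval ?S' e a \<in> ext V D" if "a \<in> set ts" for a
      by (rule Fn(1)[OF that]) (use Fn(2,3) that in \<open>auto simp: subset_iff\<close>)
    then have 1: "map (tval ?S e) ts = map (tval ?S' e) ts" by auto
    let ?as = "map (tval ?S e) ts"
    let ?F = "app0 V I (code_sym V (FunSym f (length ts)))"
    have s: "FunSym f (length ts) \<in> L" using Fn by simp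
    have as: "seq V ?as \<in> seq V ` tuples (ext V D) (length ts)"
      using args by (intro imageI) (auto simp: tuples_def)
    have i: "\<exists>!y. V (opair V (seq V ?as) y) ?F" "\<exists>y\<in>ext V D. V (opair V (seq V ?as) y) ?F"
      using int[OF s] as by (simp_all add: interprets_def del: code_sym.simps)
    have "V (opair V (seq V ?as) (app V ?F (seq V ?as))) ?F"
      unfolding app_def by (rule theI'[OF i(1)])
    then have "app V ?F (seq V ?as) \<in> ext V D" using i by blast
    moreover have "app0 V ?F (seq V ?as) = app V ?F (seq V ?as)" using i(1) by (simp add: app0_def)
    moreover have "tval ?S e (Fn f ts) = app V ?F (seq V ?as)"
      using app[OF s] by (simp add: decode_def del: code_sym.simps)
    moreover have "tval ?S' e (Fn f ts) = app0 V ?F (seq V ?as)"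
      unfolding 1 by (simp add: dec_def del: code_sym.simps)
    ultimately show ?case by simp
  qed simp
  show ?thesis using assms(2,3)
  proof (induct \<phi> arbitrary: e)
    case (Equal s t)
    then show ?case using tv[of s e] tv[of t e] by simp
  next
    case (Rel r ts)
    have "tval ?S e a = tval ?S' e a" if "a \<in> set ts" for a
      by (rule tv[THEN conjunct1]) (use Rel that in \<open>auto simp: subset_iff\<close>)
    then have 1: "map (tval ?S e) ts = map (tval ?S' e) ts" by auto
    have s: "RelSym r (length ts) \<in> L" using Rel by simp
    show ?case using app[OF s] unfolding sat.simps 1 by (simp add: decode_def dec_def del: code_sym.simps)
  next
    case (All x \<phi>)
    have "sat ?S (e(x := a)) \<phi> = sat ?S' (e(x := a)) \<phi>" if "a \<in> ext V D" for a
      by (rule All(1)) (use All that in auto)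
    then show ?case by simp
  qed auto
qed

lemma is_structureD:
  assumes "is_structure V L M"
  shows "M = opair V (str_dom V M) (str_int V M)" "ext V (str_dom V M) \<noteq> {}"
    "s \<in> L \<Longrightarrow> interprets V (str_dom V M) (str_int V M) s"
proof -
  obtain D I where M: "M = opair V D I" "ext V D \<noteq> {}" "function_on V I (code_sym V ` L) UNIV"
    "\<And>f n. FunSym f n \<in> L \<Longrightarrow>
          function_on V (app V I (code_sym V (FunSym f n))) (seq V ` tuples (ext V D) n) (ext V D)"
    using assms unfolding is_structure_def by blast
  show "M = opair V (str_dom V M) (str_int V M)" "ext V (str_dom V M) \<noteq> {}" using M by simp_all
  assume s: "s \<in> L"
  have 1: "\<exists>!y. V (opair V (code_sym V s) y) I" using M(3) s by (auto simp: function_on_def)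
  then have 2: "app0 V I (code_sym V s) = app V I (code_sym V s)" by (simp add: app0_def)
  have "interprets V D I s"
  proof (cases s)
    case (FunSym f n)
    have f: "function_on V (app V I (code_sym V s)) (seq V ` tuples (ext V D) n) (ext V D)"
      using M(4)[of f n] s FunSym by simp
    have "(\<exists>!y. V (opair V z y) (app V I (code_sym V s))) \<and> (\<exists>y\<in>ext V D. V (opair V z y) (app V I (code_sym V s)))"
      if z: "z \<in> seq V ` tuples (ext V D) n" for z
    proof -
      have e: "\<exists>!y. V (opair V z y) (app V I (code_sym V s))" using f z unfolding function_on_def by blast
      then obtain y where y: "V (opair V z y) (app V I (code_sym V s))" by blast
      then obtain x' y' where "y' \<in> ext V D" "opair V z y = opair V x' y'" using f unfolding function_on_def by blast
      then show ?thesis using e y by auto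
    qed
    then show ?thesis using 1 2 FunSym by (simp add: interprets_def)
  next
    case (RelSym r n)
    then show ?thesis using 1 by (simp add: interprets_def)
  qed
  then show "interprets V (str_dom V M) (str_int V M) s" using M(1) by simp
qed

end

section \<open>Patterns of formulas\<close>

locale struct_emb = ext_model V W j for V :: "'v \<Rightarrow> 'v \<Rightarrow> bool" and W :: "'w \<Rightarrow> 'w \<Rightarrow> bool" and j +
  fixes L :: "sym set" and M :: 'v
  assumes M: "is_structure V L M"
begin

abbreviation "DV \<equiv> ext V (str_dom V M)"
abbreviation "DW \<equiv> ext W (j (str_dom V M))"
abbreviation "N \<equiv> j_std W j M"

lemma j_M: "j M = opair W (j (str_dom V M)) (j (str_int V M))"
  by (metis V.is_structureD(1)[OF M] j_opair)

lemma univ_N [simp]: "univ N = DW"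
  by (simp add: j_std_def j_M)

lemma sat_M: "\<phi> \<in> formulas L \<Longrightarrow> (\<And>x. x \<in> fv \<phi> \<Longrightarrow> e x \<in> DV) \<Longrightarrow>
    sat (decode V M) e \<phi> = sat (dec V (str_dom V M) (str_int V M)) e \<phi>"
  using V.sat_decode[of L "str_dom V M" "str_int V M" \<phi> e] V.is_structureD[OF M] by (simp add: formulas_def)

lemma sat_N: "\<phi> \<in> formulas L \<Longrightarrow> (\<And>x. x \<in> fv \<phi> \<Longrightarrow> e x \<in> DW) \<Longrightarrow>
    sat N e \<phi> = sat (dec W (j (str_dom V M)) (j (str_int V M))) e \<phi>"
  using W.sat_decode[of L "j (str_dom V M)" "j (str_int V M)" \<phi> e] V.is_structureD[OF M]
  by (simp add: formulas_def interprets_transfer j_std_def j_M)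

lemma Def_srel:
  assumes \<phi>: "\<phi> \<in> partitioned_formulas L n k" and f: "FDef t u" "FDef t' u'"
  shows "Def (\<lambda>e. srel V (decode V M) n k \<phi> (t e) (t' e)) (\<lambda>e. srel W N n k \<phi> (u e) (u' e))"
proof (rule Def_lift2[OF _ f])
  obtain d where d: "d \<in> DV" using V.is_structureD(2)[OF M] by blast
  have \<phi>': "\<phi> \<in> formulas L" "fv \<phi> \<subseteq> {..<n + k}" using \<phi> by (auto simp: partitioned_formulas_def)
  \<comment> \<open>Indexing a list out of range has an unspecified value, about which nothing can
    be transferred. Variables from \<open>n + k\<close> on are not free in \<open>\<phi>\<close> and
    receive the element \<open>d\<close>, respectively \<open>j d\<close>.\<close>
  let ?t = "\<lambda>d b as i. if i < n then b ! i else if i < n + k then as ! (i - n) else d"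
  have sV: "sat (decode V M) ((!) (b @ as)) \<phi> = sat (dec V (str_dom V M) (str_int V M)) (?t d b as) \<phi>"
    if "b \<in> tuples DV n" "as \<in> tuples DV k" for b as
  proof -
    have "sat (decode V M) ((!) (b @ as)) \<phi> = sat (decode V M) (?t d b as) \<phi>"
      by (rule sat_cong) (use that \<phi>'(2) in \<open>auto simp: tuples_def nth_append\<close>)
    also have "\<dots> = sat (dec V (str_dom V M) (str_int V M)) (?t d b as) \<phi>"
      by (rule sat_M[OF \<phi>'(1)]) (use that d in \<open>auto intro: tuples_nth\<close>)
    finally show ?thesis .
  qed
  have sW: "sat N ((!) (b @ as)) \<phi> = sat (dec W (j (str_dom V M)) (j (str_int V M))) (?t (j d) b as) \<phi>"
    if "b \<in> tuples DW n" "as \<in> tuples DW k" for b as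
  proof -
    have jd: "j d \<in> DW" using d by (simp add: ext_def j_mem)
    have "sat N ((!) (b @ as)) \<phi> = sat N (?t (j d) b as) \<phi>"
      by (rule sat_cong) (use that \<phi>'(2) in \<open>auto simp: tuples_def nth_append\<close>)
    also have "\<dots> = sat (dec W (j (str_dom V M)) (j (str_int V M))) (?t (j d) b as) \<phi>"
      by (rule sat_N[OF \<phi>'(1)]) (use that jd in \<open>auto intro: tuples_nth\<close>)
    finally show ?thesis .
  qed
  have "Def (\<lambda>e. \<exists>b\<in>tuples DV n. \<exists>as\<in>tuples DV k. e 0 = seq V b \<and> e 1 = seq V as \<and>
      sat (dec V (str_dom V M) (str_int V M)) (?t d b as) \<phi>)
    (\<lambda>e. \<exists>b\<in>tuples DW n. \<exists>as\<in>tuples DW k. e 0 = seq W b \<and> e 1 = seq W as \<and>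
      sat (dec W (j (str_dom V M)) (j (str_int V M))) (?t (j d) b as) \<phi>)"
  proof (rule Def_bex_tuples, rule Def_bex_tuples, intro Def_conj Def_eq FDef_var FDef_seq)
    show "Def (\<lambda>e. sat (dec V (str_dom V M) (str_int V M))
        (\<lambda>i. if i < n then map (\<lambda>i. e (i + k)) [0..<n] ! i else if i < n + k then map e [0..<k] ! (i - n) else d) \<phi>)
      (\<lambda>e. sat (dec W (j (str_dom V M)) (j (str_int V M)))
        (\<lambda>i. if i < n then map (\<lambda>i. e (i + k)) [0..<n] ! i else if i < n + k then map e [0..<k] ! (i - n) else j d) \<phi>)"
    proof (rule Def_sat)
      fix i
      show "FDef
          (\<lambda>e. if i < n then map (\<lambda>i. e (i + k)) [0..<n] ! i else if i < n + k then map e [0..<k] ! (i - n) else d)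
          (\<lambda>e. if i < n then map (\<lambda>i. e (i + k)) [0..<n] ! i else if i < n + k then map e [0..<k] ! (i - n) else j d)"
      proof (cases "i < n")
        case False
        then show ?thesis by (cases "i < n + k") (simp_all add: FDef_var FDef_const less_diff_conv2)
      qed (simp add: FDef_var)
    qed
  qed
  then show "Def (\<lambda>e. srel V (decode V M) n k \<phi> (e 0) (e 1)) (\<lambda>e. srel W N n k \<phi> (e 0) (e 1))"
    using sV sW by (simp add: srel_def cong: bex_cong)
qed

definition realV :: "nat \<Rightarrow> nat \<Rightarrow> fm \<Rightarrow> 'v set \<Rightarrow> bool" where
  "realV n k \<phi> Z \<longleftrightarrow> (\<exists>w. w \<in> seq V ` tuples DV n \<and> (\<forall>z\<in>Z. srel V (decode V M) n k \<phi> w z))"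

definition realW :: "nat \<Rightarrow> nat \<Rightarrow> fm \<Rightarrow> 'w set \<Rightarrow> bool" where
  "realW n k \<phi> Z \<longleftrightarrow> (\<exists>w. w \<in> seq W ` tuples DW n \<and> (\<forall>z\<in>Z. srel W N n k \<phi> w z))"

lemma Def_real:
  assumes \<phi>: "\<phi> \<in> partitioned_formulas L n k" and f: "FDef t u"
  shows "Def (\<lambda>e. realV n k \<phi> (ext V (t e))) (\<lambda>e. realW n k \<phi> (ext W (u e)))"
  by (rule Def_lift1[OF _ f]) (unfold realV_def realW_def, intro def_intros Def_srel[OF \<phi>] FDef_const)

lemma ext_power_elem: "ext V (power_elem V M k) = seq V ` tuples DV k"
  unfolding power_elem_def by (simp add: V.ext_elem V.in_model_tuples)

lemma ext_power_elem_W: "ext W (j (power_elem V M k)) = seq W ` tuples DW k"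
proof -
  have "\<forall>z. V z (power_elem V M k) \<longleftrightarrow> z \<in> seq V ` tuples DV k" by (simp flip: ext_power_elem add: in_ext)
  also have "?this \<longleftrightarrow> (\<forall>z. W z (j (power_elem V M k)) \<longleftrightarrow> z \<in> seq W ` tuples DW k)"
    by (rule Def_closed) (intro def_intros FDef_const)
  finally show ?thesis by (simp add: set_eq_iff in_ext)
qed

lemma delta_set_iff:
  "s \<in> delta_set V M n k \<phi> \<longleftrightarrow> believes_finite V s \<and> ext V s \<subseteq> ext V (power_elem V M k) \<and> realV n k \<phi> (ext V s)"
proof -
  have "(\<exists>b\<in>tuples DV n. \<forall>as\<in>tuples DV k. V (seq V as) s \<longrightarrow> sat (decode V M) ((!) (b @ as)) \<phi>) \<longleftrightarrow>
    realV n k \<phi> (ext V s)" if s: "ext V s \<subseteq> seq V ` tuples DV k"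
  proof -
    have "(\<forall>as\<in>tuples DV k. V (seq V as) s \<longrightarrow> sat (decode V M) ((!) (b @ as)) \<phi>) \<longleftrightarrow>
      (\<forall>z\<in>ext V s. srel V (decode V M) n k \<phi> (seq V b) z)" if b: "b \<in> tuples DV n" for b
    proof -
      have 1: "srel V (decode V M) n k \<phi> (seq V b) (seq V as) \<longleftrightarrow> sat (decode V M) ((!) (b @ as)) \<phi>"
        if "as \<in> tuples DV k" for as using b that by (intro V.srel_seq) simp_all
      show ?thesis
      proof safe
        fix z assume *: "\<forall>as\<in>tuples DV k. V (seq V as) s \<longrightarrow> sat (decode V M) ((!) (b @ as)) \<phi>" "z \<in> ext V s"
        then obtain as where as: "as \<in> tuples DV k" "z = seq V as" using s by blast
        then show "srel V (decode V M) n k \<phi> (seq V b) z" using * 1 by (simp add: in_ext)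
      next
        fix as assume *: "\<forall>z\<in>ext V s. srel V (decode V M) n k \<phi> (seq V b) z" "as \<in> tuples DV k" "V (seq V as) s"
        then show "sat (decode V M) ((!) (b @ as)) \<phi>" using 1 by (metis in_ext)
      qed
    qed
    then show ?thesis unfolding realV_def by blast
  qed
  then show ?thesis unfolding delta_set_def ext_power_elem V.believes_finite_finite mem_Collect_eq V.univ_decode by blast
qed

text \<open>The pattern must be an element of \<open>V\<close> for \<open>delta_elem\<close> to mean
  anything. The bounding set of all finite subsets replaces the power set, and separation cuts out
  the realizable ones.\<close>

lemma ext_delta_elem:
  assumes \<phi>: "\<phi> \<in> partitioned_formulas L n k"
  shows "ext V (delta_elem V M n k \<phi>) = delta_set V M n k \<phi>"
proof -
  obtain q where q: "\<forall>s. finite (ext V s) \<and> ext V s \<subseteq> ext V (power_elem V M k) \<longrightarrow> V s q"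
    using V.ex_finite_subsets by blast
  have "in_model V {s \<in> ext V q. believes_finite V s \<and> ext V s \<subseteq> ext V (power_elem V M k) \<and> realV n k \<phi> (ext V s)}"
    by (rule V_sep[where Q = "\<lambda>e. believes_finite W (e 0) \<and> ext W (e 0) \<subseteq> ext W (j (power_elem V M k)) \<and> realW n k \<phi> (ext W (e 0))"])
      (intro def_intros Def_real[OF \<phi>] FDef_const)
  also have "{s \<in> ext V q. believes_finite V s \<and> ext V s \<subseteq> ext V (power_elem V M k) \<and> realV n k \<phi> (ext V s)} =
    delta_set V M n k \<phi>" using q by (auto simp: delta_set_iff V.believes_finite_finite in_ext[of _ V q])
  finally show ?thesis unfolding delta_elem_def by (rule V.ext_elem)
qed

lemma delta_elem_W:
  assumes \<phi>: "\<phi> \<in> partitioned_formulas L n k"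
  shows "W s (j (delta_elem V M n k \<phi>)) \<longleftrightarrow>
    believes_finite W s \<and> ext W s \<subseteq> seq W ` tuples DW k \<and> realW n k \<phi> (ext W s)"
proof -
  have "\<forall>s. V s (delta_elem V M n k \<phi>) \<longleftrightarrow>
    believes_finite V s \<and> ext V s \<subseteq> ext V (power_elem V M k) \<and> realV n k \<phi> (ext V s)"
    using ext_delta_elem[OF \<phi>] delta_set_iff by (metis in_ext)
  also have "?this \<longleftrightarrow> (\<forall>s. W s (j (delta_elem V M n k \<phi>)) \<longleftrightarrow>
    believes_finite W s \<and> ext W s \<subseteq> ext W (j (power_elem V M k)) \<and> realW n k \<phi> (ext W s))"
    by (rule Def_closed) (intro def_intros Def_real[OF \<phi>] FDef_const)
  finally show ?thesis by (simp add: ext_power_elem_W)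
qed

text \<open>\<open>X\<close> witnesses \<open>\<lambda>(\<Delta>\<^sub>M\<^sub>,\<^sub>\<phi>) \<le> |X|\<close>.\<close>

definition bad :: "nat \<Rightarrow> nat \<Rightarrow> fm \<Rightarrow> 'w set \<Rightarrow> bool" where
  "bad n k \<phi> X \<longleftrightarrow> pseudofinite W X \<and> X \<subseteq> seq W ` tuples DW k \<and>
     (\<forall>s\<subseteq>X. finite s \<longrightarrow> realW n k \<phi> s) \<and> \<not> realW n k \<phi> X"

text \<open>Covering and realizing coincide for a pseudofinite \<open>X\<close>: a member of the
  transferred pattern comes with a realization, and conversely a realization cuts a member of the
  pattern out of any internally finite cover of \<open>X\<close>.\<close>

lemma lambda_pattern_delta:
  assumes \<phi>: "\<phi> \<in> partitioned_formulas L n k"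
  shows "lambda_pattern W j (power_elem V M k) (delta_elem V M n k \<phi>) =
    least_cardinal (\<lambda>c. \<exists>X. bad n k \<phi> X \<and> cardinality X \<le> c)"
proof -
  have "(pseudofinite W X \<and> X \<subseteq> ext W (j (power_elem V M k)) \<and> cardinality X \<le> c \<and>
        (\<forall>s\<subseteq>X. finite s \<longrightarrow> (\<exists>d. ext W d = s \<and> W d (j (delta_elem V M n k \<phi>)))) \<and>
        \<not> (\<exists>d. W d (j (delta_elem V M n k \<phi>)) \<and> X \<subseteq> ext W d)) \<longleftrightarrow> bad n k \<phi> X \<and> cardinality X \<le> c" for X c
  proof (cases "pseudofinite W X \<and> X \<subseteq> seq W ` tuples DW k")
    case True
    have 1: "(\<exists>d. ext W d = s \<and> W d (j (delta_elem V M n k \<phi>))) \<longleftrightarrow> realW n k \<phi> s" if s: "s \<subseteq> X" "finite s" for s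
    proof -
      obtain d where d: "ext W d = s" "believes_finite W d" using bf_finite_set[OF s(2)] by blast
      then have "W d (j (delta_elem V M n k \<phi>)) \<longleftrightarrow> realW n k \<phi> s"
        using True s by (auto simp: delta_elem_W[OF \<phi>])
      then show ?thesis using d(1) by (metis delta_elem_W[OF \<phi>])
    qed
    have "realW n k \<phi> X" if "W d (j (delta_elem V M n k \<phi>))" "X \<subseteq> ext W d" for d
      using that unfolding delta_elem_W[OF \<phi>] realW_def by blast
    moreover have "\<exists>d. W d (j (delta_elem V M n k \<phi>)) \<and> X \<subseteq> ext W d" if r: "realW n k \<phi> X"
    proof -
      obtain w where w: "w \<in> seq W ` tuples DW n" "\<And>z. z \<in> X \<Longrightarrow> srel W N n k \<phi> w z" using r by (auto simp: realW_def)
      obtain F where F: "believes_finite W F" "ext W F \<subseteq> ext W (j (power_elem V M k))" "X \<subseteq> ext W F"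
        using pseudofinite_in[of X "j (power_elem V M k)"] True by (auto simp: ext_power_elem_W)
      have "in_model W {z \<in> ext W F. srel W N n k \<phi> w z}"
        by (rule W_sep[where Q = "\<lambda>z e. srel W N n k \<phi> (e 0) z" and e = "\<lambda>_. w"])
          (rule Def_srel[OF \<phi> FDef_var FDef_var])
      then obtain d where d: "ext W d = {z \<in> ext W F. srel W N n k \<phi> w z}" by (auto simp: in_model_def)
      have "believes_finite W d" by (rule bf_subset[OF F(1)]) (auto simp: d)
      moreover have "realW n k \<phi> (ext W d)" unfolding realW_def d using w(1) by blast
      ultimately have "W d (j (delta_elem V M n k \<phi>))" using F(2) d by (auto simp: delta_elem_W[OF \<phi>] ext_power_elem_W)
      then show ?thesis using d F(3) w(2) by blast
    qed
    ultimately have 2: "(\<exists>d. W d (j (delta_elem V M n k \<phi>)) \<and> X \<subseteq> ext W d) \<longleftrightarrow> realW n k \<phi> X" by blast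
    have "(\<forall>s\<subseteq>X. finite s \<longrightarrow> (\<exists>d. ext W d = s \<and> W d (j (delta_elem V M n k \<phi>)))) \<longleftrightarrow>
      (\<forall>s\<subseteq>X. finite s \<longrightarrow> realW n k \<phi> s)" using 1 by simp
    then show ?thesis unfolding bad_def ext_power_elem_W 2 by blast
  next
    case False
    then show ?thesis unfolding bad_def ext_power_elem_W by blast
  qed
  then show ?thesis by (simp add: lambda_pattern_def)
qed

lemma bad_infinite: "bad n k \<phi> X \<Longrightarrow> infinite X"
  by (auto simp: bad_def)

end

section \<open>Elementarily equivalent models have the same finite patterns\<close>

lemma tuples_snoc: "(\<exists>b\<in>tuples X (Suc n). P b) \<longleftrightarrow> (\<exists>a\<in>X. \<exists>b\<in>tuples X n. P (b @ [a]))"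
proof
  assume "\<exists>b\<in>tuples X (Suc n). P b"
  then obtain b where b: "b \<in> tuples X (Suc n)" "P b" by blast
  then obtain b' a where "b = b' @ [a]" by (cases b rule: rev_cases) (auto simp: tuples_def)
  then show "\<exists>a\<in>X. \<exists>b\<in>tuples X n. P (b @ [a])"
    using b by (intro bexI[of _ a] bexI[of _ b']) (auto simp: tuples_def)
next
  assume "\<exists>a\<in>X. \<exists>b\<in>tuples X n. P (b @ [a])"
  then obtain a b where "a \<in> X" "b \<in> tuples X n" "P (b @ [a])" by blast
  then show "\<exists>b\<in>tuples X (Suc n). P b" by (intro bexI[of _ "b @ [a]"]) (auto simp: tuples_def)
qed

lemma ex_tuple_fm:
  assumes "\<phi> \<in> formulas L"
  shows "\<exists>\<psi>\<in>formulas L. fv \<psi> \<subseteq> {i. i + n \<in> fv \<phi>} \<and> (\<forall>(M :: 'a fo_struct) e. sat M e \<psi> \<longleftrightarrow>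
    (\<exists>b\<in>tuples (univ M) n. sat M (\<lambda>i. if i < n then b ! i else e (i - n)) \<phi>))"
proof (induct n)
  case 0
  show ?case using assms by (intro bexI[of _ \<phi>]) auto
next
  case (Suc n)
  then obtain \<psi> where \<psi>: "\<psi> \<in> formulas L" "fv \<psi> \<subseteq> {i. i + n \<in> fv \<phi>}"
    "\<And>(M :: 'a fo_struct) e. sat M e \<psi> \<longleftrightarrow>
      (\<exists>b\<in>tuples (univ M) n. sat M (\<lambda>i. if i < n then b ! i else e (i - n)) \<phi>)" by blast
  \<comment> \<open>Variable 0 of \<open>\<psi>\<close> is variable \<open>n\<close> of
    \<open>\<phi>\<close>, so the new quantifier appends an entry at the end of the tuple.\<close>
  let ?\<chi> = "Neg (all0 (Neg \<psi>))"
  have "sat M e ?\<chi> \<longleftrightarrow> (\<exists>b\<in>tuples (univ M) (Suc n). sat M (\<lambda>i. if i < Suc n then b ! i else e (i - Suc n)) \<phi>)"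
    for M :: "'a fo_struct" and e
  proof -
    have "(\<lambda>i. if i < n then b ! i else (case_nat a e) (i - n)) =
      (\<lambda>i. if i < Suc n then (b @ [a]) ! i else e (i - Suc n))" if "b \<in> tuples (univ M) n" for a b
    proof
      fix i
      show "(if i < n then b ! i else (case_nat a e) (i - n)) = (if i < Suc n then (b @ [a]) ! i else e (i - Suc n))"
      proof (cases "i \<le> n")
        case True
        then show ?thesis using that by (auto simp: tuples_def nth_append)
      next
        case False
        then have "i - n = Suc (i - Suc n)" by simp
        then show ?thesis using False by simp
      qed
    qed
    then show ?thesis by (simp add: sat_all0 \<psi>(3) tuples_snoc cong: bex_cong)
  qed
  moreover have "fv ?\<chi> \<subseteq> {i. i + Suc n \<in> fv \<phi>}" using fv_all0[of "Neg \<psi>"] \<psi>(2) by auto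
  moreover have "?\<chi> \<in> formulas L" using \<psi>(1) by simp
  ultimately show ?case by blast
qed

lemma conj_fm:
  assumes "finite S" "\<And>s. s \<in> S \<Longrightarrow> f s \<in> formulas L"
  shows "\<exists>\<psi>\<in>formulas L. fv \<psi> \<subseteq> (\<Union>s\<in>S. fv (f s)) \<and>
    (\<forall>(M :: 'a fo_struct) e. sat M e \<psi> \<longleftrightarrow> (\<forall>s\<in>S. sat M e (f s)))"
  using assms
proof (induct S rule: finite_induct)
  case empty
  have "All 0 (Equal (Var 0) (Var 0)) \<in> formulas L" by (simp add: formulas_def)
  then show ?case by (intro bexI[of _ "All 0 (Equal (Var 0) (Var 0))"]) auto
next
  case (insert s S)
  then obtain \<psi> where \<psi>: "\<psi> \<in> formulas L" "fv \<psi> \<subseteq> (\<Union>s\<in>S. fv (f s))"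
    "\<And>(M :: 'a fo_struct) e. sat M e \<psi> \<longleftrightarrow> (\<forall>s\<in>S. sat M e (f s))" by blast
  have "And (f s) \<psi> \<in> formulas L" using \<psi>(1) insert.prems by simp
  moreover have "fv (And (f s) \<psi>) \<subseteq> (\<Union>s\<in>insert s S. fv (f s))" using \<psi>(2) by auto
  moreover have "sat M e (And (f s) \<psi>) \<longleftrightarrow> (\<forall>s\<in>insert s S. sat M e (f s))" for M :: "'a fo_struct" and e
    by (simp add: \<psi>(3))
  ultimately show ?case by blast
qed

definition common :: "'a fo_struct \<Rightarrow> nat \<Rightarrow> fm \<Rightarrow> (nat \<Rightarrow> 'a list) \<Rightarrow> nat set \<Rightarrow> bool" where
  "common S n \<phi> A I \<longleftrightarrow> (\<exists>b\<in>tuples (univ S) n. \<forall>i\<in>I. sat S ((!) (b @ A i)) \<phi>)"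

text \<open>The parameter tuples are laid out consecutively, with entry \<open>l\<close> of tuple
  \<open>i\<close> in variable \<open>i * k + l\<close>. The formula is an existential block over a
  conjunction of renamed copies of \<open>\<phi>\<close>.\<close>

lemma pattern_fm:
  assumes \<phi>: "\<phi> \<in> partitioned_formulas L n k" and I: "I \<subseteq> {..<m}"
  shows "\<exists>\<chi>\<in>formulas L. fv \<chi> \<subseteq> {..<m * k} \<and> (\<forall>(S :: 'a fo_struct) A e.
    (\<forall>i<m. length (A i) = k) \<and> (\<forall>i<m. \<forall>l<k. e (i * k + l) = A i ! l) \<longrightarrow> (sat S e \<chi> \<longleftrightarrow> common S n \<phi> A I))"
proof -
  have \<phi>': "\<phi> \<in> formulas L" "fv \<phi> \<subseteq> {..<n + k}" using \<phi> by (auto simp: partitioned_formulas_def)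
  define r where "r i x = (if x < n then x else x + i * k)" for i x :: nat
  have "finite I" using I by (rule finite_subset) simp
  then obtain \<psi> where \<psi>: "\<psi> \<in> formulas L" "fv \<psi> \<subseteq> (\<Union>i\<in>I. fv (ren \<phi> (r i)))"
    "\<And>(M :: 'a fo_struct) e. sat M e \<psi> \<longleftrightarrow> (\<forall>i\<in>I. sat M e (ren \<phi> (r i)))"
    using conj_fm[of I "\<lambda>i. ren \<phi> (r i)" L] \<phi>' by auto
  obtain \<chi> where \<chi>: "\<chi> \<in> formulas L" "fv \<chi> \<subseteq> {i. i + n \<in> fv \<psi>}"
    "\<And>(M :: 'a fo_struct) e. sat M e \<chi> \<longleftrightarrow>
      (\<exists>b\<in>tuples (univ M) n. sat M (\<lambda>i. if i < n then b ! i else e (i - n)) \<psi>)"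
    using ex_tuple_fm[OF \<psi>(1), of n] by blast
  have "x < m * k" if "x \<in> fv \<chi>" for x
  proof -
    have "x + n \<in> fv \<psi>" using \<chi>(2) that by blast
    then obtain i where i: "i \<in> I" "x + n \<in> fv (ren \<phi> (r i))" using \<psi>(2) by blast
    then obtain y where y: "y \<in> fv \<phi>" "x + n = r i y" using fv_ren[of \<phi> "r i"] by blast
    then have "x < Suc i * k" using \<phi>'(2) by (auto simp: r_def split: if_splits)
    also have "\<dots> \<le> m * k" using i(1) I by (intro mult_le_mono1) auto
    finally show ?thesis .
  qed
  moreover have "sat S e \<chi> \<longleftrightarrow> common S n \<phi> A I"
    if A: "\<forall>i<m. length (A i) = k" "\<forall>i<m. \<forall>l<k. e (i * k + l) = A i ! l" for S :: "'a fo_struct" and A e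
  proof -
    have "sat S ((\<lambda>i. if i < n then b ! i else e (i - n)) \<circ> r i) \<phi> = sat S ((!) (b @ A i)) \<phi>"
      if b: "b \<in> tuples (univ S) n" and i: "i \<in> I" for b i
    proof (rule sat_cong)
      fix x assume "x \<in> fv \<phi>"
      then have x: "x < n + k" using \<phi>'(2) by auto
      have im: "i < m" using i I by auto
      show "((\<lambda>i. if i < n then b ! i else e (i - n)) \<circ> r i) x = (b @ A i) ! x"
      proof (cases "x < n")
        case True
        then show ?thesis using b by (auto simp: r_def tuples_def nth_append)
      next
        case False
        then have "x + i * k - n = i * k + (x - n)" "x - n < k" using x by auto
        then have "e (x + i * k - n) = A i ! (x - n)" using A(2) im by simp
        then show ?thesis using False b by (auto simp: r_def tuples_def nth_append)
      qed
    qed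
    then show ?thesis by (simp add: \<chi>(3) \<psi>(3) sat_ren common_def cong: bex_cong)
  qed
  ultimately show ?thesis using \<chi>(1) by (intro bexI[of _ \<chi>]) auto
qed

text \<open>A finite conjunction over all subsets of the \<open>m\<close> indices records which of
  them are consistent and which are not, so that one sentence holds the entire trace of the
  pattern.\<close>

lemma ex_sentence:
  assumes \<phi>: "\<phi> \<in> partitioned_formulas L n k"
  shows "\<exists>\<theta>\<in>sentences L. \<forall>(S :: 'a fo_struct) e. sat S e \<theta> \<longleftrightarrow>
    (\<exists>A. (\<forall>i<m. A i \<in> tuples (univ S) k) \<and> (\<forall>I\<subseteq>{..<m}. common S n \<phi> A I \<longleftrightarrow> Pt I))"
proof -
  have "\<forall>I\<in>Pow {..<m}. \<exists>\<chi>. \<chi> \<in> formulas L \<and> fv \<chi> \<subseteq> {..<m * k} \<and> (\<forall>(S :: 'a fo_struct) A e.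
    (\<forall>i<m. length (A i) = k) \<and> (\<forall>i<m. \<forall>l<k. e (i * k + l) = A i ! l) \<longrightarrow> (sat S e \<chi> \<longleftrightarrow> common S n \<phi> A I))"
    using pattern_fm[OF \<phi>, where ?'a = 'a] by blast
  from bchoice[OF this] obtain \<chi> where \<chi>: "\<forall>I\<in>Pow {..<m}. \<chi> I \<in> formulas L \<and> fv (\<chi> I) \<subseteq> {..<m * k} \<and>
    (\<forall>(S :: 'a fo_struct) A e. (\<forall>i<m. length (A i) = k) \<and> (\<forall>i<m. \<forall>l<k. e (i * k + l) = A i ! l) \<longrightarrow>
      (sat S e (\<chi> I) \<longleftrightarrow> common S n \<phi> A I))" ..
  define f where "f I = (if Pt I then \<chi> I else Neg (\<chi> I))" for I
  have "f I \<in> formulas L" if "I \<in> Pow {..<m}" for I using \<chi> that by (auto simp: f_def)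
  then obtain \<psi> where \<psi>: "\<psi> \<in> formulas L" "fv \<psi> \<subseteq> (\<Union>I\<in>Pow {..<m}. fv (f I))"
    "\<And>(M :: 'a fo_struct) e. sat M e \<psi> \<longleftrightarrow> (\<forall>I\<in>Pow {..<m}. sat M e (f I))"
    using conj_fm[of "Pow {..<m}" f L] by auto
  obtain \<theta> where \<theta>: "\<theta> \<in> formulas L" "fv \<theta> \<subseteq> {i. i + m * k \<in> fv \<psi>}"
    "\<And>(M :: 'a fo_struct) e. sat M e \<theta> \<longleftrightarrow>
      (\<exists>b\<in>tuples (univ M) (m * k). sat M (\<lambda>i. if i < m * k then b ! i else e (i - m * k)) \<psi>)"
    using ex_tuple_fm[OF \<psi>(1), of "m * k"] by blast
  have "fv (f I) \<subseteq> {..<m * k}" if "I \<in> Pow {..<m}" for I using \<chi> that by (auto simp: f_def)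
  then have "fv \<psi> \<subseteq> {..<m * k}" using \<psi>(2) by blast
  then have "fv \<theta> = {}" using \<theta>(2) by auto
  then have "\<theta> \<in> sentences L" using \<theta>(1) by (simp add: sentences_def)
  moreover have "sat S e \<theta> \<longleftrightarrow> (\<exists>A. (\<forall>i<m. A i \<in> tuples (univ S) k) \<and> (\<forall>I\<subseteq>{..<m}. common S n \<phi> A I \<longleftrightarrow> Pt I))"
    for S :: "'a fo_struct" and e
  proof -
    have idx: "i * k + l < m * k" if "i < m" "l < k" for i l
    proof -
      have "i * k + l < Suc i * k" using that by simp
      also have "\<dots> \<le> m * k" using that by (intro mult_le_mono1) simp
      finally show ?thesis .
    qed
    have main: "sat S (\<lambda>i. if i < m * k then u ! i else e (i - m * k)) \<psi> \<longleftrightarrow>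
        (\<forall>I\<subseteq>{..<m}. common S n \<phi> A I \<longleftrightarrow> Pt I)"
      if A: "\<forall>i<m. length (A i) = k" "\<And>i l. i < m \<Longrightarrow> l < k \<Longrightarrow> u ! (i * k + l) = A i ! l" for A u
    proof -
      have "sat S (\<lambda>i. if i < m * k then u ! i else e (i - m * k)) (\<chi> I) \<longleftrightarrow> common S n \<phi> A I"
        if "I \<in> Pow {..<m}" for I
        using \<chi>[rule_format, OF that, THEN conjunct2, THEN conjunct2, rule_format, of A] A idx by simp
      then show ?thesis by (auto simp: \<psi>(3) f_def)
    qed
    show ?thesis
    proof
      assume "sat S e \<theta>"
      then obtain u where u: "u \<in> tuples (univ S) (m * k)"
        "sat S (\<lambda>i. if i < m * k then u ! i else e (i - m * k)) \<psi>" by (auto simp: \<theta>(3))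
      let ?A = "\<lambda>i. map (\<lambda>l. u ! (i * k + l)) [0..<k]"
      have "\<forall>I\<subseteq>{..<m}. common S n \<phi> ?A I \<longleftrightarrow> Pt I" using main[of ?A u] u(2) by simp
      moreover have "?A i \<in> tuples (univ S) k" if "i < m" for i
        using idx[OF that] tuples_nth[OF u(1)] by (auto simp: tuples_def)
      ultimately show "\<exists>A. (\<forall>i<m. A i \<in> tuples (univ S) k) \<and> (\<forall>I\<subseteq>{..<m}. common S n \<phi> A I \<longleftrightarrow> Pt I)"
        by (intro exI[of _ ?A]) simp
    next
      assume "\<exists>A. (\<forall>i<m. A i \<in> tuples (univ S) k) \<and> (\<forall>I\<subseteq>{..<m}. common S n \<phi> A I \<longleftrightarrow> Pt I)"
      then obtain A where A: "\<forall>i<m. A i \<in> tuples (univ S) k" "\<forall>I\<subseteq>{..<m}. common S n \<phi> A I \<longleftrightarrow> Pt I"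
        by (elim exE conjE)
      let ?u = "map (\<lambda>x. A (x div k) ! (x mod k)) [0..<m * k]"
      have div: "x div k < m \<and> x mod k < k" if "x < m * k" for x
        using that by (auto simp: less_mult_imp_div_less) (cases k; simp)
      have "A (x div k) ! (x mod k) \<in> univ S" if "x < m * k" for x
        using div[OF that] A(1) tuples_nth by blast
      then have "?u \<in> tuples (univ S) (m * k)" by (auto simp: tuples_def)
      moreover have "sat S (\<lambda>i. if i < m * k then ?u ! i else e (i - m * k)) \<psi>"
      proof (rule iffD2[OF main[of A ?u]])
        show "\<forall>i<m. length (A i) = k" using A(1) by (auto simp: tuples_def)
        show "?u ! (i * k + l) = A i ! l" if "i < m" "l < k" for i l using idx[OF that] that by simp
      qed (rule A(2))
      ultimately show "sat S e \<theta>" unfolding \<theta>(3) by (rule bexI[rotated])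
    qed
  qed
  ultimately show ?thesis by blast
qed

lemma same_patterns:
  assumes T: "complete_theory_in V L T" and M: "is_model V L T M" "is_model V L T M'"
    and \<phi>: "\<phi> \<in> partitioned_formulas L n k"
    and A: "\<And>i. i < m \<Longrightarrow> A i \<in> tuples (univ (decode V M)) k"
    and ne: "univ (decode V M) \<noteq> {}" "univ (decode V M') \<noteq> {}"
  shows "\<exists>A'. (\<forall>i<m. A' i \<in> tuples (univ (decode V M')) k) \<and>
    (\<forall>I\<subseteq>{..<m}. common (decode V M) n \<phi> A I \<longleftrightarrow> common (decode V M') n \<phi> A' I)"
proof -
  obtain \<theta> where \<theta>: "\<theta> \<in> sentences L" "\<And>(S :: 'a fo_struct) e. sat S e \<theta> \<longleftrightarrow>
    (\<exists>A'. (\<forall>i<m. A' i \<in> tuples (univ S) k) \<and> (\<forall>I\<subseteq>{..<m}. common S n \<phi> A' I \<longleftrightarrow> common (decode V M) n \<phi> A I))"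
    using ex_sentence[OF \<phi>, of m "common (decode V M) n \<phi> A"] by blast
  have true: "sat (decode V M) e \<theta>" for e
    unfolding \<theta>(2) by (intro exI[of _ A]) (use A in simp)
  obtain d d' where d: "d \<in> univ (decode V M)" "d' \<in> univ (decode V M')" using ne by blast
  have "\<not> holds (decode V M) (Neg \<theta>)"
    unfolding holds_def using true d(1) by (auto intro!: exI[of _ "\<lambda>_. d"])
  then have "holds (decode V M') \<theta>" using T M \<theta>(1) unfolding complete_theory_in_def by blast
  then have "sat (decode V M') (\<lambda>_. d') \<theta>" using d by (auto simp: holds_def)
  then obtain A' where A': "\<forall>i<m. A' i \<in> tuples (univ (decode V M')) k"
    "\<forall>I\<subseteq>{..<m}. common (decode V M') n \<phi> A' I \<longleftrightarrow> common (decode V M) n \<phi> A I"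
    unfolding \<theta>(2) by (elim exE conjE)
  then show ?thesis by (intro exI[of _ A']) simp
qed

context struct_emb begin

lemma realV_image:
  assumes "\<And>i. i \<in> I \<Longrightarrow> A i \<in> tuples DV k"
  shows "realV n k \<phi> ((\<lambda>i. seq V (A i)) ` I) \<longleftrightarrow> common (decode V M) n \<phi> A I"
proof -
  have "srel V (decode V M) n k \<phi> (seq V b) (seq V (A i)) \<longleftrightarrow> sat (decode V M) ((!) (b @ A i)) \<phi>"
    if "b \<in> tuples DV n" "i \<in> I" for b i
    using V.srel_seq[of b "decode V M" n "A i" k \<phi>] assms that by simp
  then show ?thesis unfolding realV_def common_def V.univ_decode by fast
qed

lemma srel_N [simp]:
  "b \<in> tuples DW n \<Longrightarrow> as \<in> tuples DW k \<Longrightarrow> srel W N n k \<phi> (seq W b) (seq W as) \<longleftrightarrow> sat N ((!) (b @ as)) \<phi>"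
  using W.srel_seq[of b N n as k \<phi>] by simp

lemma realW_iff:
  assumes "Z \<subseteq> seq W ` tuples DW k"
  shows "realW n k \<phi> Z \<longleftrightarrow> (\<exists>b\<in>tuples DW n. \<forall>as\<in>tuples DW k. seq W as \<in> Z \<longrightarrow> sat N ((!) (b @ as)) \<phi>)"
proof -
  have "(\<forall>z\<in>Z. srel W N n k \<phi> (seq W b) z) \<longleftrightarrow> (\<forall>as\<in>tuples DW k. seq W as \<in> Z \<longrightarrow> sat N ((!) (b @ as)) \<phi>)"
    if b: "b \<in> tuples DW n" for b
  proof
    assume "\<forall>as\<in>tuples DW k. seq W as \<in> Z \<longrightarrow> sat N ((!) (b @ as)) \<phi>"
    then show "\<forall>z\<in>Z. srel W N n k \<phi> (seq W b) z" using assms b by force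
  next
    assume "\<forall>z\<in>Z. srel W N n k \<phi> (seq W b) z"
    then show "\<forall>as\<in>tuples DW k. seq W as \<in> Z \<longrightarrow> sat N ((!) (b @ as)) \<phi>" using b srel_N by blast
  qed
  then show ?thesis unfolding realW_def by blast
qed

lemma pseudosaturated_real:
  assumes ps: "pseudosaturated W (cardSuc |X| ) L N" and inf: "infinite X"
    and \<phi>: "\<phi> \<in> partitioned_formulas L n k"
    and Z: "pseudofinite W Z" "Z \<subseteq> seq W ` tuples DW k" "|Z| \<le>o |X|"
    and fin: "\<And>s. s \<subseteq> Z \<Longrightarrow> finite s \<Longrightarrow> realW n k \<phi> s"
  shows "realW n k \<phi> Z"
proof -
  obtain F where F: "believes_finite W F" "ext W F \<subseteq> ext W (j (power_elem V M k))" "Z \<subseteq> ext W F"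
    using pseudofinite_in[OF Z(1), of "j (power_elem V M k)"] Z(2) by (auto simp: ext_power_elem_W)
  obtain B where B: "believes_finite W B" "ext W B \<subseteq> DW" "ext W F \<subseteq> seq W ` tuples (ext W B) k"
    using bf_coordinates[OF F(1), of "j (str_dom V M)" k] F(2) by (auto simp: ext_power_elem_W)
  have "\<forall>z\<in>Z. \<exists>as. as \<in> tuples (ext W B) k \<and> z = seq W as" using F(3) B(3) by blast
  from bchoice[OF this] obtain a where a: "\<forall>z\<in>Z. a z \<in> tuples (ext W B) k \<and> z = seq W (a z)" ..
  define A where "A = (\<Union>z\<in>Z. set (a z))"
  have AB: "A \<subseteq> ext W B" using a by (auto simp: A_def tuples_def)
  have pf: "pseudofinite W A" using AB B(1) by (auto simp: pseudofinite_def)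
  have "|A| \<le>o |X|" unfolding A_def
  proof (rule card_of_UNION_ordLeq_infinite[OF inf Z(3)], rule ballI)
    show "|set (a z)| \<le>o |X|" for z by (rule finite_ordLeq_infinite[OF _ inf]) simp
  qed
  then have "|A| <o cardSuc |X|" by (simp add: cardSuc_greater card_of_Card_order ordLeq_ordLess_trans)
  then have rt: "realizes_types_over L N A" using ps pf AB B(2) by (auto simp: pseudosaturated_def)
  define p0 where "p0 = (\<lambda>z. (\<phi>, a z)) ` Z"
  have p0: "p0 \<subseteq> param_formulas L A n"
  proof -
    have "(\<phi>, a z) \<in> param_formulas L A n" if "z \<in> Z" for z
      using a that \<phi> by (auto simp: param_formulas_def partitioned_formulas_def A_def tuples_def)
    then show ?thesis by (auto simp: p0_def)
  qed
  have aD: "a z \<in> tuples DW k" if "z \<in> Z" for z using a that B(2) by (auto simp: tuples_def)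
  have "\<exists>b\<in>tuples (univ N) n. satisfies_all N b q" if q: "q \<subseteq> p0" "finite q" for q
  proof -
    obtain s where s: "s \<subseteq> Z" "finite s" "q = (\<lambda>z. (\<phi>, a z)) ` s"
      using finite_subset_image[OF q(2) q(1)[unfolded p0_def]] by blast
    obtain b where b: "b \<in> tuples DW n" "\<forall>as\<in>tuples DW k. seq W as \<in> s \<longrightarrow> sat N ((!) (b @ as)) \<phi>"
      using fin[OF s(1,2)] realW_iff[of s k n \<phi>] s(1) Z(2) by blast
    have "sat N ((!) (b @ a z)) \<phi>" if "z \<in> s" for z
    proof -
      have "seq W (a z) \<in> s" using a that s(1) by (metis subsetD)
      then show ?thesis using b(2) aD that s(1) by blast
    qed
    then show ?thesis using b(1) s(3) by (intro bexI[of _ b]) (auto simp: satisfies_all_def)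
  qed
  from extend_to_complete_type[OF p0 this]
  obtain p where p: "complete_type L N A n p" "p0 \<subseteq> p" by blast
  have "\<exists>b\<in>tuples DW n. satisfies_all N b p" using rt p(1) unfolding realizes_types_over_def univ_N by blast
  then obtain b where b: "b \<in> tuples DW n" "satisfies_all N b p" by blast
  have "srel W N n k \<phi> (seq W b) z" if z: "z \<in> Z" for z
  proof -
    have "(\<phi>, a z) \<in> p" using p(2) z by (auto simp: p0_def)
    then have "sat N ((!) (b @ a z)) \<phi>" using b(2) by (auto simp: satisfies_all_def)
    then have "srel W N n k \<phi> (seq W b) (seq W (a z))" using b(1) aD[OF z] by simp
    then show ?thesis using a z by metis
  qed
  then show ?thesis using b(1) unfolding realW_def by blast
qed

end

section \<open>Pseudosaturation bounds the local invariants\<close>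

text \<open>\<open>lambda_formula\<close> is evaluated in a chosen model, here \<open>M0\<close>,
  whereas \<open>pseudosaturates\<close> supplies some model, here \<open>M1\<close>. The two must
  be compared.\<close>

locale two_models = ext_model V W j for V :: "'v \<Rightarrow> 'v \<Rightarrow> bool" and W :: "'w \<Rightarrow> 'w \<Rightarrow> bool" and j +
  fixes L :: "sym set" and T :: "fm set" and M0 M1 :: 'v
  assumes T: "complete_theory_in V L T" and M0: "is_model V L T M0" and M1: "is_model V L T M1"

sublocale two_models \<subseteq> A: struct_emb V W j L M0
  using M0 by unfold_locales (simp add: is_model_def)

sublocale two_models \<subseteq> B: struct_emb V W j L M1
  using M1 by unfold_locales (simp add: is_model_def)

context two_models begin

text \<open>Which subsets of a finite set of instances are consistent is a first-order property of the
  model, hence occurs in every model of \<open>T\<close>.\<close>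

lemma finite_pattern_map:
  assumes \<phi>: "\<phi> \<in> partitioned_formulas L n k"
    and F: "believes_finite V F" "\<forall>z\<in>ext V F. z \<in> seq V ` tuples A.DV k"
  shows "\<exists>g F'. believes_finite V F' \<and> (\<forall>z\<in>ext V F'. z \<in> seq V ` tuples B.DV k) \<and>
    (\<forall>x\<in>ext V F. \<exists>y\<in>ext V F'. V (opair V x y) g) \<and>
    (\<forall>x y y'. V (opair V x y) g \<and> V (opair V x y') g \<longrightarrow> y = y') \<and>
    (\<forall>s t. ext V s \<subseteq> ext V F \<and> ext V t \<subseteq> ext V F' \<and>
      (\<forall>y\<in>ext V F'. V y t \<longleftrightarrow> (\<exists>x\<in>ext V s. V (opair V x y) g)) \<longrightarrow>
      (A.realV n k \<phi> (ext V s) \<longleftrightarrow> B.realV n k \<phi> (ext V t)))"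
proof -
  have fin: "finite (ext V F)" using F(1) by (simp add: V.believes_finite_finite)
  define m where "m = card (ext V F)"
  obtain h where h: "bij_betw h {0..<m} (ext V F)" using ex_bij_betw_nat_finite[OF fin] m_def by blast
  have hF: "h i \<in> ext V F" if "i < m" for i using h that by (auto simp: bij_betw_def)
  have hinj: "h i = h i' \<longleftrightarrow> i = i'" if "i < m" "i' < m" for i i' using h that by (auto simp: bij_betw_def inj_on_def)
  have hsurj: "\<exists>i<m. x = h i" if "x \<in> ext V F" for x
    using that h unfolding bij_betw_def by (metis imageE atLeastLessThan_iff)
  have "\<forall>i\<in>{..<m}. \<exists>as. as \<in> tuples A.DV k \<and> h i = seq V as" using F(2) hF by blast
  from bchoice[OF this] obtain a where a: "\<forall>i\<in>{..<m}. a i \<in> tuples A.DV k \<and> h i = seq V (a i)" ..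
  have "\<exists>a'. (\<forall>i<m. a' i \<in> tuples (univ (decode V M1)) k) \<and>
    (\<forall>I\<subseteq>{..<m}. common (decode V M0) n \<phi> a I \<longleftrightarrow> common (decode V M1) n \<phi> a' I)"
    by (rule same_patterns[OF T M0 M1 \<phi>])
      (use a V.is_structureD(2)[OF A.M] V.is_structureD(2)[OF B.M] in auto)
  then obtain a' where a': "\<And>i. i < m \<Longrightarrow> a' i \<in> tuples B.DV k"
    "\<And>I. I \<subseteq> {..<m} \<Longrightarrow> common (decode V M0) n \<phi> a I \<longleftrightarrow> common (decode V M1) n \<phi> a' I" by auto
  have "in_model V ((\<lambda>i. opair V (h i) (seq V (a' i))) ` {..<m})" by (rule V.in_model_finite) simp
  then obtain g where "ext V g = (\<lambda>i. opair V (h i) (seq V (a' i))) ` {..<m}" by (auto simp: in_model_def)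
  then have g: "V p g \<longleftrightarrow> (\<exists>i<m. p = opair V (h i) (seq V (a' i)))" for p by (auto simp: ext_def set_eq_iff)
  have "in_model V ((\<lambda>i. seq V (a' i)) ` {..<m})" by (rule V.in_model_finite) simp
  then obtain F' where F': "ext V F' = (\<lambda>i. seq V (a' i)) ` {..<m}" by (auto simp: in_model_def)
  have "A.realV n k \<phi> (ext V s) \<longleftrightarrow> B.realV n k \<phi> (ext V t)"
    if st: "ext V s \<subseteq> ext V F" "ext V t \<subseteq> ext V F'" "\<forall>y\<in>ext V F'. V y t \<longleftrightarrow> (\<exists>x\<in>ext V s. V (opair V x y) g)" for s t
  proof -
    define I where "I = {i. i < m \<and> h i \<in> ext V s}"
    have s: "ext V s = (\<lambda>i. seq V (a i)) ` I"
    proof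
      show "ext V s \<subseteq> (\<lambda>i. seq V (a i)) ` I"
      proof
        fix x assume x: "x \<in> ext V s"
        then obtain i where "i < m" "x = h i" using hsurj st(1) by blast
        then show "x \<in> (\<lambda>i. seq V (a i)) ` I" using a x by (auto simp: I_def)
      qed
      show "(\<lambda>i. seq V (a i)) ` I \<subseteq> ext V s" using a by (auto simp: I_def)
    qed
    have t: "ext V t = (\<lambda>i. seq V (a' i)) ` I"
    proof
      show "ext V t \<subseteq> (\<lambda>i. seq V (a' i)) ` I"
      proof
        fix y assume y: "y \<in> ext V t"
        then have "\<exists>x\<in>ext V s. V (opair V x y) g" using st(2,3) by (auto simp: in_ext)
        then show "y \<in> (\<lambda>i. seq V (a' i)) ` I" by (auto simp: g I_def)
      qed
      show "(\<lambda>i. seq V (a' i)) ` I \<subseteq> ext V t"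
      proof
        fix y assume "y \<in> (\<lambda>i. seq V (a' i)) ` I"
        then obtain i where i: "i < m" "h i \<in> ext V s" "y = seq V (a' i)" by (auto simp: I_def)
        then have "V (opair V (h i) y) g" "y \<in> ext V F'" by (auto simp: g F')
        then show "y \<in> ext V t" using st(3) i(2) by (auto simp: in_ext)
      qed
    qed
    have I: "I \<subseteq> {..<m}" by (auto simp: I_def)
    show ?thesis unfolding s t
      using A.realV_image[of I a k n \<phi>] B.realV_image[of I a' k n \<phi>] a a' I by (simp add: subset_iff)
  qed
  moreover have "believes_finite V F'" by (simp add: V.believes_finite_finite F')
  moreover have "\<forall>z\<in>ext V F'. z \<in> seq V ` tuples B.DV k" using a'(1) by (auto simp: F')
  moreover have "\<forall>x\<in>ext V F. \<exists>y\<in>ext V F'. V (opair V x y) g"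
  proof
    fix x assume "x \<in> ext V F"
    then obtain i where "i < m" "x = h i" using hsurj by blast
    then show "\<exists>y\<in>ext V F'. V (opair V x y) g" by (auto simp: F' g)
  qed
  moreover have "\<forall>x y y'. V (opair V x y) g \<and> V (opair V x y') g \<longrightarrow> y = y'"
    using hinj by (auto simp: g)
  ultimately show ?thesis by (intro exI[of _ g] exI[of _ F'] conjI allI impI; simp)
qed

text \<open>Transfer turns finite sets of instances into internally finite ones. To permit this, the
  map is a graph \<open>g\<close> inside the model and images are described by membership.\<close>

lemma pattern_map:
  assumes \<phi>: "\<phi> \<in> partitioned_formulas L n k"
    and F: "believes_finite W F" "ext W F \<subseteq> seq W ` tuples A.DW k"
  shows "\<exists>g F'. believes_finite W F' \<and> (\<forall>z\<in>ext W F'. z \<in> seq W ` tuples B.DW k) \<and>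
    (\<forall>x\<in>ext W F. \<exists>y\<in>ext W F'. W (opair W x y) g) \<and>
    (\<forall>x y y'. W (opair W x y) g \<and> W (opair W x y') g \<longrightarrow> y = y') \<and>
    (\<forall>s t. ext W s \<subseteq> ext W F \<and> ext W t \<subseteq> ext W F' \<and>
      (\<forall>y\<in>ext W F'. W y t \<longleftrightarrow> (\<exists>x\<in>ext W s. W (opair W x y) g)) \<longrightarrow>
      (A.realW n k \<phi> (ext W s) \<longleftrightarrow> B.realW n k \<phi> (ext W t)))"
proof -
  have "\<forall>F. believes_finite V F \<and> (\<forall>z\<in>ext V F. z \<in> seq V ` tuples A.DV k) \<longrightarrow>
   (\<exists>g F'. believes_finite V F' \<and> (\<forall>z\<in>ext V F'. z \<in> seq V ` tuples B.DV k) \<and>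
    (\<forall>x\<in>ext V F. \<exists>y\<in>ext V F'. V (opair V x y) g) \<and>
    (\<forall>x y y'. V (opair V x y) g \<and> V (opair V x y') g \<longrightarrow> y = y') \<and>
    (\<forall>s t. ext V s \<subseteq> ext V F \<and> ext V t \<subseteq> ext V F' \<and>
      (\<forall>y\<in>ext V F'. V y t \<longleftrightarrow> (\<exists>x\<in>ext V s. V (opair V x y) g)) \<longrightarrow>
      (A.realV n k \<phi> (ext V s) \<longleftrightarrow> B.realV n k \<phi> (ext V t))))"
    using finite_pattern_map[OF \<phi>] by simp
  also have "?this \<longleftrightarrow> (\<forall>F. believes_finite W F \<and> (\<forall>z\<in>ext W F. z \<in> seq W ` tuples A.DW k) \<longrightarrow>
   (\<exists>g F'. believes_finite W F' \<and> (\<forall>z\<in>ext W F'. z \<in> seq W ` tuples B.DW k) \<and>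
    (\<forall>x\<in>ext W F. \<exists>y\<in>ext W F'. W (opair W x y) g) \<and>
    (\<forall>x y y'. W (opair W x y) g \<and> W (opair W x y') g \<longrightarrow> y = y') \<and>
    (\<forall>s t. ext W s \<subseteq> ext W F \<and> ext W t \<subseteq> ext W F' \<and>
      (\<forall>y\<in>ext W F'. W y t \<longleftrightarrow> (\<exists>x\<in>ext W s. W (opair W x y) g)) \<longrightarrow>
      (A.realW n k \<phi> (ext W s) \<longleftrightarrow> B.realW n k \<phi> (ext W t)))))"
    by (rule Def_closed) (intro def_intros FDef_const A.Def_real[OF \<phi>] B.Def_real[OF \<phi>])
  finally show ?thesis using F by (simp add: subset_eq)
qed

text \<open>An internal map carries the bad set to \<open>M1\<close>, where its image is again
  finitely realizable and so realized, by pseudosaturation. The realization has to be pulled back to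
  \<open>M0\<close>, although patterns are compared for internal sets only.\<close>

lemma bad_not_pseudosaturated:
  assumes \<phi>: "\<phi> \<in> partitioned_formulas L n k" and bad: "A.bad n k \<phi> X"
  shows "\<not> pseudosaturated W (cardSuc |X| ) L (j_std W j M1)"
proof
  assume ps: "pseudosaturated W (cardSuc |X| ) L (j_std W j M1)"
  have X: "pseudofinite W X" "X \<subseteq> seq W ` tuples A.DW k" "\<And>s. s \<subseteq> X \<Longrightarrow> finite s \<Longrightarrow> A.realW n k \<phi> s"
    "\<not> A.realW n k \<phi> X" using bad by (auto simp: A.bad_def)
  obtain F where F: "believes_finite W F" "ext W F \<subseteq> seq W ` tuples A.DW k" "X \<subseteq> ext W F"
    using pseudofinite_in[OF X(1), of "j (power_elem V M0 k)"] X(2) by (auto simp: A.ext_power_elem_W)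
  obtain g F' where F': "believes_finite W F'" "\<forall>z\<in>ext W F'. z \<in> seq W ` tuples B.DW k"
    and g: "\<forall>x\<in>ext W F. \<exists>y\<in>ext W F'. W (opair W x y) g"
      "\<forall>x y y'. W (opair W x y) g \<and> W (opair W x y') g \<longrightarrow> y = y'"
    and eq: "\<forall>s t. ext W s \<subseteq> ext W F \<and> ext W t \<subseteq> ext W F' \<and>
      (\<forall>y\<in>ext W F'. W y t \<longleftrightarrow> (\<exists>x\<in>ext W s. W (opair W x y) g)) \<longrightarrow>
      (A.realW n k \<phi> (ext W s) \<longleftrightarrow> B.realW n k \<phi> (ext W t))"
    using pattern_map[OF \<phi> F(1,2)] by (elim exE conjE)
  have "\<forall>x\<in>ext W F. \<exists>y. y \<in> ext W F' \<and> W (opair W x y) g" using g(1) by blast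
  from bchoice[OF this] obtain f where f: "\<forall>x\<in>ext W F. f x \<in> ext W F' \<and> W (opair W x (f x)) g" ..
  have fg: "W (opair W x y) g \<longleftrightarrow> y = f x" if "x \<in> ext W F" for x y using f g(2) that by blast
  have real: "A.realW n k \<phi> (ext W s) \<longleftrightarrow> B.realW n k \<phi> (f ` ext W s)"
    if s: "ext W s \<subseteq> ext W F" "in_model W (f ` ext W s)" for s
  proof -
    obtain t where t: "ext W t = f ` ext W s" using s(2) by (auto simp: in_model_def)
    have "W y t \<longleftrightarrow> (\<exists>x\<in>ext W s. W (opair W x y) g)" for y
      using fg s(1) t[unfolded set_eq_iff, rule_format, of y] by (auto simp: in_ext[of y])
    moreover have "ext W t \<subseteq> ext W F'" using f s(1) t by auto
    ultimately show ?thesis using eq[rule_format, of s t] s(1) t by simp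
  qed
  have "B.realW n k \<phi> (f ` X)"
  proof (rule B.pseudosaturated_real[OF ps A.bad_infinite[OF bad] \<phi>])
    have "f ` X \<subseteq> ext W F'" using f F(3) by blast
    then show "pseudofinite W (f ` X)" "f ` X \<subseteq> seq W ` tuples B.DW k" using F' by (auto simp: pseudofinite_def)
    show "|f ` X| \<le>o |X|" by (rule card_of_image)
    fix t assume t: "t \<subseteq> f ` X" "finite t"
    from finite_subset_image[OF t(2,1)] obtain s where s: "s \<subseteq> X" "finite s" "t = f ` s" by blast
    obtain s' where s': "ext W s' = s" using W.in_model_finite[OF s(2)] by (auto simp: in_model_def)
    have "in_model W (f ` ext W s')" using s(2) s' by (intro W.in_model_finite) simp
    then show "B.realW n k \<phi> t" using real[of s'] s s' F(3) X(3)[OF s(1,2)] by auto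
  qed
  then obtain w where w: "w \<in> seq W ` tuples B.DW n" "\<And>x. x \<in> X \<Longrightarrow> srel W B.N n k \<phi> w (f x)"
    by (auto simp: B.realW_def)
  have D: "WW.Def (\<lambda>e. srel W B.N n k \<phi> (e 0) (e 1)) (\<lambda>e. srel W B.N n k \<phi> (e 0) (e 1))"
    by (rule Def_target[OF B.Def_srel[OF \<phi> FDef_var FDef_var]])
  \<comment> \<open>The external \<open>X\<close> is enlarged to the internal set of all
    \<open>x\<close> in \<open>F\<close> whose image is satisfied by \<open>w\<close>; the
    comparison applies to this set.\<close>
  have "in_model W {x \<in> ext W F. \<exists>y. W (opair W x y) g \<and> srel W B.N n k \<phi> w y}"
    by (rule W.sep1) (intro WW.def_intros WW.Def_lift2[OF D] WW.FDef_const)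
  then obtain s where "ext W s = {x \<in> ext W F. \<exists>y. W (opair W x y) g \<and> srel W B.N n k \<phi> w y}"
    by (auto simp: in_model_def)
  then have s: "ext W s = {x \<in> ext W F. srel W B.N n k \<phi> w (f x)}" using fg by auto
  have "in_model W {y \<in> ext W F'. \<exists>x\<in>ext W s. W (opair W x y) g}"
    by (rule W.sep1) (intro WW.def_intros WW.FDef_const)
  also have "{y \<in> ext W F'. \<exists>x\<in>ext W s. W (opair W x y) g} = f ` ext W s" using fg f s by auto
  finally have "in_model W (f ` ext W s)" .
  moreover have "B.realW n k \<phi> (f ` ext W s)" unfolding B.realW_def using w(1) s by auto
  ultimately have "A.realW n k \<phi> (ext W s)" using real[of s] s by auto
  moreover have "X \<subseteq> ext W s" using s w(2) F(3) by auto
  ultimately have "A.realW n k \<phi> X" unfolding A.realW_def by blast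
  then show False using X(4) by blast
qed

end

lemma least_cardinal_holds: "least_cardinal P = Cardinal c \<Longrightarrow> P c"
  by (auto simp: least_cardinal_def split: if_splits intro: LeastI)

lemma least_cardinal_le: "P c \<Longrightarrow> least_cardinal P \<le> Cardinal c"
  by (auto simp: least_cardinal_def intro: Least_le)

context ext_model begin

lemma lambda_theory_le_formula:
  assumes T: "complete_theory_in V L T" and \<phi>: "\<phi> \<in> partitioned_formulas L n k"
  shows "lambda_theory V W j L T \<le> lambda_formula V W j L T n k \<phi>"
proof (cases "lambda_formula V W j L T n k \<phi>")
  case (Cardinal c)
  define M0 where "M0 = (SOME M. is_model V L T M)"
  have M0: "is_model V L T M0" unfolding M0_def by (rule someI_ex) (use T in \<open>simp add: complete_theory_in_def\<close>)
  interpret A: struct_emb V W j L M0 using M0 by unfold_locales (simp add: is_model_def)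
  have "lambda_pattern W j (power_elem V M0 k) (delta_elem V M0 n k \<phi>) = Cardinal c"
    using Cardinal by (simp add: lambda_formula_def Let_def M0_def)
  then obtain X where X: "A.bad n k \<phi> X" "cardinality X \<le> c"
    unfolding A.lambda_pattern_delta[OF \<phi>] by (auto dest!: least_cardinal_holds)
  have "\<not> pseudosaturates V W j (cardSuc |X| ) L T"
  proof
    assume "pseudosaturates V W j (cardSuc |X| ) L T"
    then obtain M1 where m1: "is_model V L T M1" "pseudosaturated W (cardSuc |X| ) L (j_std W j M1)"
      by (auto simp: pseudosaturates_def)
    interpret two_models V W j L T M0 M1 using T M0 m1(1) by unfold_locales
    show False using bad_not_pseudosaturated[OF \<phi> X(1)] m1(2) by blast
  qed
  then have "lambda_theory V W j L T \<le> Cardinal (cardinality X)"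
    unfolding lambda_theory_def using A.bad_infinite[OF X(1)] by (intro least_cardinal_le) blast
  also have "\<dots> \<le> Cardinal c" using X(2) by simp
  finally show ?thesis using Cardinal by simp
qed simp

lemma lambda_loc_n_witness:
  "\<exists>m k \<phi>. m \<le> n \<and> \<phi> \<in> partitioned_formulas L m k \<and> lambda_loc_n V W j L T n = lambda_formula V W j L T m k \<phi>"
proof -
  \<comment> \<open>Variable 0 counts as a parameter here, there being no type variables; the
    minimum thus ranges over a nonempty set even for \<open>n = 0\<close>.\<close>
  have "Equal (Var 0) (Var 0) \<in> partitioned_formulas L 0 1" by (simp add: partitioned_formulas_def formulas_def)
  then have "\<exists>c m k. m \<le> n \<and> (\<exists>\<phi>\<in>partitioned_formulas L m k. c = lambda_formula V W j L T m k \<phi>)" by blast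
  from LeastI_ex[OF this] show ?thesis unfolding lambda_loc_n_def by blast
qed

lemma lambda_loc_witness: "\<exists>n. lambda_loc V W j L T = lambda_loc_n V W j L T n"
  unfolding lambda_loc_def by (rule LeastI_ex) blast

theorem lambda_theory_le_loc:
  assumes "complete_theory_in V L T"
  shows "lambda_theory V W j L T \<le> lambda_loc V W j L T"
proof -
  obtain n where n: "lambda_loc V W j L T = lambda_loc_n V W j L T n" using lambda_loc_witness by blast
  obtain m k \<phi> where "\<phi> \<in> partitioned_formulas L m k" "lambda_loc_n V W j L T n = lambda_formula V W j L T m k \<phi>"
    using lambda_loc_n_witness[of n L T] by blast
  then show ?thesis unfolding n using lambda_theory_le_formula[OF assms] by simp
qed

end

section \<open>Types in one variable suffice\<close>

text \<open>Makes room for \<open>l\<close> parameters between the \<open>n\<close> variables of a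
  type and the old parameters. Formulas with different parameter lists are conjoined over the
  concatenated list in this way.\<close>

definition shift :: "nat \<Rightarrow> nat \<Rightarrow> nat \<Rightarrow> nat" where
  "shift n l x = (if x < n then x else x + l)"

lemma sat_append:
  "fv \<phi> \<subseteq> {..<length b + length as} \<Longrightarrow> sat M ((!) (b @ as @ cs)) \<phi> = sat M ((!) (b @ as)) \<phi>"
  by (rule sat_cong) (auto simp: nth_append)

lemma sat_shift:
  "sat M ((!) (b @ as @ cs)) (ren \<phi> (shift (length b) (length as))) = sat M ((!) (b @ cs)) \<phi>"
  unfolding sat_ren by (rule sat_cong) (auto simp: nth_append shift_def)

lemma fv_shift: "fv \<phi> \<subseteq> {..<n + k} \<Longrightarrow> fv (ren \<phi> (shift n l)) \<subseteq> {..<n + (l + k)}"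
  using fv_ren[of \<phi> "shift n l"] by (fastforce simp: shift_def split: if_splits)

lemma in_complete_type:
  assumes p: "complete_type L M A n p" and \<phi>: "(\<phi>, as) \<in> param_formulas L A n" and q: "q \<subseteq> p" "finite q"
    and imp: "\<And>b. b \<in> tuples (univ M) n \<Longrightarrow> satisfies_all M b q \<Longrightarrow> sat M ((!) (b @ as)) \<phi>"
  shows "(\<phi>, as) \<in> p"
proof (rule ccontr)
  assume "(\<phi>, as) \<notin> p"
  then have "insert (Neg \<phi>, as) q \<subseteq> p" using p \<phi> q(1) by (auto simp: complete_type_def)
  moreover have "finite (insert (Neg \<phi>, as) q)" using q(2) by simp
  ultimately obtain b where "b \<in> tuples (univ M) n" "satisfies_all M b (insert (Neg \<phi>, as) q)"
    using p unfolding complete_type_def by meson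
  then show False using imp[of b] by (auto simp: satisfies_all_def)
qed

lemma in_param: "complete_type L M A n p \<Longrightarrow> (\<phi>, as) \<in> p \<Longrightarrow> (\<phi>, as) \<in> param_formulas L A n"
  by (auto simp: complete_type_def)

lemma type_conj:
  assumes p: "complete_type L M A n p" and q: "finite q" "q \<subseteq> p"
  shows "\<exists>\<theta> cs. (\<theta>, cs) \<in> p \<and> (\<forall>b\<in>tuples (univ M) n. sat M ((!) (b @ cs)) \<theta> \<longrightarrow> satisfies_all M b q)"
  using q
proof (induct q rule: finite_induct)
  case empty
  have "(All 0 (Equal (Var 0) (Var 0)), []) \<in> p"
    by (rule in_complete_type[OF p, of _ _ "{}"]) (auto simp: param_formulas_def formulas_def)
  then show ?case by (auto simp: satisfies_all_def)
next
  case (insert x q)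
  then obtain \<theta> cs where \<theta>: "(\<theta>, cs) \<in> p"
    "\<And>b. b \<in> tuples (univ M) n \<Longrightarrow> sat M ((!) (b @ cs)) \<theta> \<Longrightarrow> satisfies_all M b q" by auto
  obtain \<phi> as where x: "x = (\<phi>, as)" by (cases x)
  have \<phi>: "(\<phi>, as) \<in> p" using insert.prems x by simp
  note 1 = in_param[OF p \<theta>(1)] in_param[OF p \<phi>]
  have sat: "sat M ((!) (b @ as @ cs)) (And \<phi> (ren \<theta> (shift n (length as)))) \<longleftrightarrow>
    sat M ((!) (b @ as)) \<phi> \<and> sat M ((!) (b @ cs)) \<theta>" if "b \<in> tuples (univ M) n" for b
    using that sat_append[of \<phi> b as M cs] sat_shift[of M b as cs \<theta>] 1(2)
    by (auto simp: tuples_def param_formulas_def)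
  have "(And \<phi> (ren \<theta> (shift n (length as))), as @ cs) \<in> p"
  proof (rule in_complete_type[OF p, of _ _ "{(\<phi>, as), (\<theta>, cs)}"])
    show "(And \<phi> (ren \<theta> (shift n (length as))), as @ cs) \<in> param_formulas L A n"
      using 1 fv_shift[of \<theta> n "length cs" "length as"] by (auto simp: param_formulas_def)
  qed (use \<phi> \<theta>(1) sat in \<open>auto simp: satisfies_all_def\<close>)
  then show ?case using sat \<theta>(2) x
    by (intro exI[of _ "And \<phi> (ren \<theta> (shift n (length as)))"] exI[of _ "as @ cs"])
      (auto simp: satisfies_all_def)
qed

lemma case_nat_nth: "case_nat x ((!) l) = (!) (x # l)"
  by (auto split: nat.splits)

text \<open>The type of the last \<open>n\<close> coordinates is realized by induction; with this
  tuple as new parameters, the remaining condition on the first coordinate is a 1-type.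
  \<open>P\<close> stands for a smallness condition on parameter sets that survives adding one
  element.\<close>

lemma realize_types_by_1types:
  assumes one: "\<And>A p. A \<subseteq> univ M \<Longrightarrow> P A \<Longrightarrow> complete_type L M A 1 p \<Longrightarrow> \<exists>b\<in>tuples (univ M) 1. satisfies_all M b p"
    and ins: "\<And>A x. P A \<Longrightarrow> x \<in> univ M \<Longrightarrow> P (insert x A)"
    and A: "A \<subseteq> univ M" "P A" and p: "complete_type L M A n p"
  shows "\<exists>b\<in>tuples (univ M) n. satisfies_all M b p"
  using p
proof (induct n arbitrary: p)
  case 0
  have "satisfies_all M [] {x}" if "x \<in> p" for x
  proof -
    have "{x} \<subseteq> p" "finite {x}" using that by auto
    then obtain b where "b \<in> tuples (univ M) 0" "satisfies_all M b {x}" using 0 unfolding complete_type_def by meson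
    then show ?thesis by simp
  qed
  then show ?case by (auto simp: satisfies_all_def)
next
  case (Suc n)
  note p = Suc(2)
  define p' where "p' = {(\<psi>, as) \<in> param_formulas L A n. (ren \<psi> Suc, as) \<in> p}"
  have sSuc: "sat M ((!) ((x # b) @ as)) (ren \<psi> Suc) = sat M ((!) (b @ as)) \<psi>" for x b as \<psi>
    unfolding sat_ren by (rule sat_cong) simp
  have renp: "(ren \<psi> Suc, as) \<in> param_formulas L A (Suc n)" if "(\<psi>, as) \<in> param_formulas L A n" for \<psi> as
    using that fv_ren[of \<psi> Suc] by (auto simp: param_formulas_def)
  have "complete_type L M A n p'"
    unfolding complete_type_def
  proof (intro conjI allI impI)
    show "p' \<subseteq> param_formulas L A n" by (auto simp: p'_def)
    fix q assume q: "q \<subseteq> p'" "finite q"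
    let ?q = "(\<lambda>(\<psi>, as). (ren \<psi> Suc, as)) ` q"
    have "?q \<subseteq> p" "finite ?q" using q by (auto simp: p'_def)
    then obtain b where b: "b \<in> tuples (univ M) (Suc n)" "satisfies_all M b ?q" using p unfolding complete_type_def by meson
    then obtain x b' where xb: "b = x # b'" "b' \<in> tuples (univ M) n" by (auto simp: tuples_Suc)
    have "satisfies_all M b' q" using b(2) unfolding satisfies_all_def xb(1) by (fastforce simp: sSuc[simplified])
    then show "\<exists>b\<in>tuples (univ M) n. satisfies_all M b q" using xb(2) by blast
  next
    show "\<forall>(\<phi>, as)\<in>param_formulas L A n. (\<phi>, as) \<in> p' \<or> (Neg \<phi>, as) \<in> p'"
    proof safe
      fix \<phi> as assume *: "(\<phi>, as) \<in> param_formulas L A n" "(Neg \<phi>, as) \<notin> p'"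
      then have "(Neg (ren \<phi> Suc), as) \<notin> p" by (auto simp: p'_def param_formulas_def)
      then have "(ren \<phi> Suc, as) \<in> p" using p renp[OF *(1)] by (auto simp: complete_type_def)
      then show "(\<phi>, as) \<in> p'" using *(1) by (auto simp: p'_def)
    qed
  qed
  then obtain b' where b': "b' \<in> tuples (univ M) n" "satisfies_all M b' p'" using Suc(1) by blast
  define A' where "A' = A \<union> set b'"
  have bset: "set b' \<subseteq> univ M" "length b' = n" using b'(1) by (auto simp: tuples_def)
  have "P (A \<union> set l)" if "set l \<subseteq> univ M" for l using that by (induct l) (auto simp: A(2) ins)
  then have A': "A' \<subseteq> univ M" "P A'" using A(1) bset(1) by (auto simp: A'_def)
  let ?p1 = "(\<lambda>(\<phi>, as). (\<phi>, b' @ as)) ` p"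
  have p1: "?p1 \<subseteq> param_formulas L A' 1"
  proof
    fix y assume "y \<in> ?p1"
    then obtain \<phi> as where y: "y = (\<phi>, b' @ as)" "(\<phi>, as) \<in> p" by auto
    then show "y \<in> param_formulas L A' 1" using in_param[OF p y(2)] bset by (auto simp: param_formulas_def A'_def)
  qed
  have "\<exists>b\<in>tuples (univ M) 1. satisfies_all M b q" if q: "q \<subseteq> ?p1" "finite q" for q
  proof -
    from finite_subset_image[OF q(2,1)] obtain q0 where q0: "q0 \<subseteq> p" "finite q0" "q = (\<lambda>(\<phi>, as). (\<phi>, b' @ as)) ` q0" by blast
    obtain \<theta> cs where \<theta>: "(\<theta>, cs) \<in> p" "\<forall>b\<in>tuples (univ M) (Suc n). sat M ((!) (b @ cs)) \<theta> \<longrightarrow> satisfies_all M b q0"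
      using type_conj[OF p q0(2,1)] by blast
    \<comment> \<open>Finitely many formulas of \<open>p\<close> are implied by a single
      \<open>\<theta>\<close> in \<open>p\<close>. The existential statement over its first variable
      then belongs to \<open>p'\<close>, so it is true of \<open>b'\<close>.\<close>
    let ?\<chi> = "Neg (all0 (Neg \<theta>))"
    have sat\<chi>: "sat M ((!) (b @ cs)) ?\<chi> \<longleftrightarrow> (\<exists>x\<in>univ M. sat M ((!) ((x # b) @ cs)) \<theta>)" for b
      by (simp add: sat_all0 case_nat_nth)
    have \<chi>: "(?\<chi>, cs) \<in> param_formulas L A n"
      using in_param[OF p \<theta>(1)] fv_all0[of "Neg \<theta>"] by (auto simp: param_formulas_def)
    have "(ren ?\<chi> Suc, cs) \<in> p"
    proof (rule in_complete_type[OF p renp[OF \<chi>], of "{(\<theta>, cs)}"])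
      fix b assume b: "b \<in> tuples (univ M) (Suc n)" "satisfies_all M b {(\<theta>, cs)}"
      then obtain x b0 where xb: "b = x # b0" "x \<in> univ M" by (auto simp: tuples_Suc)
      show "sat M ((!) (b @ cs)) (ren ?\<chi> Suc)"
        unfolding xb(1) sSuc sat\<chi> using b(2) xb by (auto simp: satisfies_all_def)
    qed (use \<theta>(1) in auto)
    then have "(?\<chi>, cs) \<in> p'" using \<chi> by (simp add: p'_def)
    then have "sat M ((!) (b' @ cs)) ?\<chi>" using b'(2) by (auto simp: satisfies_all_def)
    then obtain x where x: "x \<in> univ M" "sat M ((!) ((x # b') @ cs)) \<theta>" unfolding sat\<chi> by blast
    have "x # b' \<in> tuples (univ M) (Suc n)" using x(1) bset by (simp add: tuples_def)
    then have "satisfies_all M (x # b') q0" using \<theta>(2) x(2) by blast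
    then have "satisfies_all M [x] q" by (auto simp: satisfies_all_def q0(3))
    then show ?thesis using x(1) by (intro bexI[of _ "[x]"]) (auto simp: tuples_def)
  qed
  from extend_to_complete_type[OF p1 this]
  obtain p2 where p2: "complete_type L M A' 1 p2" "?p1 \<subseteq> p2" by blast
  obtain b where b: "b \<in> tuples (univ M) 1" "satisfies_all M b p2" using one[OF A' p2(1)] by blast
  then obtain x where x: "b = [x]" "x \<in> univ M" by (auto simp: tuples_def length_Suc_conv)
  have "satisfies_all M (x # b') p" unfolding satisfies_all_def
  proof safe
    fix \<phi> as assume "(\<phi>, as) \<in> p"
    then have "(\<phi>, b' @ as) \<in> p2" using p2(2) by auto
    then show "sat M ((!) ((x # b') @ as)) \<phi>" using b(2) x(1) by (auto simp: satisfies_all_def)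
  qed
  then show ?case using x(2) bset by (intro bexI[of _ "x # b'"]) (auto simp: tuples_def)
qed

lemma card_of_tuples:
  assumes "infinite lam" "|A| \<le>o |lam|" shows "|tuples A k| \<le>o |lam|"
proof (induct k)
  case 0
  show ?case by (rule finite_ordLeq_infinite[OF _ assms(1)]) simp
next
  case (Suc k)
  have "|\<Union>a\<in>A. (#) a ` tuples A k| \<le>o |lam|"
    by (rule card_of_UNION_ordLeq_infinite[OF assms]) (use ordLeq_transitive[OF card_of_image Suc] in blast)
  moreover have "(\<Union>a\<in>A. (#) a ` tuples A k) = tuples A (Suc k)" by (auto simp: tuples_Suc)
  ultimately show ?case by simp
qed

section \<open>Realizing types in one variable\<close>

context struct_emb begin

lemma tuples_1: "tuples D 1 = (\<lambda>b. [b]) ` D"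
  by (auto simp: tuples_def length_Suc_conv)

lemma realW_1: "realW 1 k \<phi> Z \<longleftrightarrow> (\<exists>b\<in>DW. \<forall>z\<in>Z. srel W N 1 k \<phi> (seq W [b]) z)"
  unfolding realW_def tuples_1 by blast

section \<open>Minimal inconsistent sets of instances\<close>

definition minV :: "nat \<Rightarrow> nat \<Rightarrow> fm \<Rightarrow> 'v \<Rightarrow> bool" where
  "minV n k \<phi> F \<longleftrightarrow> believes_finite V F \<and> ext V F \<subseteq> ext V (power_elem V M k) \<and> \<not> realV n k \<phi> (ext V F) \<and>
     (\<forall>G. ext V G \<subseteq> ext V F \<and> G \<noteq> F \<longrightarrow> realV n k \<phi> (ext V G))"

definition minW :: "nat \<Rightarrow> nat \<Rightarrow> fm \<Rightarrow> 'w \<Rightarrow> bool" where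
  "minW n k \<phi> F \<longleftrightarrow> believes_finite W F \<and> ext W F \<subseteq> ext W (j (power_elem V M k)) \<and> \<not> realW n k \<phi> (ext W F) \<and>
     (\<forall>G. ext W G \<subseteq> ext W F \<and> G \<noteq> F \<longrightarrow> realW n k \<phi> (ext W G))"

lemma Def_min:
  assumes \<phi>: "\<phi> \<in> partitioned_formulas L n k" and f: "FDef t u"
  shows "Def (\<lambda>e. minV n k \<phi> (t e)) (\<lambda>e. minW n k \<phi> (u e))"
  by (rule Def_lift1[OF _ f]) (unfold minV_def minW_def, intro def_intros Def_real[OF \<phi>] FDef_const)

lemma ex_minW:
  assumes \<phi>: "\<phi> \<in> partitioned_formulas L n k"
    and F: "believes_finite W F" "ext W F \<subseteq> ext W (j (power_elem V M k))" "\<not> realW n k \<phi> (ext W F)"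
  shows "\<exists>G. ext W G \<subseteq> ext W F \<and> minW n k \<phi> G"
proof -
  have "\<exists>G. ext V G \<subseteq> ext V F \<and> minV n k \<phi> G"
    if F: "believes_finite V F" "ext V F \<subseteq> ext V (power_elem V M k)" "\<not> realV n k \<phi> (ext V F)" for F
  proof -
    let ?S = "{s. s \<subseteq> ext V F \<and> \<not> realV n k \<phi> s}"
    have fin: "finite (ext V F)" using F(1) by (simp add: V.believes_finite_finite)
    have "finite ?S" by (rule finite_subset[of _ "Pow (ext V F)"]) (use fin in auto)
    moreover have "ext V F \<in> ?S" using F(3) by simp
    ultimately have "\<exists>s\<in>?S. s \<le> ext V F \<and> (\<forall>t\<in>?S. t \<le> s \<longrightarrow> s = t)" by (rule finite_has_minimal2)
    then obtain s where s0: "s \<in> ?S" "s \<le> ext V F \<and> (\<forall>t\<in>?S. t \<le> s \<longrightarrow> s = t)" ..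
    have s: "s \<in> ?S" "\<And>t. t \<in> ?S \<Longrightarrow> t \<subseteq> s \<Longrightarrow> s = t"
      using s0(1) s0(2)[THEN conjunct2, rule_format] by simp_all
    then have "finite s" using fin finite_subset by blast
    then obtain G where G: "ext V G = s" using V.in_model_finite unfolding in_model_def by blast
    have "realV n k \<phi> (ext V G')" if "ext V G' \<subseteq> ext V G" "G' \<noteq> G" for G'
    proof (rule ccontr)
      assume "\<not> ?thesis"
      then have "ext V G' \<in> ?S" using that(1) s(1) G by blast
      then have "ext V G = ext V G'" using s(2) that(1) G by blast
      then show False using that(2) by simp
    qed
    then have "minV n k \<phi> G" unfolding minV_def
      using G s(1) F(2) \<open>finite s\<close> by (auto simp: V.believes_finite_finite)
    then show ?thesis using G s(1) by blast
  qed
  then have "\<forall>F. believes_finite V F \<and> ext V F \<subseteq> ext V (power_elem V M k) \<and> \<not> realV n k \<phi> (ext V F) \<longrightarrow>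
    (\<exists>G. ext V G \<subseteq> ext V F \<and> minV n k \<phi> G)" by blast
  also have "?this \<longleftrightarrow> (\<forall>F. believes_finite W F \<and> ext W F \<subseteq> ext W (j (power_elem V M k)) \<and> \<not> realW n k \<phi> (ext W F) \<longrightarrow>
    (\<exists>G. ext W G \<subseteq> ext W F \<and> minW n k \<phi> G))"
    by (rule Def_closed) (intro def_intros Def_real[OF \<phi>] Def_min[OF \<phi>] FDef_const)
  finally show ?thesis using F by blast
qed

lemma finite_ext_j: "finite (ext V a) \<Longrightarrow> ext W (j a) = j ` ext V a"
proof -
  have "\<exists>a. ext V a = S \<and> ext W (j a) = j ` S" if "finite S" for S
    using that
  proof (induct S rule: finite_induct)
    case empty
    have "j (elem V {}) = elem W {}" using FDef_transfer[OF FDef_empty] by simp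
    then show ?case by (intro exI[of _ "elem V {}"]) simp
  next
    case (insert x S)
    then obtain a where a: "ext V a = S" "ext W (j a) = j ` S" by blast
    have "j (elem V (insert x (ext V a))) = elem W (insert (j x) (ext W (j a)))"
      using FDef_transfer[OF FDef_insert[OF FDef_const FDef_const]] by simp
    then have "ext W (j (elem V (insert x (ext V a)))) = j ` insert x S" using a(2) W.ext_insert by (metis image_insert)
    moreover have "ext V (elem V (insert x (ext V a))) = insert x S" using a(1) V.ext_insert by metis
    ultimately show ?case by (intro exI conjI)
  qed
  note ex = this
  assume "finite (ext V a)"
  then obtain b where "ext V b = ext V a" "ext W (j b) = j ` ext V a" using ex by blast
  then show ?thesis by simp
qed

text \<open>Elementarity downwards: since such a set exists in \<open>W\<close>, one exists in
  \<open>V\<close>, where it is truly finite, and \<open>j\<close> adds no elements to a finite set.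
  This provides the finite approximations for saturation.\<close>

lemma reflect_minW:
  assumes \<phi>: "\<phi> \<in> partitioned_formulas L n k" and F: "minW n k \<phi> F" "at_least m (ext W F)"
  shows "\<exists>G. minW n k \<phi> G \<and> at_least m (ext W G) \<and> finite (ext W G)"
proof -
  have D: "Def (\<lambda>e. at_least m {x. V x (e 0)}) (\<lambda>e. at_least m {x. W x (e 0)})"
    by (rule Def_at_least) (intro def_intros)
  have "(\<exists>F. minV n k \<phi> F \<and> at_least m {x. V x F}) \<longleftrightarrow> (\<exists>F. minW n k \<phi> F \<and> at_least m {x. W x F})"
    by (rule Def_closed) (intro def_intros Def_min[OF \<phi>] D)
  then obtain G where G: "minV n k \<phi> G" "at_least m {x. V x G}" using F by (auto simp: ext_def)
  have fin: "finite (ext V G)" using G(1) by (simp add: minV_def V.believes_finite_finite)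
  have "minV n k \<phi> G \<longleftrightarrow> minW n k \<phi> (j G)"
    by (rule Def_closed) (intro Def_min[OF \<phi>] FDef_const)
  moreover have "at_least m {x. V x G} \<longleftrightarrow> at_least m {x. W x (j G)}"
    by (rule Def_closed) (rule Def_lift1[where P = "\<lambda>a. at_least m {x. V x a}" and Q = "\<lambda>a. at_least m {x. W x a}", OF D FDef_const])
  ultimately show ?thesis using G finite_ext_j[OF fin] fin by (intro exI[of _ "j G"]) (auto simp: ext_def[symmetric])
qed

end

locale one_type = struct_emb V W j L M for V :: "'v \<Rightarrow> 'v \<Rightarrow> bool" and W :: "'w \<Rightarrow> 'w \<Rightarrow> bool" and j L M +
  fixes A :: "'w set" and p :: "(fm \<times> 'w list) set" and lam :: "'w set"
  assumes inf: "infinite lam"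
    and sat: "saturated (cardSuc natLeq) set_lang (set_struct W)"
    and NS_ne: "NS \<noteq> {}"
    and A: "A \<subseteq> DW" "pseudofinite W A" "|A| \<le>o |lam|"
    and p: "complete_type L N A 1 p"
    and good: "\<phi> \<in> partitioned_formulas L 1 k \<Longrightarrow> |Z| \<le>o |lam| \<Longrightarrow> \<not> bad 1 k \<phi> Z"
begin

lemma good_real:
  assumes "\<phi> \<in> partitioned_formulas L 1 k" "pseudofinite W Z" "Z \<subseteq> seq W ` tuples DW k" "|Z| \<le>o |lam|"
    "\<And>s. s \<subseteq> Z \<Longrightarrow> finite s \<Longrightarrow> realW 1 k \<phi> s"
  shows "realW 1 k \<phi> Z"
  using good[OF assms(1,4)] assms(2,3,5) unfolding bad_def by blast

text \<open>The instances in the type may be uncountable in number, but their shapes, a formula with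
  a number of parameters, are countable. The chain runs through shapes; the parameters vary within
  each.\<close>

definition Idx :: "(fm \<times> nat) set" where
  "Idx = {(\<phi>, k). \<exists>as. length as = k \<and> (\<phi>, as) \<in> p}"

definition chi :: "nat \<Rightarrow> fm" where "chi i = fst (from_nat_into Idx i)"
definition kk :: "nat \<Rightarrow> nat" where "kk i = snd (from_nat_into Idx i)"
text \<open>Padding material: appending \<open>c (Suc i)\<close> to an instance of
  \<open>psi i\<close> in the type yields an instance of \<open>psi (Suc i)\<close> that is still in
  the type.\<close>

definition c :: "nat \<Rightarrow> 'w list" where "c i = (SOME as. length as = kk i \<and> (chi i, as) \<in> p)"

primrec K :: "nat \<Rightarrow> nat" where
  "K 0 = kk 0"
| "K (Suc i) = K i + kk (Suc i)"

primrec psi :: "nat \<Rightarrow> fm" where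
  "psi 0 = chi 0"
| "psi (Suc i) = And (psi i) (ren (chi (Suc i)) (shift 1 (K i)))"

lemma c: "length (c i) = kk i" "(chi i, c i) \<in> p"
proof -
  have "(All 0 (Equal (Var 0) (Var 0)), []) \<in> p"
    by (rule in_complete_type[OF p, of _ _ "{}"]) (auto simp: param_formulas_def formulas_def)
  then have "Idx \<noteq> {}" by (auto simp: Idx_def)
  then have "(chi i, kk i) \<in> Idx" using from_nat_into[of Idx i] by (simp add: chi_def kk_def)
  then have "\<exists>as. length as = kk i \<and> (chi i, as) \<in> p" by (simp add: Idx_def)
  from someI_ex[OF this] show "length (c i) = kk i" "(chi i, c i) \<in> p" by (simp_all add: c_def)
qed

lemma Idx_surj: assumes "(\<phi>, as) \<in> p" shows "\<exists>i. chi i = \<phi> \<and> kk i = length as"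
proof -
  have "(\<phi>, length as) \<in> Idx" using assms by (auto simp: Idx_def)
  then obtain i where "from_nat_into Idx i = (\<phi>, length as)" using from_nat_into_surj[of Idx] by auto
  then show ?thesis by (intro exI[of _ i]) (simp add: chi_def kk_def)
qed

lemma chi_pf: "chi i \<in> partitioned_formulas L 1 (kk i)"
  using in_param[OF p c(2)[of i]] c(1)[of i] by (simp add: param_formulas_def partitioned_formulas_def)

lemma psi_pf: "psi i \<in> partitioned_formulas L 1 (K i)"
proof (induct i)
  case (Suc i)
  then show ?case using chi_pf[of "Suc i"] fv_shift[of "chi (Suc i)" 1 "kk (Suc i)" "K i"]
    by (auto simp: partitioned_formulas_def)
qed (use chi_pf[of 0] in simp)

lemma c_tuples: "c i \<in> tuples A (kk i)"
  using in_param[OF p c(2)[of i]] c(1)[of i] by (auto simp: param_formulas_def tuples_def)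

lemma sat_psi_Suc:
  assumes "length as = K i"
  shows "sat S ((!) ([b] @ as @ bs)) (psi (Suc i)) \<longleftrightarrow> sat S ((!) ([b] @ as)) (psi i) \<and> sat S ((!) ([b] @ bs)) (chi (Suc i))"
  using sat_append[of "psi i" "[b]" as S bs] sat_shift[of S "[b]" as bs "chi (Suc i)"] psi_pf[of i] assms
  by (auto simp: partitioned_formulas_def simp del: append_Cons)

lemma psi_p:
  assumes "(psi i, as) \<in> p" "length as = K i" "(chi (Suc i), bs) \<in> p" "length bs = kk (Suc i)"
  shows "(psi (Suc i), as @ bs) \<in> p"
proof (rule in_complete_type[OF p, of _ _ "{(psi i, as), (chi (Suc i), bs)}"])
  show "(psi (Suc i), as @ bs) \<in> param_formulas L A 1"
    using psi_pf[of "Suc i"] in_param[OF p assms(1)] in_param[OF p assms(3)] assms(2,4)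
    by (auto simp: param_formulas_def partitioned_formulas_def)
  fix b assume b: "b \<in> tuples (univ N) 1" "satisfies_all N b {(psi i, as), (chi (Suc i), bs)}"
  then obtain x where x: "b = [x]" by (auto simp: tuples_def length_Suc_conv)
  show "sat N ((!) (b @ as @ bs)) (psi (Suc i))"
    unfolding x sat_psi_Suc[OF assms(2)] using b(2) by (simp add: satisfies_all_def x)
qed (use assms in auto)

text \<open>An instance of \<open>chi (Suc i)\<close> enters the chain only as the last conjunct of
  an instance of \<open>psi (Suc i)\<close>; this supplies parameters for the preceding
  conjuncts.\<close>

lemma ex_prefix: "\<exists>w. length w = K i \<and> (psi i, w) \<in> p"
proof (induct i)
  case 0
  then show ?case using c[of 0] by auto
next
  case (Suc i)
  then obtain w where "length w = K i" "(psi i, w) \<in> p" by blast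
  then show ?case using psi_p[of i w "c (Suc i)"] c[of "Suc i"] by (intro exI[of _ "w @ c (Suc i)"]) simp
qed

definition R :: "nat \<Rightarrow> 'w \<Rightarrow> 'w \<Rightarrow> bool" where
  "R i b z \<longleftrightarrow> srel W N 1 (K i) (psi i) (seq W [b]) z"

lemma R_seq: "b \<in> DW \<Longrightarrow> as \<in> tuples DW (K i) \<Longrightarrow> R i b (seq W as) \<longleftrightarrow> sat N ((!) ([b] @ as)) (psi i)"
  unfolding R_def by (rule srel_N) (auto simp: tuples_def)

lemma R_real: "(\<exists>b\<in>DW. \<forall>z\<in>Z. R i b z) \<longleftrightarrow> realW 1 (K i) (psi i) Z"
  unfolding realW_1 R_def ..

lemma R_min: "believes_finite W F \<and> ext W F \<subseteq> ext W (j (power_elem V M (K i))) \<and>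
    \<not> realW 1 (K i) (psi i) (ext W F) \<and> (\<forall>G. ext W G \<subseteq> ext W F \<and> G \<noteq> F \<longrightarrow> realW 1 (K i) (psi i) (ext W G)) \<longleftrightarrow>
    minW 1 (K i) (psi i) F"
  unfolding minW_def ..

lemma A_tuples: "tuples A k \<subseteq> tuples DW k"
  using A(1) by (auto simp: tuples_def)

definition X :: "nat \<Rightarrow> 'w set" where
  "X i = seq W ` {as \<in> tuples A (K i). (psi i, as) \<in> p}"

definition Ahat :: 'w where
  "Ahat = (SOME B. believes_finite W B \<and> ext W B \<subseteq> DW \<and> A \<subseteq> ext W B)"

lemma Ahat: "believes_finite W Ahat" "ext W Ahat \<subseteq> DW" "A \<subseteq> ext W Ahat"
  using someI_ex[OF pseudofinite_in[OF A(2,1)]] by (simp_all add: Ahat_def)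

definition Y :: "nat \<Rightarrow> 'w" where
  "Y i = (SOME C. believes_finite W C \<and> ext W C = seq W ` tuples (ext W Ahat) (K i))"

lemma Y: "believes_finite W (Y i)" "ext W (Y i) = seq W ` tuples (ext W Ahat) (K i)"
  using someI_ex[OF bf_tuples[OF Ahat(1), of "K i"]] by (simp_all add: Y_def)

text \<open>Satisfying \<open>psi i\<close> at \<open>u\<close> and refuting it at \<open>v\<close>
  is one instance of a single formula in the same variable, with the two tuples concatenated, so
  \<open>good\<close> covers it.\<close>

lemma local_difference:
  assumes F: "believes_finite W F" "ext W F \<subseteq> seq W ` tuples DW (K i)" and P: "P \<subseteq> ext W F \<times> ext W F" "|P| \<le>o |lam|"
    and fin: "\<And>s. s \<subseteq> P \<Longrightarrow> finite s \<Longrightarrow> \<exists>b\<in>DW. \<forall>(u, v)\<in>s. R i b u \<and> \<not> R i b v"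
  shows "\<exists>b\<in>DW. \<forall>(u, v)\<in>P. R i b u \<and> \<not> R i b v"
proof -
  let ?\<phi> = "And (psi i) (Neg (ren (psi i) (shift 1 (K i))))"
  have \<phi>: "?\<phi> \<in> partitioned_formulas L 1 (K i + K i)"
    using psi_pf[of i] fv_shift[of "psi i" 1 "K i" "K i"] by (auto simp: partitioned_formulas_def)
  obtain B where B: "believes_finite W B" "ext W B \<subseteq> DW" "ext W F \<subseteq> seq W ` tuples (ext W B) (K i)"
    using bf_coordinates[OF F] by blast
  have "\<forall>z\<in>ext W F. \<exists>as. as \<in> tuples (ext W B) (K i) \<and> z = seq W as" using B(3) by blast
  from bchoice[OF this] obtain a where a: "\<forall>z\<in>ext W F. a z \<in> tuples (ext W B) (K i) \<and> z = seq W (a z)" ..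
  have aD: "a z \<in> tuples DW (K i)" "z = seq W (a z)" "length (a z) = K i" if "z \<in> ext W F" for z
    using a that B(2) by (auto simp: tuples_def)
  define h where "h = (\<lambda>(u, v). seq W (a u @ a v))"
  have rel: "srel W N 1 (K i + K i) ?\<phi> (seq W [b]) (h (u, v)) \<longleftrightarrow> R i b u \<and> \<not> R i b v"
    if b: "b \<in> DW" and uv: "u \<in> ext W F" "v \<in> ext W F" for b u v
  proof -
    have "srel W N 1 (K i + K i) ?\<phi> (seq W [b]) (h (u, v)) \<longleftrightarrow> sat N ((!) ([b] @ a u @ a v)) ?\<phi>"
      unfolding h_def prod.case by (rule srel_N) (use b aD(1)[OF uv(1)] aD(1)[OF uv(2)] in \<open>auto simp: tuples_def\<close>)
    also have "\<dots> \<longleftrightarrow> sat N ((!) ([b] @ a u)) (psi i) \<and> \<not> sat N ((!) ([b] @ a v)) (psi i)"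
      using sat_append[of "psi i" "[b]" "a u" N "a v"] sat_shift[of N "[b]" "a u" "a v" "psi i"] psi_pf[of i] aD(3)[OF uv(1)]
      by (auto simp: partitioned_formulas_def simp del: append_Cons)
    also have "\<dots> \<longleftrightarrow> R i b (seq W (a u)) \<and> \<not> R i b (seq W (a v))"
      using R_seq[OF b aD(1)[OF uv(1)]] R_seq[OF b aD(1)[OF uv(2)]] by simp
    finally show ?thesis using aD(2)[OF uv(1)] aD(2)[OF uv(2)] by simp
  qed
  have "realW 1 (K i + K i) ?\<phi> (h ` P)"
  proof (rule good_real[OF \<phi>])
    obtain C where C: "believes_finite W C" "ext W C = seq W ` tuples (ext W B) (K i + K i)"
      using bf_tuples[OF B(1)] by blast
    have "h (u, v) \<in> seq W ` tuples (ext W B) (K i + K i)" if "u \<in> ext W F" "v \<in> ext W F" for u v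
      unfolding h_def prod.case using a that by (intro imageI) (auto simp: tuples_def)
    then have hC: "h ` P \<subseteq> ext W C" using P(1) C(2) by auto
    then show "pseudofinite W (h ` P)" using C(1) by (auto simp: pseudofinite_def)
    have "tuples (ext W B) (K i + K i) \<subseteq> tuples DW (K i + K i)" using B(2) by (auto simp: tuples_def)
    then show "h ` P \<subseteq> seq W ` tuples DW (K i + K i)" using hC C(2) by blast
    show "|h ` P| \<le>o |lam|" by (rule ordLeq_transitive[OF card_of_image P(2)])
    fix s assume s: "s \<subseteq> h ` P" "finite s"
    from finite_subset_image[OF s(2,1)] obtain s' where s': "s' \<subseteq> P" "finite s'" "s = h ` s'" by blast
    obtain b where b: "b \<in> DW" "\<forall>(u, v)\<in>s'. R i b u \<and> \<not> R i b v" using fin[OF s'(1,2)] by blast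
    then have "\<forall>z\<in>s. srel W N 1 (K i + K i) ?\<phi> (seq W [b]) z"
      unfolding s'(3) using rel[OF b(1)] s'(1) P(1) by fastforce
    then show "realW 1 (K i + K i) ?\<phi> s" using b(1) unfolding realW_1 by blast
  qed
  then obtain b where b: "b \<in> DW" "\<forall>z\<in>h ` P. srel W N 1 (K i + K i) ?\<phi> (seq W [b]) z" unfolding realW_1 by blast
  have "R i b u \<and> \<not> R i b v" if "(u, v) \<in> P" for u v
    using rel[OF b(1), of u v] b(2) that P(1) by blast
  then show ?thesis using b(1) by blast
qed

theorem realized: "\<exists>b\<in>tuples (univ N) 1. satisfies_all N b p"
proof -
  let ?T = "\<lambda>(\<phi>, as). {b \<in> DW. sat N ((!) ([b] @ as)) \<phi>}"
  have "DW \<inter> \<Inter>H \<noteq> {}" if H: "finite H" "H \<subseteq> ?T ` p" for H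
  proof -
    from finite_subset_image[OF H] obtain q where q: "q \<subseteq> p" "finite q" "H = ?T ` q" by blast
    then obtain b where b: "b \<in> tuples DW 1" "satisfies_all N b q" using p unfolding complete_type_def univ_N by meson
    then obtain x where x: "b = [x]" "x \<in> DW" by (auto simp: tuples_def length_Suc_conv)
    then have "x \<in> DW \<inter> \<Inter>H" using b(2) unfolding q(3) satisfies_all_def by auto
    then show ?thesis by blast
  qed
  then obtain U where U: "?T ` p \<subseteq> U" "\<And>H. finite H \<Longrightarrow> H \<subseteq> U \<Longrightarrow> DW \<inter> \<Inter>H \<noteq> {}" "\<And>S. S \<in> U \<or> DW - S \<in> U"
    by (rule ultrafilter_extension) (assumption, assumption, rule that)
  \<comment> \<open>Maximality would otherwise put the complement of the intersection into
    \<open>U\<close>, against the finite intersection property.\<close>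
  have U_int: "S \<inter> S' \<in> U" if "S \<in> U" "S' \<in> U" for S S'
  proof (rule ccontr)
    assume "S \<inter> S' \<notin> U"
    then have "{S, S', DW - S \<inter> S'} \<subseteq> U" using U(3) that by blast
    then have "DW \<inter> \<Inter>{S, S', DW - S \<inter> S'} \<noteq> {}" by (intro U(2)) auto
    then show False by blast
  qed
  have set_R: "{b \<in> DW. R i b (seq W as)} = ?T (psi i, as)" if "as \<in> tuples DW (K i)" for i as
    using R_seq[OF _ that] by auto
  have AD: "as \<in> tuples DW k" if "as \<in> tuples (ext W Ahat) k" for as k using that Ahat(2) by (auto simp: tuples_def)
  have "\<exists>b\<in>DW. \<forall>i. \<forall>z\<in>X i. R i b z"
  proof (rule type_core.realize_chain)
    show "type_core V W j (j (str_dom V M)) (\<lambda>i. j (power_elem V M (K i))) Y R X U lam"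
    proof (unfold_locales, unfold R_real R_min)
      show "infinite lam" by (rule inf)
      show "saturated (cardSuc natLeq) set_lang (set_struct W)" by (rule sat)
      show "NS \<noteq> {}" by (rule NS_ne)
      fix i
      have D: "WW.Def (\<lambda>e. srel W N 1 (K i) (psi i) (e 0) (e 1)) (\<lambda>e. srel W N 1 (K i) (psi i) (e 0) (e 1))"
        by (rule Def_target[OF Def_srel[OF psi_pf FDef_var FDef_var]])
      show "WW.Def (\<lambda>e. R i (e 0) (e 1)) (\<lambda>e. R i (e 0) (e 1))"
        unfolding R_def seq.simps by (intro WW.Def_lift2[OF D] WW.def_intros)
      show XY: "X i \<subseteq> ext W (Y i)" using Ahat(3) by (auto simp: X_def Y(2) tuples_def)
      show "ext W (Y i) \<subseteq> ext W (j (power_elem V M (K i)))"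
        unfolding Y(2) ext_power_elem_W using AD by blast
      show "believes_finite W (Y i)" by (rule Y(1))
      have "|{as \<in> tuples A (K i). (psi i, as) \<in> p}| \<le>o |tuples A (K i)|" by (rule card_of_mono1) auto
      then show "|X i| \<le>o |lam|" unfolding X_def
        using ordLeq_transitive[OF card_of_image ordLeq_transitive[OF _ card_of_tuples[OF inf A(3)]]] by blast
    next
      show "DW \<inter> \<Inter>H \<noteq> {}" if "finite H" "H \<subseteq> U" for H by (rule U(2)[OF that])
      show "S \<in> U \<or> DW - S \<in> U" for S by (rule U(3))
      show "{b \<in> DW. R i b z} \<in> U" if "z \<in> X i" for z i
      proof -
        obtain as where as: "as \<in> tuples A (K i)" "(psi i, as) \<in> p" "z = seq W as" using \<open>z \<in> X i\<close> by (auto simp: X_def)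
        have "?T (psi i, as) \<in> U" using U(1) as(2) by blast
        moreover have "as \<in> tuples DW (K i)" using as(1) A_tuples by blast
        ultimately show ?thesis using set_R as(3) by simp
      qed
    next
      fix z i assume "z \<in> ext W (Y i)"
      then obtain as where as: "as \<in> tuples (ext W Ahat) (K i)" "z = seq W as" by (auto simp: Y(2))
      \<comment> \<open>The successor of \<open>z\<close> in the chain is \<open>z\<close> padded
        with these parameters. The added conjunct belongs to the type and hence its solution set to
        \<open>U\<close>, so being in \<open>X\<close> and having a solution set in \<open>U\<close>
        are both inherited.\<close>
      let ?c = "c (Suc i)"
      have lc: "length as = K i" using as(1) by (simp add: tuples_def)
      have cA: "as @ ?c \<in> tuples (ext W Ahat) (K (Suc i))"
        using as(1) c_tuples[of "Suc i"] Ahat(3) by (auto simp: tuples_def)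
      have impl: "R (Suc i) b (seq W (as @ ?c)) \<longleftrightarrow> R i b z \<and> sat N ((!) ([b] @ ?c)) (chi (Suc i))" if "b \<in> DW" for b
        using R_seq[OF that AD[OF cA]] R_seq[OF that AD[OF as(1)]] sat_psi_Suc[OF lc] as(2) by simp
      have "seq W (as @ ?c) \<in> X (Suc i)" if "z \<in> X i"
      proof -
        obtain as' where as': "as' \<in> tuples A (K i)" "(psi i, as') \<in> p" "z = seq W as'" using \<open>z \<in> X i\<close> by (auto simp: X_def)
        then have "as' = as" using as lc by (metis (mono_tags) W.seq_inject mem_Collect_eq tuples_def)
        then have "(psi (Suc i), as @ ?c) \<in> p" using psi_p[of i as ?c] as' lc c[of "Suc i"] by simp
        moreover have "as @ ?c \<in> tuples A (K (Suc i))"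
          using as'(1) \<open>as' = as\<close> c_tuples[of "Suc i"] by (auto simp: tuples_def)
        ultimately show ?thesis by (auto simp: X_def)
      qed
      moreover have "{b \<in> DW. R (Suc i) b (seq W (as @ ?c))} \<in> U" if "{b \<in> DW. R i b z} \<in> U"
      proof -
        have "?T (chi (Suc i), ?c) \<in> U" using U(1) c(2)[of "Suc i"] by blast
        from U_int[OF that this] have "{b \<in> DW. R i b z} \<inter> ?T (chi (Suc i), ?c) \<in> U" .
        also have "{b \<in> DW. R i b z} \<inter> ?T (chi (Suc i), ?c) = {b \<in> DW. R (Suc i) b (seq W (as @ ?c))}"
          using impl by auto
        finally show ?thesis .
      qed
      ultimately show "\<exists>z'\<in>ext W (Y (Suc i)). (z \<in> X i \<longrightarrow> z' \<in> X (Suc i)) \<and>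
        (\<forall>b\<in>DW. R (Suc i) b z' \<longrightarrow> R i b z) \<and> ({b \<in> DW. R i b z} \<in> U \<longrightarrow> {b \<in> DW. R (Suc i) b z'} \<in> U)"
        using cA impl by (intro bexI[of _ "seq W (as @ ?c)"]) (simp_all add: Y(2))
    next
      fix Z i assume Z: "pseudofinite W Z" "Z \<subseteq> ext W (j (power_elem V M (K i)))" "|Z| \<le>o |lam|"
        "\<And>s. s \<subseteq> Z \<Longrightarrow> finite s \<Longrightarrow> realW 1 (K i) (psi i) s"
      show "realW 1 (K i) (psi i) Z"
        by (rule good_real[OF psi_pf Z(1) _ Z(3,4)]) (use Z(2) in \<open>simp_all only: ext_power_elem_W\<close>)
    next
      fix F i P assume "believes_finite W F" "ext W F \<subseteq> ext W (j (power_elem V M (K i)))"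
        "P \<subseteq> ext W F \<times> ext W F" "|P| \<le>o |lam|"
        "\<And>s. s \<subseteq> P \<Longrightarrow> finite s \<Longrightarrow> \<exists>b\<in>DW. \<forall>(u, v)\<in>s. R i b u \<and> \<not> R i b v"
      then show "\<exists>b\<in>DW. \<forall>(u, v)\<in>P. R i b u \<and> \<not> R i b v"
        unfolding ext_power_elem_W by (rule local_difference)
    next
      fix F i assume "believes_finite W F" "ext W F \<subseteq> ext W (j (power_elem V M (K i)))" "\<not> realW 1 (K i) (psi i) (ext W F)"
      then show "\<exists>G. ext W G \<subseteq> ext W F \<and> minW 1 (K i) (psi i) G" by (rule ex_minW[OF psi_pf])
    next
      fix i F n assume "minW 1 (K i) (psi i) F" "at_least n (ext W F)"
      then show "\<exists>G. minW 1 (K i) (psi i) G \<and> at_least n (ext W G) \<and> finite (ext W G)"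
        by (rule reflect_minW[OF psi_pf])
    qed
  qed
  then obtain b where b: "b \<in> DW" "\<And>i z. z \<in> X i \<Longrightarrow> R i b z" by blast
  have psi_b: "sat N ((!) ([b] @ as)) (psi i)" if as: "(psi i, as) \<in> p" "length as = K i" for i as
  proof -
    have "as \<in> tuples A (K i)" using in_param[OF p as(1)] as(2) by (auto simp: param_formulas_def tuples_def)
    then show ?thesis using b as R_seq[OF b(1), of as i] A_tuples by (auto simp: X_def)
  qed
  have "sat N ((!) ([b] @ as)) \<phi>" if \<phi>: "(\<phi>, as) \<in> p" for \<phi> as
  proof -
    obtain i where i: "chi i = \<phi>" "kk i = length as" using Idx_surj[OF \<phi>] by blast
    show ?thesis
    proof (cases i)
      case 0
      then show ?thesis using psi_b[of 0 as] \<phi> i by simp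
    next
      case (Suc i')
      obtain w where w: "length w = K i'" "(psi i', w) \<in> p" using ex_prefix by blast
      have "(psi i, w @ as) \<in> p" using psi_p[OF w(2,1), of as] \<phi> i Suc by simp
      then have "sat N ((!) ([b] @ w @ as)) (psi i)" using psi_b[of i "w @ as"] w i Suc by simp
      then show ?thesis using sat_psi_Suc[OF w(1)] i Suc by simp
    qed
  qed
  then show ?thesis using b(1) by (intro bexI[of _ "[b]"]) (auto simp: satisfies_all_def tuples_def)
qed

end

context ext_model begin

lemma lambda_loc_1_le_theory:
  assumes T: "complete_theory_in V L T" and sat: "saturated (cardSuc natLeq) set_lang (set_struct W)" and NS: "NS \<noteq> {}"
  shows "lambda_loc_n V W j L T 1 \<le> lambda_theory V W j L T"
proof (rule ccontr)
  assume neg: "\<not> ?thesis"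
  then obtain c where c: "lambda_theory V W j L T = Cardinal c" by (cases "lambda_theory V W j L T") auto
  then obtain X0 where X0: "c = cardinality X0" "infinite X0" "\<not> pseudosaturates V W j (cardSuc |X0| ) L T"
    unfolding lambda_theory_def by (auto dest!: least_cardinal_holds)
  define M0 where "M0 = (SOME M. is_model V L T M)"
  have M0: "is_model V L T M0" unfolding M0_def by (rule someI_ex) (use T in \<open>simp add: complete_theory_in_def\<close>)
  interpret S: struct_emb V W j L M0 using M0 by unfold_locales (simp add: is_model_def)
  have good: "\<not> S.bad 1 k \<phi> Z" if \<phi>: "\<phi> \<in> partitioned_formulas L 1 k" and Z: "|Z| \<le>o |X0|" for k \<phi> Z
  proof
    assume "S.bad 1 k \<phi> Z"
    then have "lambda_formula V W j L T 1 k \<phi> \<le> Cardinal c"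
      unfolding lambda_formula_def Let_def M0_def[symmetric] S.lambda_pattern_delta[OF \<phi>]
      using Z X0(1) by (intro least_cardinal_le) (auto simp: cardinality_le_iff)
    moreover have "lambda_loc_n V W j L T 1 \<le> lambda_formula V W j L T 1 k \<phi>"
      unfolding lambda_loc_n_def using \<phi> by (intro Least_le) blast
    ultimately show False using neg c by simp
  qed
  have "pseudosaturated W (cardSuc |X0| ) L S.N"
    unfolding pseudosaturated_def realizes_types_over_def
  proof (intro allI impI, elim conjE)
    fix A n p assume A: "A \<subseteq> univ S.N" "pseudofinite W A" "|A| <o cardSuc |X0|" and p: "complete_type L S.N A n p"
    have cA: "|A| \<le>o |X0|" using A(3) by (simp add: cardSuc_ordLeq_ordLess card_of_Card_order)
    show "\<exists>b\<in>tuples (univ S.N) n. satisfies_all S.N b p"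
    \<comment> \<open>Each realized coordinate adds one parameter, and since \<open>X0\<close> is
      infinite the bound on cardinality survives.\<close>
    proof (rule realize_types_by_1types[where P = "\<lambda>A. pseudofinite W A \<and> |A| \<le>o |X0|", OF _ _ A(1) _ p])
      show "pseudofinite W A \<and> |A| \<le>o |X0|" using A(2) cA by simp
      fix A' x assume A': "pseudofinite W A' \<and> |A'| \<le>o |X0|"
      have "|{x} \<union> A'| \<le>o |X0|"
        using A' X0(2) finite_ordLeq_infinite[of "{x}" X0]
        by (intro card_of_Un_ordLeq_infinite_Field) (simp_all add: Field_card_of card_of_card_order_on)
      then show "pseudofinite W (insert x A') \<and> |insert x A'| \<le>o |X0|" using A' pseudofinite_insert by simp
    next
      fix A' q assume "A' \<subseteq> univ S.N" "pseudofinite W A' \<and> |A'| \<le>o |X0|" "complete_type L S.N A' 1 q"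
      then interpret one_type V W j L M0 A' q X0
        using X0(2) sat NS good by unfold_locales auto
      show "\<exists>b\<in>tuples (univ S.N) 1. satisfies_all S.N b q" by (rule realized)
    qed
  qed
  then show False using X0(3) M0 by (auto simp: pseudosaturates_def)
qed

end

theorem theorem3p7:
  fixes V :: "'v \<Rightarrow> 'v \<Rightarrow> bool"
    and W :: "'w \<Rightarrow> 'w \<Rightarrow> bool"
    and j :: "'v \<Rightarrow> 'w"
    and L :: "sym set"
    and T :: "fm set"
  assumes "transitive_zfc_minus V"
    and "elementary_embedding set_lang (set_struct V) (set_struct W) j"
    and "omega_nonstandard W"
    and "complete_theory_in V L T"
  shows "lambda_theory V W j L T \<le> lambda_loc V W j L T \<and>
    (saturated (cardSuc natLeq) set_lang (set_struct W) \<longrightarrow>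
       lambda_theory V W j L T = lambda_loc V W j L T \<and>
       lambda_loc V W j L T = lambda_loc_n V W j L T 1)"
proof -
  interpret ext_model V W j
    using assms(1,2) by (simp add: ext_model_def zfc_model_def elem_emb_def)
  have le: "lambda_theory V W j L T \<le> lambda_loc V W j L T" by (rule lambda_theory_le_loc[OF assms(4)])
  obtain n where n: "W n (omega W)" "infinite (ext W n)" using assms(3) by (auto simp: omega_nonstandard_def)
  \<comment> \<open>A standard numeral has finitely many elements.\<close>
  then have "n \<in> NS" by (auto simp: NS_def W.ext_num)
  then have "NS \<noteq> {}" by blast
  have loc: "lambda_loc V W j L T \<le> lambda_loc_n V W j L T 1" unfolding lambda_loc_def by (rule Least_le) blast
  show ?thesis
  proof (intro conjI impI)
    show "lambda_theory V W j L T \<le> lambda_loc V W j L T" by (rule le)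
    assume "saturated (cardSuc natLeq) set_lang (set_struct W)"
    from lambda_loc_1_le_theory[OF assms(4) this \<open>NS \<noteq> {}\<close>]
    have "lambda_loc_n V W j L T 1 \<le> lambda_theory V W j L T" .
    then show "lambda_theory V W j L T = lambda_loc V W j L T" "lambda_loc V W j L T = lambda_loc_n V W j L T 1"
      using le loc by simp_all
  qed
qed

end
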